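(* Assume the following. (A1) $\Sigma$ is invertible; $X$ is the stationary solution of the SDDE, i.e. $X_0^{\mathrm{seg}}\sim\pi^{\mathrm{seg}}$ independent of $W$; and $m_G^2:=\mathbb E_\pi\|G(Z_0)\|^2<\infty$. (A2) Each $f_j:\mathbb R^{D(q+1)}\to\mathbb R$ is locally Lipschitz (jointly in all its arguments), and there are $c_K\in\mathbb R^D$, $R_K>0$, $\beta_K>0$ such that, with $c_K^{(q)}=(c_K,\dots,c_K)$, $\langle x_0-c_K,G(z)\rangle\le\beta_K(1+\|z-c_K^{(q)}\|^2)$ for all $z=(x_0,\dots,x_q)$ with $\|z-c_K^{(q)}\|\ge R_K$. (A3) There are $c\in\mathbb R^D$, $R,\alpha,C_R\ge0$ and $\beta_0,\dots,\beta_q,\varepsilon_1,\dots,\varepsilon_q\ge0$ such that for all $z=(x_0,\dots,x_q)\in\mathbb R^{D(q+1)}$: $\langle x_0-c,G(z)\rangle\le\alpha-\beta_0\|x_0-c\|^2+\sum_{a=1}^q\beta_a\|x_a-c\|^2$ if $\|x_0-c\|\ge R$; $\langle x_0-c,G(z)\rangle\le C_R+\sum_{a=1}^q\varepsilon_a\|x_a-c\|^2$ if $\|x_0-c\|\le R$; and $\sum_{a=1}^q(\beta_a+\varepsilon_a)<\beta_0$. (A4) $\mathcal H_n^q$ is a deterministic set of pairs $(\widetilde G,\tilde M)$, with $\tilde M\in\{0,1\}^{D\times D\times(q+1)}$ and $\widetilde G_j(x_0,\dots,x_q)=\widetilde f_j(\tilde m_j^0\odot x_0,\dots,\tilde m_j^q\odot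 x_q)$ with $\widetilde f_j$ continuous; it contains $(G,M)$, and every member has $\mathcal R_T(\widetilde G)<\infty$. For every $\rho\ge1$ and $\epsilon>0$, there is a finite subset of drifts from the class (an internal $\epsilon$-net) such that each drift in the class is within sup-distance $\epsilon$ on $K_\rho=\{z:\|z-c^{(q)}\|\le\rho\}$ of one of its members; $N_n(\rho,\epsilon)$ is the minimal cardinality of such a subset. The pointwise diameter $\mathcal E(z)=\sup_{\widetilde G_1,\widetilde G_2\in\mathcal H_n^q}\|\widetilde G_1(z)-\widetilde G_2(z)\|$ satisfies $m_{\mathcal E}^2:=\int\mathcal E(z)^2\mu_\infty^q(dz)<\infty$. Let $T>\tau_{\max}$ and $\delta\in(0,1)$. Choose an integer $p\ge1$ and $\epsilon>0$, and set $$\eta=\delta/6,\quad J=\max\{1,\lceil T_\circ\rceil\},\quad \rho\ge\max\Bigl\{1,\Bigl(\tfrac{J(q+1)^pS_p}{\eta}\Bigr)^{1/(2p)}\Bigr\},$$ $$b=\max\Bigl\{1,\tfrac1{\lambda_{\mathrm{erg}}}\log\tfrac{C_\beta J}{\eta}\Bigr\},\quad N=N_n(\rho,\epsilon),\quad \Lambda=\log\tfrac{4N}{\eta},$$ $$\begin{aligned}\varepsilon_n(\delta;\rho,\epsilon)={}&\frac{2m_{\mathcal E}T_\circ}{\eta}\,\omega_G(\Delta_{\max})+2\sigma_{\mathrm{op}}E_\rho\sqrt{2T_\circ\Lambda}+\frac{2\epsilon\sigma_F}{\eta}\sum_k\sqrt{\Delta_k}\\&+E_\rho^2\sqrt{2T_\circ(b+\Delta_{\max})\Lambda}+4E_\rho\epsilon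 T_\circ+v_\rho T_\circ .\end{aligned}$$ Then, with $\mathbb P_\pi$-probability at least $1-\delta$, $$\sup_{(\widetilde G,\tilde M)\in\mathcal H_n^q}\Bigl|\bigl[\widehat{\mathcal R}_n(\widetilde G)-\widehat{\mathcal R}_n(G)\bigr]-\mathcal R_T(\widetilde G)\Bigr|\le\varepsilon_n(\delta;\rho,\epsilon).$$ Suppose additionally that $M\ne0$, $s_{\min}>0$ and $0<\lambda<T_\circ s_{\min}^2/d_{\max}$, so that $\gamma(\lambda):=\min\{\lambda,\,T_\circ s_{\min}^2-\lambda d_{\max}\}>0$. If $\varepsilon_n(\delta;\rho,\epsilon)<\gamma(\lambda)$, then every measurable minimizer $$(\widehat G,\widehat M)\in\operatorname*{arg\,min}_{(\widetilde G,\tilde M)\in\mathcal H_n^q}\Bigl\{\widehat{\mathcal R}_n(\widetilde G)+\lambda\sum_{a=0}^q\|\tilde M^a\|_0\Bigr\}$$ (such a measurable global minimizer being assumed to exist) satisfies $$\mathbb P_\pi\Bigl(\widehat M^a=M^a\ \text{for all }a=0,\dots,q,\quad \|\widehat G-G\|^2_{L^2(\mu_\infty^q)}\le\frac{\varepsilon_n(\delta;\rho,\epsilon)}{T_\circ}\Bigr)\ge1-\delta .$$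
   Context: Setting. Fix integers $D\ge1$, $q\ge0$ and delays $0<\tau_1<\dots<\tau_q$; $\tau_{\max}=\tau_q$ (with $\tau_{\max}=0$ if $q=0$). $\mathcal C=C([-\tau_{\max},0];\mathbb R^D)$ with $\|\varphi\|_{\mathcal C}=\sup_s\|\varphi(s)\|$ (for $q=0$, $\mathcal C=\mathbb R^D$). The SDDE is $dX_t=G(X_t,X_{t-\tau_1},\dots,X_{t-\tau_q})\,dt+\Sigma\,dW_t$ with $W$ a standard $D$-dimensional Brownian motion, $\Sigma\in\mathbb R^{D\times D}$, and $G_j(x_0,\dots,x_q)=f_j(m_j^0\odot x_0,\dots,m_j^q\odot x_q)$, where $M=(M^a_{ij})\in\{0,1\}^{D\times D\times(q+1)}$ is the true mask ($0\le a\le q$), $m_j^a$ is the $j$-th column of $M^a$ (likewise $\tilde m^a_j$ for $\tilde M$), and $\odot$ is the entrywise product. $X_t^{\mathrm{seg}}(s)=X_{t+s}$ for $s\in[-\tau_{\max},0]$, and $Z_t=(X_t,X_{t-\tau_1},\dots,X_{t-\tau_q})$. The constant $c$ is that of (A3), also used for the constant segment with value $c$; $c^{(q)}=(c,\dots,c)\in\mathbb R^{D(q+1)}$. $\|\cdot\|_0$ counts nonzero entries. Stationarity. Under the assumptions, the segment process is a Markov process on $\mathcal C$ with a unique invariant probability measure $\pi^{\mathrm{seg}}$, which has all polynomial moments of $\|\cdot-c\|_{\mathcal C}$. $\mathbb P_\pi,\mathbb E_\pi$ refer to $X_0^{\mathrm{seg}}\sim\pi^{\mathrm{seg}}$ independent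 of $W$; $\mu_\infty^q$ is the stationary law of $Z_t$ on $\mathbb R^{D(q+1)}$. Observations. The grid $0=t_0<t_1<\dots<t_n=T$ is deterministic, $\Delta_k=t_{k+1}-t_k$, $\Delta_{\max}=\max_{k<n}\Delta_k\le1$. It is assumed that $\tau_{\max}$ is a grid point and that $X_{t_k-\tau_a}$ is observed exactly for every $a$ and every $t_k\ge\tau_{\max}$. All sums over $k$ are over $k<n$ with $t_k\ge\tau_{\max}$. $Z_k:=Z_{t_k}$ and $T_\circ:=\sum_k\Delta_k=T-\tau_{\max}$. Risks. $\widehat{\mathcal R}_n(\widetilde G)=\sum_k\Delta_k\bigl\|\frac{X_{t_{k+1}}-X_{t_k}}{\Delta_k}-\widetilde G(Z_k)\bigr\|^2$ and $\mathcal R_T(\widetilde G)=T_\circ\|\widetilde G-G\|^2_{L^2(\mu_\infty^q)}$. Signal quantities. For $M^a_{ij}=1$, $s_{ij}^a=\|G_j-\Pi_{-(i,a)}G_j\|_{L^2(\mu_\infty^q)}$, where $\Pi_{-(i,a)}$ is the $L^2(\mu_\infty^q)$-orthogonal projection onto the closed subspace of functions of all coordinates except coordinate $i$ of block $a$; $s_{\min}=\min\{s_{ij}^a:M_{ij}^a=1\}$; $d_{\max}=\max_j\sum_{a=0}^q\|m_j^a\|_0$. Constants. $\omega_G(h)=\sup_{0\le u\le h}(\mathbb E_\pi\|G(Z_u)-G(Z_0)\|^2)^{1/2}$; $E_\rho=\max\{1,\sup_{z\in K_\rho}\mathcal E(z)\}$; $v_\rho=\int_{K_\rho^c}\mathcal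 E(z)^2\mu_\infty^q(dz)$; $\sigma_{\mathrm{op}}=\|\Sigma\|_{\mathrm{op}}$; $\sigma_F=\sqrt{\operatorname{tr}(\Sigma\Sigma^\top)}$; $S_p=\mathbb E_\pi\sup_{0\le u\le1}\|X_u^{\mathrm{seg}}-c\|_{\mathcal C}^{2p}$ (finite). Mixing constants. For sub-$\sigma$-algebras, $\beta(\mathcal A,\mathcal B)=\sup\frac12\sum_{i,j}|\mathbb P(A_i\cap B_j)-\mathbb P(A_i)\mathbb P(B_j)|$ over finite $\mathcal A$-measurable partitions $\{A_i\}$ and $\mathcal B$-measurable partitions $\{B_j\}$ of $\Omega$; $\beta_Z(u)=\sup_{s\ge0}\beta(\sigma(Z_r:0\le r\le s),\sigma(Z_r:r\ge s+u))$ under $\mathbb P_\pi$. $C_\beta<\infty$ and $\lambda_{\mathrm{erg}}>0$ are constants with $\beta_Z(u)\le C_\beta e^{-\lambda_{\mathrm{erg}}u}$ for all $u>0$. One may take $\lambda_{\mathrm{erg}}=\gamma$ and $C_\beta=C(1+\int\|\varphi-c\|_{\mathcal C}^2\,\pi^{\mathrm{seg}}(d\varphi))$, where $C\ge1,\gamma>0$ are constants such that the transition kernels $P_t$ of the segment process satisfy $\sup_A|P_t(\varphi,A)-\pi^{\mathrm{seg}}(A)|\le Ce^{-\gamma t}(1+\|\varphi-c\|_{\mathcal C}^2)$ for all $t\ge0$, $\varphi\in\mathcal C$ (such constants exist under the assumptions). *)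

theory Defs
  imports "HOL-Probability.Probability"
begin

text \<open>
  The state space is \<open>real^'d\<close>, and a vector \<open>z = (x_0, ..., x_q)\<close> is an element of
  \<open>real^'d^'b\<close> with blocks \<open>z $ a\<close>.  The type \<open>'b\<close> of block labels is finite and linearly
  ordered, so it stands for \<open>{0, ..., q}\<close> with \<open>q = CARD('b) - 1\<close>; \<open>q = 0\<close> is the case
  \<open>CARD('b) = 1\<close>.  The norm of \<open>real^'d^'b\<close> is the Euclidean norm of dimension \<open>D (q + 1)\<close>.
\<close>

abbreviation block0 :: "'b::{finite,linorder}" where
  "block0 \<equiv> Min UNIV"

text \<open>The family \<open>\<tau>\<close> contains the trivial delay of block 0.\<close>

definition is_delays :: "('b::{finite,linorder} \<Rightarrow> real) \<Rightarrow> bool" where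
  "is_delays \<tau> \<longleftrightarrow> \<tau> block0 = 0 \<and> strict_mono \<tau>"

definition tau_max :: "('b::{finite,linorder} \<Rightarrow> real) \<Rightarrow> real" where
  "tau_max \<tau> = \<tau> (Max UNIV)"

definition delay_vec :: "('b::finite \<Rightarrow> real) \<Rightarrow> (real \<Rightarrow> 'a) \<Rightarrow> real \<Rightarrow> 'a^'b" where
  "delay_vec \<tau> x t = (\<chi> a. x (t - \<tau> a))"

definition is_mask :: "real^'d^'d^'b \<Rightarrow> bool" where
  "is_mask m \<longleftrightarrow> (\<forall>a i j. m $ a $ i $ j \<in> {0, 1})"

text \<open>Multiplication of vectors in \<open>real^'d\<close> is the entrywise product.\<close>

definition masked_drift ::
  "('d::finite \<Rightarrow> real^'d^'b \<Rightarrow> real) \<Rightarrow> real^'d^'d^'b \<Rightarrow> real^'d^'b \<Rightarrow> real^'d" where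
  "masked_drift f m z = (\<chi> j. f j (\<chi> a. column j (m $ a) * (z $ a)))"

definition vec_l0 :: "real^'d \<Rightarrow> nat" where
  "vec_l0 v = card {i. v $ i \<noteq> 0}"

definition mat_l0 :: "real^'d^'d \<Rightarrow> nat" where
  "mat_l0 A = card {(i, j). A $ i $ j \<noteq> 0}"

definition d_max :: "real^'d^'d^'b \<Rightarrow> nat" where
  "d_max m = Max (range (\<lambda>j. \<Sum>a\<in>UNIV. vec_l0 (column j (m $ a))))"

definition locally_lipschitz :: "('a::metric_space \<Rightarrow> 'c::metric_space) \<Rightarrow> bool" where
  "locally_lipschitz g \<longleftrightarrow> (\<forall>z. \<exists>r>0. \<exists>L. L-lipschitz_on (ball z r) g)"

definition coercive_drift :: "(real^'d^'b::{finite,linorder} \<Rightarrow> real^'d) \<Rightarrow> bool" where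
  "coercive_drift G \<longleftrightarrow> (\<exists>cK RK \<beta>K. RK > 0 \<and> \<beta>K > 0 \<and>
     (\<forall>z. norm (z - (\<chi> a. cK)) \<ge> RK \<longrightarrow>
        (z $ block0 - cK) \<bullet> G z \<le> \<beta>K * (1 + (norm (z - (\<chi> a. cK)))\<^sup>2)))"

definition dissipative_drift ::
  "real^'d \<Rightarrow> (real^'d^'b::{finite,linorder} \<Rightarrow> real^'d) \<Rightarrow> bool" where
  "dissipative_drift c G \<longleftrightarrow> (\<exists>R \<alpha> CR. \<exists>\<beta> \<epsilon> :: 'b \<Rightarrow> real.
     R \<ge> 0 \<and> \<alpha> \<ge> 0 \<and> CR \<ge> 0 \<and> (\<forall>a. \<beta> a \<ge> 0) \<and> (\<forall>a. a \<noteq> block0 \<longrightarrow> \<epsilon> a \<ge> 0) \<and>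
     (\<forall>z. norm (z $ block0 - c) \<ge> R \<longrightarrow>
        (z $ block0 - c) \<bullet> G z \<le> \<alpha> - \<beta> block0 * (norm (z $ block0 - c))\<^sup>2
          + (\<Sum>a\<in>UNIV - {block0}. \<beta> a * (norm (z $ a - c))\<^sup>2)) \<and>
     (\<forall>z. norm (z $ block0 - c) \<le> R \<longrightarrow>
        (z $ block0 - c) \<bullet> G z \<le> CR
          + (\<Sum>a\<in>UNIV - {block0}. \<epsilon> a * (norm (z $ a - c))\<^sup>2)) \<and>
     (\<Sum>a\<in>UNIV - {block0}. \<beta> a + \<epsilon> a) < \<beta> block0)"

text \<open>
  An element of \<open>C([-h, 0]; \<real>\<^sup>D)\<close> is a function that is continuous on \<open>{-h..0}\<close> and \<open>undefined\<close>
  elsewhere.  The sigma-algebra is generated by the point evaluations; it is the Borel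
  sigma-algebra of the sup norm because \<open>C([-h, 0]; \<real>\<^sup>D)\<close> is separable.
\<close>

definition segment_space :: "real \<Rightarrow> (real \<Rightarrow> real^'d) measure" where
  "segment_space h = restrict_space (PiM {-h..0} (\<lambda>_. borel)) {\<phi>. continuous_on {-h..0} \<phi>}"

definition segment :: "real \<Rightarrow> (real \<Rightarrow> real^'d) \<Rightarrow> real \<Rightarrow> real \<Rightarrow> real^'d" where
  "segment h x t = (\<lambda>s\<in>{-h..0}. x (t + s))"

definition segment_norm :: "real \<Rightarrow> (real \<Rightarrow> real^'d) \<Rightarrow> real" where
  "segment_norm h \<phi> = (SUP s\<in>{-h..0}. norm (\<phi> s))"

definition is_filtration :: "'w measure \<Rightarrow> (real \<Rightarrow> 'w measure) \<Rightarrow> bool" where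
  "is_filtration M F \<longleftrightarrow>
     (\<forall>t\<ge>0. subalgebra M (F t)) \<and> (\<forall>s\<ge>0. \<forall>t\<ge>s. sets (F s) \<subseteq> sets (F t))"

definition brownian_motion ::
  "'w measure \<Rightarrow> (real \<Rightarrow> 'w measure) \<Rightarrow> (real \<Rightarrow> 'w \<Rightarrow> real^'d) \<Rightarrow> bool" where
  "brownian_motion M F W \<longleftrightarrow>
     is_filtration M F \<and>
     (\<forall>t\<ge>0. W t \<in> borel_measurable (F t)) \<and>
     (\<forall>\<omega>\<in>space M. W 0 \<omega> = 0 \<and> continuous_on {0..} (\<lambda>t. W t \<omega>)) \<and>
     (\<forall>s\<ge>0. \<forall>t>s.
        prob_space.indep_set M (sets (F s))
          {(\<lambda>\<omega>. W t \<omega> - W s \<omega>) -` B \<inter> space M | B. B \<in> sets borel} \<and>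
        prob_space.indep_vars M (\<lambda>_. borel) (\<lambda>i \<omega>. (W t \<omega> - W s \<omega>) $ i) UNIV \<and>
        (\<forall>i. distributed M lborel (\<lambda>\<omega>. (W t \<omega> - W s \<omega>) $ i)
               (normal_density 0 (sqrt (t - s)))))"

text \<open>
  The noise is additive, so the stochastic integral of the constant matrix \<open>S\<close> is \<open>S *v W\<close> and
  the equation is a pathwise integral equation.
\<close>

definition sdde_solution ::
  "'w measure \<Rightarrow> (real \<Rightarrow> 'w measure) \<Rightarrow> ('b::{finite,linorder} \<Rightarrow> real) \<Rightarrow>
   ((real^'d, 'b) vec \<Rightarrow> real^'d) \<Rightarrow> real^'d^'d \<Rightarrow> (real \<Rightarrow> 'w \<Rightarrow> real^'d) \<Rightarrow>
   (real \<Rightarrow> 'w \<Rightarrow> real^'d) \<Rightarrow> bool" where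
  "sdde_solution M F \<tau> G S W X \<longleftrightarrow>
     (\<forall>t\<ge>- tau_max \<tau>. X t \<in> borel_measurable (F (max 0 t))) \<and>
     (\<forall>\<omega>\<in>space M. continuous_on {- tau_max \<tau>..} (\<lambda>t. X t \<omega>)) \<and>
     (AE \<omega> in M. \<forall>t\<ge>0.
        ((\<lambda>s. G (delay_vec \<tau> (\<lambda>r. X r \<omega>) s)) has_integral (X t \<omega> - X 0 \<omega> - S *v W t \<omega>)) {0..t})"

text \<open>
  \<open>P t \<phi>\<close> are the transition kernels of the segment process: every solution has the Markov
  property \<open>\<P>(seg(s + t) \<in> A | F s) = P t (seg s) A\<close>, where \<open>seg s\<close> is its segment at time \<open>s\<close>.
\<close>

definition segment_kernel ::
  "'w measure \<Rightarrow> (real \<Rightarrow> 'w measure) \<Rightarrow> ('b::{finite,linorder} \<Rightarrow> real) \<Rightarrow>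
   ((real^'d, 'b) vec \<Rightarrow> real^'d) \<Rightarrow> real^'d^'d \<Rightarrow> (real \<Rightarrow> 'w \<Rightarrow> real^'d) \<Rightarrow>
   (real \<Rightarrow> (real \<Rightarrow> real^'d) \<Rightarrow> (real \<Rightarrow> real^'d) measure) \<Rightarrow> bool" where
  "segment_kernel M F \<tau> G S W P \<longleftrightarrow>
     (\<forall>t\<ge>0. P t \<in> segment_space (tau_max \<tau>) \<rightarrow>\<^sub>M prob_algebra (segment_space (tau_max \<tau>))) \<and>
     (\<forall>X. sdde_solution M F \<tau> G S W X \<longrightarrow>
        (\<forall>s\<ge>0. \<forall>t\<ge>0. \<forall>A\<in>sets (segment_space (tau_max \<tau>)). AE \<omega> in M.
           real_cond_exp M (F s)
             (indicator {\<omega>\<in>space M. segment (tau_max \<tau>) (\<lambda>r. X r \<omega>) (s + t) \<in> A}) \<omega>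
           = measure (P t (segment (tau_max \<tau>) (\<lambda>r. X r \<omega>) s)) A))"

definition invariant_measure ::
  "'s measure \<Rightarrow> (real \<Rightarrow> 's \<Rightarrow> 's measure) \<Rightarrow> 's measure \<Rightarrow> bool" where
  "invariant_measure C P \<pi> \<longleftrightarrow>
     \<pi> \<in> space (prob_algebra C) \<and> (\<forall>t\<ge>0. \<pi> \<bind> P t = \<pi>)"

definition stationary_solution ::
  "'w measure \<Rightarrow> (real \<Rightarrow> 'w measure) \<Rightarrow> ('b::{finite,linorder} \<Rightarrow> real) \<Rightarrow>
   ((real^'d, 'b) vec \<Rightarrow> real^'d) \<Rightarrow> real^'d^'d \<Rightarrow> (real \<Rightarrow> 'w \<Rightarrow> real^'d) \<Rightarrow>
   (real \<Rightarrow> real^'d) measure \<Rightarrow> (real \<Rightarrow> 'w \<Rightarrow> real^'d) \<Rightarrow> bool" where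
  "stationary_solution M F \<tau> G S W \<pi> X \<longleftrightarrow>
     sdde_solution M F \<tau> G S W X \<and>
     distr M (segment_space (tau_max \<tau>)) (\<lambda>\<omega>. segment (tau_max \<tau>) (\<lambda>r. X r \<omega>) 0) = \<pi> \<and>
     prob_space.indep_var M
       (segment_space (tau_max \<tau>)) (\<lambda>\<omega>. segment (tau_max \<tau>) (\<lambda>r. X r \<omega>) 0)
       (PiM {0..} (\<lambda>_. borel)) (\<lambda>\<omega>. \<lambda>t\<in>{0..}. W t \<omega>)"

definition stationary_law ::
  "('b::finite \<Rightarrow> real) \<Rightarrow> (real \<Rightarrow> real^'d) measure \<Rightarrow> (real^'d^'b) measure" where
  "stationary_law \<tau> \<pi> = distr \<pi> borel (\<lambda>\<phi>. delay_vec \<tau> \<phi> 0)"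

definition beta_coeff :: "'w measure \<Rightarrow> 'w measure \<Rightarrow> 'w measure \<Rightarrow> real" where
  "beta_coeff M A B =
     (SUP (p, r)\<in>{(p, r). finite p \<and> partition_on (space M) p \<and> p \<subseteq> sets A \<and>
                          finite r \<and> partition_on (space M) r \<and> r \<subseteq> sets B}.
        1/2 * (\<Sum>U\<in>p. \<Sum>V\<in>r. \<bar>measure M (U \<inter> V) - measure M U * measure M V\<bar>))"

definition generated_sigma ::
  "'w measure \<Rightarrow> real set \<Rightarrow> (real \<Rightarrow> 'w \<Rightarrow> 'a::topological_space) \<Rightarrow> 'w measure" where
  "generated_sigma M I Z =
     sigma (space M) {Z r -` B \<inter> space M | r B. r \<in> I \<and> B \<in> sets borel}"

definition beta_mixing ::
  "'w measure \<Rightarrow> (real \<Rightarrow> 'w \<Rightarrow> 'a::topological_space) \<Rightarrow> real \<Rightarrow> real" where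
  "beta_mixing M Z u =
     (SUP s\<in>{0..}. beta_coeff M (generated_sigma M {0..s} Z) (generated_sigma M {s + u..} Z))"

type_synonym ('d, 'b) hyp_class = "((real^'d^'b \<Rightarrow> real^'d) \<times> (real^'d^'d^'b)) set"

definition admissible_class :: "('d::finite, 'b::finite) hyp_class \<Rightarrow> bool" where
  "admissible_class H \<longleftrightarrow>
     (\<forall>(g, m)\<in>H. is_mask m \<and> (\<exists>f. (\<forall>j. continuous_on UNIV (f j)) \<and> g = masked_drift f m))"

definition internal_net ::
  "('d::finite, 'b::finite) hyp_class \<Rightarrow> (real^'d^'b) set \<Rightarrow> real \<Rightarrow>
   (real^'d^'b \<Rightarrow> real^'d) set \<Rightarrow> bool" where
  "internal_net H K \<epsilon> N \<longleftrightarrow> finite N \<and> N \<subseteq> fst ` H \<and>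
     (\<forall>g\<in>fst ` H. \<exists>g'\<in>N. \<forall>z\<in>K. norm (g z - g' z) \<le> \<epsilon>)"

definition covering_number ::
  "('d::finite, 'b::finite) hyp_class \<Rightarrow> (real^'d^'b) set \<Rightarrow> real \<Rightarrow> nat" where
  "covering_number H K \<epsilon> = (LEAST k. \<exists>N. internal_net H K \<epsilon> N \<and> card N = k)"

text \<open>The real supremum is that of a bounded set as soon as \<open>z\<close> lies in a set on which the drifts of
  \<open>H\<close> have a finite internal net.\<close>

definition class_diam ::
  "('d::finite, 'b::finite) hyp_class \<Rightarrow> real^'d^'b \<Rightarrow> real" where
  "class_diam H z = (SUP (g, g')\<in>fst ` H \<times> fst ` H. norm (g z - g' z))"

definition K_ball :: "real^'d \<Rightarrow> real \<Rightarrow> (real^'d^'b) set" where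
  "K_ball c \<rho> = {z. norm (z - (\<chi> a. c)) \<le> \<rho>}"

definition mesh :: "(nat \<Rightarrow> real) \<Rightarrow> nat \<Rightarrow> real" where
  "mesh t k = t (Suc k) - t k"

definition mesh_max :: "(nat \<Rightarrow> real) \<Rightarrow> nat \<Rightarrow> real" where
  "mesh_max t n = Max (mesh t ` {..<n})"

definition is_grid :: "(nat \<Rightarrow> real) \<Rightarrow> nat \<Rightarrow> real \<Rightarrow> bool" where
  "is_grid t n T \<longleftrightarrow> t 0 = 0 \<and> t n = T \<and> (\<forall>k<n. t k < t (Suc k))"

definition obs_index :: "('b::{finite,linorder} \<Rightarrow> real) \<Rightarrow> (nat \<Rightarrow> real) \<Rightarrow> nat \<Rightarrow> nat set" where
  "obs_index \<tau> t n = {k. k < n \<and> t k \<ge> tau_max \<tau>}"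

definition obs_time :: "('b::{finite,linorder} \<Rightarrow> real) \<Rightarrow> (nat \<Rightarrow> real) \<Rightarrow> nat \<Rightarrow> real" where
  "obs_time \<tau> t n = (\<Sum>k\<in>obs_index \<tau> t n. mesh t k)"

definition emp_risk ::
  "('b::{finite,linorder} \<Rightarrow> real) \<Rightarrow> (nat \<Rightarrow> real) \<Rightarrow> nat \<Rightarrow> (real \<Rightarrow> real^'d) \<Rightarrow>
   ((real^'d, 'b) vec \<Rightarrow> real^'d) \<Rightarrow> real" where
  "emp_risk \<tau> t n x g = (\<Sum>k\<in>obs_index \<tau> t n.
     mesh t k * (norm ((x (t (Suc k)) - x (t k)) /\<^sub>R mesh t k - g (delay_vec \<tau> x (t k))))\<^sup>2)"

definition L2_dist_sq ::
  "'a measure \<Rightarrow> ('a \<Rightarrow> 'c::real_normed_vector) \<Rightarrow> ('a \<Rightarrow> 'c) \<Rightarrow> real" where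
  "L2_dist_sq \<mu> g g' = (\<integral>z. (norm (g z - g' z))\<^sup>2 \<partial>\<mu>)"

text \<open>Representatives of the square-integrable functions of all coordinates but coordinate \<open>i\<close>
  of block \<open>a\<close>.\<close>

definition L2_omit :: "(real^'d^'b) measure \<Rightarrow> 'd \<Rightarrow> 'b \<Rightarrow> (real^'d^'b \<Rightarrow> real) set" where
  "L2_omit \<mu> i a = {v. v \<in> borel_measurable borel \<and> integrable \<mu> (\<lambda>z. (v z)\<^sup>2) \<and>
     (\<forall>z z'. (\<forall>b k. (k, b) \<noteq> (i, a) \<longrightarrow> z $ b $ k = z' $ b $ k) \<longrightarrow> v z = v z')}"

definition L2_proj :: "'a measure \<Rightarrow> ('a \<Rightarrow> real) set \<Rightarrow> ('a \<Rightarrow> real) \<Rightarrow> 'a \<Rightarrow> real" where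
  "L2_proj \<mu> V g = (SOME p. p \<in> V \<and> (\<forall>v\<in>V. (\<integral>z. (g z - p z) * v z \<partial>\<mu>) = 0))"

definition signal ::
  "(real^'d^'b) measure \<Rightarrow> (real^'d^'b \<Rightarrow> real^'d) \<Rightarrow> 'd \<Rightarrow> 'd \<Rightarrow> 'b \<Rightarrow> real" where
  "signal \<mu> G i j a =
     sqrt (L2_dist_sq \<mu> (\<lambda>z. G z $ j) (L2_proj \<mu> (L2_omit \<mu> i a) (\<lambda>z. G z $ j)))"

definition s_min ::
  "(real^'d^'b::finite) measure \<Rightarrow> (real^'d^'b \<Rightarrow> real^'d::finite) \<Rightarrow> real^'d^'d^'b \<Rightarrow> real" where
  "s_min \<mu> G m = Min {signal \<mu> G i j a | i j a. m $ a $ i $ j = 1}"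

definition drift_modulus ::
  "'w measure \<Rightarrow> (real \<Rightarrow> 'w \<Rightarrow> 'a) \<Rightarrow> ('a \<Rightarrow> real^'d) \<Rightarrow> real \<Rightarrow> real" where
  "drift_modulus M Z G h =
     (SUP u\<in>{0..h}. sqrt (\<integral>\<omega>. (norm (G (Z u \<omega>) - G (Z 0 \<omega>)))\<^sup>2 \<partial>M))"

text \<open>The moment is extended-valued, so a condition of the form \<open>\<rho> \<ge> ...\<close> on a root of it can only
  be met when it is finite.\<close>

definition moment_sup ::
  "'w measure \<Rightarrow> real \<Rightarrow> (real \<Rightarrow> 'w \<Rightarrow> real^'d) \<Rightarrow> real^'d \<Rightarrow> nat \<Rightarrow> ennreal" where
  "moment_sup M h X c p = (\<integral>\<^sup>+\<omega>. (SUP u\<in>{0..1}.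
     ennreal (segment_norm h (\<lambda>s. segment h (\<lambda>r. X r \<omega>) u s - c) ^ (2 * p))) \<partial>M)"

definition ennreal_root :: "nat \<Rightarrow> ennreal \<Rightarrow> ennreal" where
  "ennreal_root k x = (if x = \<infinity> then \<infinity> else ennreal (root k (enn2real x)))"

definition op_norm :: "real^'d^'d \<Rightarrow> real" where
  "op_norm S = onorm ((*v) S)"

definition frob_norm :: "real^'d^'d \<Rightarrow> real" where
  "frob_norm S = sqrt (trace (S ** transpose S))"

end

theory Submission
  imports Defs
begin

text \<open>
  Expanding the squares, \<open>emp_risk g - emp_risk G\<close> is the weighted sum of \<open>(norm (g - G))\<^sup>2\<close> over the
  observations minus cross terms with the drift increments and with the noise increments.  The drift
  cross term is small in mean by stationarity, Cauchy--Schwarz and Markov's inequality; the noise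
  cross term is, for a drift of the finite net and truncated to the ball, a martingale with Gaussian
  increments and hence sub-Gaussian, and passing to the net costs \<open>\<epsilon>\<close> times the total length of the
  noise increments.  The quadratic term is split into even and odd blocks of length \<open>b\<close>; the blocks of
  one parity are compared in total variation with independent copies, at the price of one mixing
  coefficient per block, and Hoeffding's inequality applies to the copies.  The observations leave
  the ball only with small probability, by stationarity and the moment of the segment norm.

  On the event where the deviation is at most \<open>eps_n\<close>, a column in which the minimizer misses an
  edge costs at least \<open>To * s_min\<^sup>2\<close> in risk and saves at most \<open>lam * d_max\<close> in penalty, while a
  superfluous edge costs \<open>lam\<close>; both exceed \<open>eps_n\<close>.
\<close>


section \<open>Measure-theoretic preliminaries\<close>

text \<open>Stationarity enters only as invariance of \<open>\<pi>\<close> under the kernels, so the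
  joint laws of \<open>Z\<close> at several times have to be derived by iterating the Markov
  property; the drift modulus needs two times, the tail event all observation times in a unit
  window. The mixing coefficient is defined by finite partitions and must be turned into a total
  variation bound for all events of a product sigma-algebra before blocks can be exchanged for
  copies. The block sums of all net members are decoupled as one vector, so the size of the net
  multiplies sub-Gaussian tails only and never a mixing coefficient. Truncation is written into the
  functions by an indicator instead of restricting the sample space: the martingale argument and the
  decoupling need bounds that hold everywhere, and truncated and original functions agree once all
  observations lie in the ball. For the recovery, the projection in the signal is realised as a
  conditional expectation; a missing edge puts the component of the candidate into the subspace onto
  which is projected, which bounds its risk from below.\<close>

lemma measurable_Caratheodory:
  fixes f :: "'w \<Rightarrow> 'z::{second_countable_topology,metric_space} \<Rightarrow> 'c::metric_space"
  assumes meas: "\<And>z. (\<lambda>\<omega>. f \<omega> z) \<in> borel_measurable M"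
    and cont: "\<And>\<omega>. \<omega> \<in> space M \<Longrightarrow> continuous_on UNIV (f \<omega>)"
  shows "(\<lambda>(\<omega>, z). f \<omega> z) \<in> borel_measurable (M \<Otimes>\<^sub>M borel)"
proof -
  \<comment> \<open>Replacing \<open>z\<close> by the first point of a countable dense sequence
    within distance 1/(n+1) gives a function that depends on \<open>z\<close> through a measurable
    index only; continuity in \<open>z\<close> lets these functions converge to
    \<open>f\<close>.\<close>
  obtain X :: "'z set" where X: "countable X" "\<And>U. open U \<Longrightarrow> U \<noteq> {} \<Longrightarrow> \<exists>d\<in>X. d \<in> U"
    using countable_dense_setE by blast
  have "X \<noteq> {}"
    using X(2)[of UNIV] by auto
  define D where "D = from_nat_into X"
  have dense: "\<exists>i. dist (D i) z < e" if "e > 0" for z e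
  proof -
    obtain d where "d \<in> X" "d \<in> ball z e"
      using X(2)[of "ball z e"] \<open>e > 0\<close> by auto
    then show ?thesis
      unfolding D_def using from_nat_into_surj[OF \<open>countable X\<close>, of d] by (auto simp: dist_commute)
  qed
  define i where "i n z = (LEAST i. dist (D i) z < 1 / real (Suc n))" for n :: nat and z
  have i: "dist (D (i n z)) z < 1 / real (Suc n)" for n z
    unfolding i_def by (rule LeastI_ex) (rule dense, simp)
  have i_meas [measurable]: "i n \<in> borel \<rightarrow>\<^sub>M count_space UNIV" for n
    unfolding i_def by measurable
  have "(\<lambda>(\<omega>, z). f \<omega> (D (i n z))) \<in> borel_measurable (M \<Otimes>\<^sub>M borel)" for n
  proof -
    have m: "(\<lambda>p. i n (snd p)) \<in> M \<Otimes>\<^sub>M borel \<rightarrow>\<^sub>M count_space UNIV"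
      by measurable
    have "(\<lambda>p. f (fst p) (D k)) \<in> borel_measurable (M \<Otimes>\<^sub>M borel)" for k
      by (rule measurable_compose[OF measurable_fst meas])
    from measurable_compose_countable[OF this m] show ?thesis
      by (simp add: case_prod_beta)
  qed
  then show ?thesis
  proof (rule borel_measurable_LIMSEQ_metric)
    fix p :: "'w \<times> 'z" assume "p \<in> space (M \<Otimes>\<^sub>M borel)"
    then obtain \<omega> z where p: "p = (\<omega>, z)" "\<omega> \<in> space M"
      by (auto simp: space_pair_measure)
    have "(\<lambda>n. D (i n z)) \<longlonglongrightarrow> z"
    proof (rule metric_LIMSEQ_I)
      fix r :: real assume "r > 0"
      then obtain n0 where n0: "1 / real (Suc n0) < r"
        using nat_approx_posE by blast
      show "\<exists>no. \<forall>n\<ge>no. dist (D (i n z)) z < r"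
      proof (intro exI allI impI)
        fix n assume "n \<ge> n0"
        then have "1 / real (Suc n) \<le> 1 / real (Suc n0)"
          by (simp add: field_simps)
        then show "dist (D (i n z)) z < r"
          using i[of n z] n0 by linarith
      qed
    qed
    then show "(\<lambda>n. case p of (\<omega>, z) \<Rightarrow> f \<omega> (D (i n z))) \<longlonglongrightarrow> (case p of (\<omega>, z) \<Rightarrow> f \<omega> z)"
      using cont[OF p(2)] unfolding p
      by (auto simp: continuous_on_eq_continuous_at intro: isCont_tendsto_compose)
  qed
qed

text \<open>Dividing the moment bound by the permitted probability is the source of the factors
  1/\<open>\<eta>\<close> outside the logarithm in \<open>eps_n\<close>. The case
  \<open>a = 0\<close> is separate because the final division by \<open>a\<close> fails; there
  \<open>f\<close> vanishes almost everywhere.\<close>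

lemma (in finite_measure) markov_ennreal:
  assumes f [measurable]: "f \<in> borel_measurable M" and a: "0 \<le> a" and \<eta>: "0 < \<eta>"
    and int: "(\<integral>\<^sup>+\<omega>. f \<omega> \<partial>M) \<le> ennreal a"
  shows "measure M {\<omega>\<in>space M. f \<omega> > ennreal (a / \<eta>)} \<le> \<eta>"
proof (cases "a = 0")
  case True
  then have "(\<integral>\<^sup>+\<omega>. f \<omega> \<partial>M) = 0" using int by simp
  then have "AE \<omega> in M. f \<omega> = 0"
    by (subst (asm) nn_integral_0_iff_AE) auto
  then have "measure M {\<omega>\<in>space M. f \<omega> > ennreal (a / \<eta>)} = measure M {}"
    using True by (intro measure_eq_AE) auto
  then show ?thesis using \<eta> by simp
next
  case False
  then have "a > 0" using a by simp
  define A where "A = {\<omega>\<in>space M. f \<omega> > ennreal (a / \<eta>)}"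
  have A [measurable]: "A \<in> sets M" unfolding A_def by measurable
  have "ennreal (a / \<eta>) * emeasure M A = (\<integral>\<^sup>+\<omega>. ennreal (a / \<eta>) * indicator A \<omega> \<partial>M)"
    by (simp add: nn_integral_cmult)
  also have "\<dots> \<le> (\<integral>\<^sup>+\<omega>. f \<omega> \<partial>M)"
    by (intro nn_integral_mono) (auto simp: A_def indicator_def)
  also have "\<dots> \<le> ennreal a" by (rule int)
  finally have "ennreal (a / \<eta> * measure M A) \<le> ennreal a"
    using \<open>a > 0\<close> \<eta> by (subst ennreal_mult) (simp_all add: emeasure_eq_measure)
  then have "a / \<eta> * measure M A \<le> a"
    using a by (subst (asm) ennreal_le_iff) auto
  then show ?thesis using \<open>a > 0\<close> \<eta> unfolding A_def by (simp add: field_simps)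
qed

text \<open>Integrating a weighted Young inequality, with the weight
  \<open>k = sqrt B / sqrt A\<close> that makes both terms equal. If \<open>A\<close> or
  \<open>B\<close> is zero, one factor vanishes almost everywhere.\<close>

lemma cauchy_schwarz_integral:
  fixes f g :: "'a \<Rightarrow> real"
  assumes [measurable]: "f \<in> borel_measurable M" "g \<in> borel_measurable M"
    and f: "integrable M (\<lambda>x. (f x)\<^sup>2)" and g: "integrable M (\<lambda>x. (g x)\<^sup>2)"
  shows "integrable M (\<lambda>x. f x * g x)"
    and "(\<integral>x. f x * g x \<partial>M) \<le> sqrt (\<integral>x. (f x)\<^sup>2 \<partial>M) * sqrt (\<integral>x. (g x)\<^sup>2 \<partial>M)"
proof -
  have ineq: "\<bar>u * v\<bar> \<le> (k * u\<^sup>2 + v\<^sup>2 / k) / 2" if "k > 0" for u v k :: real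
  proof -
    have "0 \<le> (k * \<bar>u\<bar> - \<bar>v\<bar>)\<^sup>2 / k" using that by simp
    also have "\<dots> = k * u\<^sup>2 + v\<^sup>2 / k - 2 * \<bar>u * v\<bar>"
      using that by (simp add: power2_eq_square field_simps abs_mult)
    finally show ?thesis by simp
  qed
  show int: "integrable M (\<lambda>x. f x * g x)"
    by (rule Bochner_Integration.integrable_bound[OF Bochner_Integration.integrable_add[OF f g]])
       (use ineq[of 1] in \<open>auto intro!: AE_I2 order_trans[OF ineq[of 1]]\<close>)
  define A B where "A = (\<integral>x. (f x)\<^sup>2 \<partial>M)" and "B = (\<integral>x. (g x)\<^sup>2 \<partial>M)"
  have AB: "A \<ge> 0" "B \<ge> 0" unfolding A_def B_def by simp_all
  consider "A = 0" | "B = 0" | "A > 0" "B > 0" using AB by linarith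
  then have "(\<integral>x. f x * g x \<partial>M) \<le> sqrt A * sqrt B"
  proof cases
    case 1
    then have "AE x in M. (f x)\<^sup>2 = 0"
      unfolding A_def using f by (subst (asm) integral_nonneg_eq_0_iff_AE) auto
    then have "(\<integral>x. f x * g x \<partial>M) = (\<integral>x. 0 \<partial>M)" by (intro integral_cong_AE) auto
    then show ?thesis using AB by simp
  next
    case 2
    then have "AE x in M. (g x)\<^sup>2 = 0"
      unfolding B_def using g by (subst (asm) integral_nonneg_eq_0_iff_AE) auto
    then have "(\<integral>x. f x * g x \<partial>M) = (\<integral>x. 0 \<partial>M)" by (intro integral_cong_AE) auto
    then show ?thesis using AB by simp
  next
    case 3
    define k where "k = sqrt B / sqrt A"
    have k: "k > 0" using 3 by (simp add: k_def)
    have "(\<integral>x. f x * g x \<partial>M) \<le> (\<integral>x. (k * (f x)\<^sup>2 + (g x)\<^sup>2 / k) / 2 \<partial>M)"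
    proof (rule integral_mono[OF int])
      show "f x * g x \<le> (k * (f x)\<^sup>2 + (g x)\<^sup>2 / k) / 2" for x
        using ineq[OF k, of "f x" "g x"] by linarith
    qed (use f g in simp)
    also have "\<dots> = (k * A + B / k) / 2"
      using f g by (simp add: A_def B_def)
    also have "\<dots> = sqrt A * sqrt B"
    proof -
      have "k * A = sqrt A * sqrt B" "B / k = sqrt A * sqrt B"
        using 3 unfolding k_def by (simp_all add: field_simps)
      then show ?thesis by simp
    qed
    finally show ?thesis .
  qed
  then show "(\<integral>x. f x * g x \<partial>M) \<le> sqrt (\<integral>x. (f x)\<^sup>2 \<partial>M) * sqrt (\<integral>x. (g x)\<^sup>2 \<partial>M)"
    unfolding A_def B_def .
qed

text \<open>Difference of squares: one factor is at most \<open>\<epsilon>\<close>, the other at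
  most \<open>2 * E\<close>. This is the price of replacing a drift by its net member inside a
  squared norm.\<close>

lemma abs_norm_square_diff_le:
  fixes u v :: "'a::real_normed_vector"
  assumes "norm u \<le> E" "norm v \<le> E" "norm (u - v) \<le> \<epsilon>"
  shows "\<bar>(norm u)\<^sup>2 - (norm v)\<^sup>2\<bar> \<le> 2 * E * \<epsilon>"
proof -
  have "\<bar>(norm u)\<^sup>2 - (norm v)\<^sup>2\<bar> = \<bar>norm u - norm v\<bar> * (norm u + norm v)"
    by (simp add: power2_eq_square square_diff_square_factored abs_mult mult.commute)
  also have "\<dots> \<le> \<epsilon> * (E + E)"
    using assms norm_triangle_ineq3[of u v] by (intro mult_mono) auto
  finally show ?thesis by (simp add: algebra_simps)
qed

lemma norm_diff_square_le:
  fixes u v :: "'a::real_normed_vector"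
  shows "(norm (u - v))\<^sup>2 \<le> 2 * (norm u)\<^sup>2 + 2 * (norm v)\<^sup>2"
proof -
  have "(norm (u - v))\<^sup>2 \<le> (norm u + norm v)\<^sup>2" by (intro power_mono norm_triangle_ineq4) simp
  also have "\<dots> \<le> 2 * (norm u)\<^sup>2 + 2 * (norm v)\<^sup>2"
    using sum_squares_bound[of "norm u" "norm v"] by (simp add: power2_sum)
  finally show ?thesis .
qed

lemma integrable_norm_diff_square:
  fixes f g :: "'a \<Rightarrow> 'b::{real_normed_vector, second_countable_topology}"
  assumes [measurable]: "f \<in> borel_measurable M" "g \<in> borel_measurable M"
    and "integrable M (\<lambda>x. (norm (f x))\<^sup>2)" "integrable M (\<lambda>x. (norm (g x))\<^sup>2)"
  shows "integrable M (\<lambda>x. (norm (f x - g x))\<^sup>2)"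
proof (rule Bochner_Integration.integrable_bound)
  show "integrable M (\<lambda>x. 2 * (norm (f x))\<^sup>2 + 2 * (norm (g x))\<^sup>2)" using assms by simp
qed (use norm_diff_square_le in auto)

section \<open>Gaussian exponential moments and independence from the past\<close>

lemma nn_integral_normal_exp:
  assumes "\<sigma> > 0"
  shows "(\<integral>\<^sup>+x. ennreal (normal_density 0 \<sigma> x) * ennreal (exp (a * x)) \<partial>lborel)
    = ennreal (exp (a\<^sup>2 * \<sigma>\<^sup>2 / 2))"
proof -
  have "normal_density 0 \<sigma> x * exp (a * x) = exp (a\<^sup>2 * \<sigma>\<^sup>2 / 2) * normal_density (a * \<sigma>\<^sup>2) \<sigma> x" for x
  proof -
    \<comment> \<open>Completing the square: the exponential tilt moves the mean of the normal
      density to \<open>a * \<sigma>\<^sup>2\<close>.\<close>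
    have "- (x - 0)\<^sup>2 / (2 * \<sigma>\<^sup>2) + a * x = a\<^sup>2 * \<sigma>\<^sup>2 / 2 + - (x - a * \<sigma>\<^sup>2)\<^sup>2 / (2 * \<sigma>\<^sup>2)"
      using assms by (simp add: field_simps power2_eq_square)
    then show ?thesis
      unfolding normal_density_def by (simp add: exp_add[symmetric] mult.assoc mult.left_commute)
  qed
  then have "(\<integral>\<^sup>+x. ennreal (normal_density 0 \<sigma> x) * ennreal (exp (a * x)) \<partial>lborel)
    = (\<integral>\<^sup>+x. ennreal (exp (a\<^sup>2 * \<sigma>\<^sup>2 / 2)) * ennreal (normal_density (a * \<sigma>\<^sup>2) \<sigma> x) \<partial>lborel)"
    by (simp add: ennreal_mult[symmetric])
  also have "\<dots> = ennreal (exp (a\<^sup>2 * \<sigma>\<^sup>2 / 2)) * (\<integral>\<^sup>+x. ennreal (normal_density (a * \<sigma>\<^sup>2) \<sigma> x) \<partial>lborel)"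
    by (rule nn_integral_cmult) simp
  also have "(\<integral>\<^sup>+x. ennreal (normal_density (a * \<sigma>\<^sup>2) \<sigma> x) \<partial>lborel) = 1"
    using assms by (subst nn_integral_eq_integral) auto
  finally show ?thesis by simp
qed

text \<open>The exponential of the inner product is a product over coordinates, and independence
  turns its moment into a product of one-dimensional ones. Extended non-negative integrals keep
  integrability questions out.\<close>

lemma (in prob_space) gaussian_vector_mgf:
  fixes w :: "'a \<Rightarrow> real^'d::finite"
  assumes indep: "indep_vars (\<lambda>_. borel) (\<lambda>i \<omega>. w \<omega> $ i) UNIV"
    and normal: "\<And>i. distributed M lborel (\<lambda>\<omega>. w \<omega> $ i) (normal_density 0 (sqrt h))"
    and h: "h > 0"
  shows "(\<integral>\<^sup>+\<omega>. ennreal (exp (v \<bullet> w \<omega>)) \<partial>M) = ennreal (exp (h * (norm v)\<^sup>2 / 2))"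
proof -
  have one: "(\<integral>\<^sup>+\<omega>. ennreal (exp (v $ i * w \<omega> $ i)) \<partial>M) = ennreal (exp (h * (v $ i)\<^sup>2 / 2))" for i
  proof -
    have "(\<integral>\<^sup>+\<omega>. ennreal (exp (v $ i * w \<omega> $ i)) \<partial>M)
      = (\<integral>\<^sup>+x. ennreal (normal_density 0 (sqrt h) x) * ennreal (exp (v $ i * x)) \<partial>lborel)"
      by (rule distributed_nn_integral[OF normal, symmetric]) measurable
    then show ?thesis using h by (simp add: nn_integral_normal_exp mult.commute[of h])
  qed
  have "(\<integral>\<^sup>+\<omega>. ennreal (exp (v \<bullet> w \<omega>)) \<partial>M)
    = (\<integral>\<^sup>+\<omega>. (\<Prod>i\<in>UNIV. ennreal (exp (v $ i * w \<omega> $ i))) \<partial>M)"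
    by (simp add: inner_vec_def exp_sum prod_ennreal)
  also have "\<dots> = (\<Prod>i\<in>UNIV. \<integral>\<^sup>+\<omega>. ennreal (exp (v $ i * w \<omega> $ i)) \<partial>M)"
    using indep_vars_compose2[OF indep, of "\<lambda>i x. ennreal (exp (v $ i * x))" "\<lambda>_. borel"]
    by (intro indep_vars_nn_integral) auto
  also have "\<dots> = ennreal (exp (h * (norm v)\<^sup>2 / 2))"
    by (simp add: one prod_ennreal exp_sum[symmetric] norm_vec_def L2_set_def sum_nonneg sum_distrib_left sum_divide_distrib)
  finally show ?thesis .
qed

text \<open>Freezing: independence makes the joint law of \<open>V\<close> and \<open>w\<close> a
  product, so \<open>w\<close> may be integrated out while \<open>V\<close> is held fixed. This
  replaces conditioning on \<open>F\<close>.\<close>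

lemma (in prob_space) indep_increment_nn_integral:
  assumes sub: "subalgebra M F" and w [measurable]: "w \<in> M \<rightarrow>\<^sub>M N"
    and indep: "indep_set (sets F) {w -` B \<inter> space M | B. B \<in> sets N}"
    and V: "V \<in> F \<rightarrow>\<^sub>M L"
    and f [measurable]: "case_prod f \<in> borel_measurable (L \<Otimes>\<^sub>M N)"
  shows "(\<integral>\<^sup>+\<omega>. f (V \<omega>) (w \<omega>) \<partial>M) = (\<integral>\<^sup>+\<omega>. (\<integral>\<^sup>+\<omega>'. f (V \<omega>) (w \<omega>') \<partial>M) \<partial>M)"
proof -
  have VM [measurable]: "V \<in> M \<rightarrow>\<^sub>M L" by (rule measurable_from_subalg[OF sub V])
  interpret V: prob_space "distr M L V" by (rule prob_space_distr) simp
  interpret W: prob_space "distr M N w" by (rule prob_space_distr) simp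
  have d: "distr M L V \<Otimes>\<^sub>M distr M N w = distr M (L \<Otimes>\<^sub>M N) (\<lambda>\<omega>. (V \<omega>, w \<omega>))"
  proof (rule pair_measure_eqI)
    fix A B assume "A \<in> sets (distr M L V)" "B \<in> sets (distr M N w)"
    then have AB [measurable]: "A \<in> sets L" "B \<in> sets N" by auto
    have "V -` A \<inter> space M \<in> sets F"
      using V AB sub by (auto simp: subalgebra_def measurable_def)
    then have "prob ((V -` A \<inter> space M) \<inter> (w -` B \<inter> space M)) = prob (V -` A \<inter> space M) * prob (w -` B \<inter> space M)"
      using AB by (intro indep_setD[OF indep]) auto
    moreover have "(V -` A \<inter> space M) \<inter> (w -` B \<inter> space M) = (\<lambda>\<omega>. (V \<omega>, w \<omega>)) -` (A \<times> B) \<inter> space M"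
      by auto
    ultimately show "emeasure (distr M L V) A * emeasure (distr M N w) B
      = emeasure (distr M (L \<Otimes>\<^sub>M N) (\<lambda>\<omega>. (V \<omega>, w \<omega>))) (A \<times> B)"
      by (simp add: emeasure_distr emeasure_eq_measure ennreal_mult[symmetric])
  qed (simp_all add: V.sigma_finite_measure_axioms W.sigma_finite_measure_axioms)
  have "(\<integral>\<^sup>+\<omega>. f (V \<omega>) (w \<omega>) \<partial>M) = (\<integral>\<^sup>+p. case_prod f p \<partial>distr M (L \<Otimes>\<^sub>M N) (\<lambda>\<omega>. (V \<omega>, w \<omega>)))"
    by (subst nn_integral_distr) auto
  also have "\<dots> = (\<integral>\<^sup>+v. (\<integral>\<^sup>+x. f v x \<partial>distr M N w) \<partial>distr M L V)"
    unfolding d[symmetric] by (subst W.nn_integral_fst[symmetric]) auto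
  also have "\<dots> = (\<integral>\<^sup>+\<omega>. (\<integral>\<^sup>+x. f (V \<omega>) x \<partial>distr M N w) \<partial>M)"
    by (rule nn_integral_distr) measurable
  also have "\<dots> = (\<integral>\<^sup>+\<omega>. (\<integral>\<^sup>+\<omega>'. f (V \<omega>) (w \<omega>') \<partial>M) \<partial>M)"
  proof (rule nn_integral_cong)
    fix \<omega> assume "\<omega> \<in> space M"
    then have "V \<omega> \<in> space L" using VM by (auto simp: measurable_def)
    then show "(\<integral>\<^sup>+x. f (V \<omega>) x \<partial>distr M N w) = (\<integral>\<^sup>+\<omega>'. f (V \<omega>) (w \<omega>') \<partial>M)"
      by (subst nn_integral_distr) auto
  qed
  finally show ?thesis .
qed


section \<open>Total variation and the mixing coefficient\<close>

text \<open>These are the finite unions of measurable rectangles, encoded by finite-valued labels on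
  both factors. Complements and unions become operations on label sets, and the level sets of the
  labels are the partitions to be fed into \<open>beta_coeff\<close>.\<close>

definition finite_rect_union :: "'a measure \<Rightarrow> 'b measure \<Rightarrow> ('a \<times> 'b) set \<Rightarrow> bool" where
  "finite_rect_union S T E \<longleftrightarrow> (\<exists>(\<alpha> :: 'a \<Rightarrow> nat) (\<alpha>' :: 'b \<Rightarrow> nat) R.
     \<alpha> \<in> S \<rightarrow>\<^sub>M count_space UNIV \<and> finite (\<alpha> ` space S) \<and>
     \<alpha>' \<in> T \<rightarrow>\<^sub>M count_space UNIV \<and> finite (\<alpha>' ` space T) \<and>
     E = {p \<in> space (S \<Otimes>\<^sub>M T). (\<alpha> (fst p), \<alpha>' (snd p)) \<in> R})"

lemma finite_rect_union_sets:
  assumes "finite_rect_union S T E"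
  shows "E \<in> sets (S \<Otimes>\<^sub>M T)"
proof -
  obtain \<alpha> \<alpha>' and R :: "(nat \<times> nat) set" where [measurable]: "\<alpha> \<in> S \<rightarrow>\<^sub>M count_space UNIV" "\<alpha>' \<in> T \<rightarrow>\<^sub>M count_space UNIV"
    and E: "E = {p \<in> space (S \<Otimes>\<^sub>M T). (\<alpha> (fst p), \<alpha>' (snd p)) \<in> R}"
    using assms unfolding finite_rect_union_def by blast
  have "(\<lambda>p. (\<alpha> (fst p), \<alpha>' (snd p))) \<in> S \<Otimes>\<^sub>M T \<rightarrow>\<^sub>M count_space UNIV \<Otimes>\<^sub>M count_space UNIV"
    by measurable
  then have "(\<lambda>p. (\<alpha> (fst p), \<alpha>' (snd p))) \<in> S \<Otimes>\<^sub>M T \<rightarrow>\<^sub>M count_space UNIV"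
    by (simp add: pair_measure_countable)
  from measurable_sets[OF this, of R] show ?thesis
    unfolding E by (simp add: vimage_def Int_def conj_commute)
qed

lemma finite_rect_union_rect:
  assumes "A \<in> sets S" "B \<in> sets T"
  shows "finite_rect_union S T (A \<times> B)"
proof -
  have 1: "(\<lambda>x. if x \<in> A then 1 else 0 :: nat) \<in> S \<rightarrow>\<^sub>M count_space UNIV"
    using assms(1) by measurable
  have 2: "(\<lambda>x. if x \<in> B then 1 else 0 :: nat) \<in> T \<rightarrow>\<^sub>M count_space UNIV"
    using assms(2) by measurable
  have 3: "finite ((\<lambda>x. if x \<in> A then 1 else 0 :: nat) ` space S)" "finite ((\<lambda>x. if x \<in> B then 1 else 0 :: nat) ` space T)"
    by (rule finite_subset[of _ "{0, 1}"], auto)+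
  have 4: "A \<times> B = {p \<in> space (S \<Otimes>\<^sub>M T). (if fst p \<in> A then 1 else 0 :: nat, if snd p \<in> B then 1 else 0 :: nat) \<in> {(1, 1)}}"
    using sets.sets_into_space[OF assms(1)] sets.sets_into_space[OF assms(2)]
    by (auto simp: space_pair_measure split: if_splits)
  show ?thesis
    unfolding finite_rect_union_def using 1 2 3 4 by blast
qed

lemma finite_rect_union_compl:
  assumes "finite_rect_union S T E"
  shows "finite_rect_union S T (space (S \<Otimes>\<^sub>M T) - E)"
proof -
  obtain \<alpha> \<alpha>' and R :: "(nat \<times> nat) set" where 1: "\<alpha> \<in> S \<rightarrow>\<^sub>M count_space UNIV" "finite (\<alpha> ` space S)"
     "\<alpha>' \<in> T \<rightarrow>\<^sub>M count_space UNIV" "finite (\<alpha>' ` space T)"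
    and E: "E = {p \<in> space (S \<Otimes>\<^sub>M T). (\<alpha> (fst p), \<alpha>' (snd p)) \<in> R}"
    using assms unfolding finite_rect_union_def by blast
  have "space (S \<Otimes>\<^sub>M T) - E = {p \<in> space (S \<Otimes>\<^sub>M T). (\<alpha> (fst p), \<alpha>' (snd p)) \<in> - R}"
    unfolding E by auto
  then show ?thesis
    unfolding finite_rect_union_def using 1 by blast
qed

lemma finite_rect_union_Un:
  assumes "finite_rect_union S T E" "finite_rect_union S T F"
  shows "finite_rect_union S T (E \<union> F)"
proof -
  obtain \<alpha> \<alpha>' and R :: "(nat \<times> nat) set" where 1: "\<alpha> \<in> S \<rightarrow>\<^sub>M count_space UNIV" "finite (\<alpha> ` space S)"
     "\<alpha>' \<in> T \<rightarrow>\<^sub>M count_space UNIV" "finite (\<alpha>' ` space T)"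
    and E: "E = {p \<in> space (S \<Otimes>\<^sub>M T). (\<alpha> (fst p), \<alpha>' (snd p)) \<in> R}"
    using assms(1) unfolding finite_rect_union_def by blast
  obtain \<beta> \<beta>' and R' :: "(nat \<times> nat) set" where 2: "\<beta> \<in> S \<rightarrow>\<^sub>M count_space UNIV" "finite (\<beta> ` space S)"
     "\<beta>' \<in> T \<rightarrow>\<^sub>M count_space UNIV" "finite (\<beta>' ` space T)"
    and F: "F = {p \<in> space (S \<Otimes>\<^sub>M T). (\<beta> (fst p), \<beta>' (snd p)) \<in> R'}"
    using assms(2) unfolding finite_rect_union_def by blast
  \<comment> \<open>Pairing the labels yields the common refinement of both label partitions, on
    which \<open>E\<close> and \<open>F\<close> are unions of cells.\<close>
  define \<gamma> \<gamma>' where "\<gamma> x = prod_encode (\<alpha> x, \<beta> x)" and "\<gamma>' y = prod_encode (\<alpha>' y, \<beta>' y)" for x y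
  define Q where "Q = {(i, j). (fst (prod_decode i), fst (prod_decode j)) \<in> R \<or> (snd (prod_decode i), snd (prod_decode j)) \<in> R'}"
  note [measurable] = 1(1,3) 2(1,3)
  have "\<gamma> \<in> S \<rightarrow>\<^sub>M count_space UNIV" "\<gamma>' \<in> T \<rightarrow>\<^sub>M count_space UNIV"
    unfolding \<gamma>_def \<gamma>'_def by measurable
  moreover have "finite (\<gamma> ` space S)"
    by (rule finite_subset[of _ "prod_encode ` (\<alpha> ` space S \<times> \<beta> ` space S)"]) (use 1 2 in \<open>auto simp: \<gamma>_def\<close>)
  moreover have "finite (\<gamma>' ` space T)"
    by (rule finite_subset[of _ "prod_encode ` (\<alpha>' ` space T \<times> \<beta>' ` space T)"]) (use 1 2 in \<open>auto simp: \<gamma>'_def\<close>)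
  moreover have "E \<union> F = {p \<in> space (S \<Otimes>\<^sub>M T). (\<gamma> (fst p), \<gamma>' (snd p)) \<in> Q}"
    unfolding E F Q_def \<gamma>_def \<gamma>'_def by auto
  ultimately show ?thesis
    unfolding finite_rect_union_def by (intro exI[of _ \<gamma>] exI[of _ \<gamma>'] exI[of _ Q] conjI)
qed

lemma finite_rect_union_UN:
  assumes "\<And>i::nat. i < n \<Longrightarrow> finite_rect_union S T (E i)"
  shows "finite_rect_union S T (\<Union>i<n. E i)"
  using assms
proof (induction n)
  case 0
  then show ?case using finite_rect_union_rect[of "{}" S "{}" T] by simp
next
  case (Suc n)
  then show ?case by (auto simp: lessThan_Suc intro!: finite_rect_union_Un)
qed

text \<open>The approximable sets form a sigma-algebra containing the rectangles: complements leave
  the symmetric difference unchanged, and a countable union is cut to a finite one by continuity of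
  the measure.\<close>

lemma finite_rect_union_approx:
  assumes m: "finite_measure m" and sets_m: "sets m = sets (S \<Otimes>\<^sub>M T)"
    and E: "E \<in> sets (S \<Otimes>\<^sub>M T)" and "\<kappa> > 0"
  shows "\<exists>F. finite_rect_union S T F \<and> measure m ((E - F) \<union> (F - E)) < \<kappa>"
proof -
  interpret finite_measure m by fact
  have space_m: "space m = space (S \<Otimes>\<^sub>M T)" by (rule sets_eq_imp_space_eq[OF sets_m])
  have "\<forall>\<kappa>>0. \<exists>F. finite_rect_union S T F \<and> measure m ((E - F) \<union> (F - E)) < \<kappa>"
    using E unfolding sets_pair_measure
  proof (induction rule: sigma_sets.induct)
    case (Basic a)
    then obtain A B where "a = A \<times> B" "A \<in> sets S" "B \<in> sets T" by auto
    then show ?case using finite_rect_union_rect[of A S B T] by auto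
  next
    case Empty
    show ?case using finite_rect_union_rect[of "{}" S "{}" T] by auto
  next
    case (Compl a)
    show ?case
    proof (intro allI impI)
      fix \<kappa> :: real assume "\<kappa> > 0"
      then obtain F where F: "finite_rect_union S T F" "measure m ((a - F) \<union> (F - a)) < \<kappa>"
        using Compl.IH by blast
      have "a \<subseteq> space S \<times> space T"
      proof (rule sigma_sets_into_sp[OF _ Compl.hyps], safe)
        fix A B x y assume "A \<in> sets S" "B \<in> sets T" "x \<in> A" "y \<in> B"
        then show "x \<in> space S" "y \<in> space T" by (meson sets.sets_into_space subsetD)+
      qed
      moreover have "F \<subseteq> space S \<times> space T"
        using sets.sets_into_space[OF finite_rect_union_sets[OF F(1)]] by (simp add: space_pair_measure)
      ultimately have eq: "((space S \<times> space T - a) - (space S \<times> space T - F)) \<union> ((space S \<times> space T - F) - (space S \<times> space T - a))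
         = (a - F) \<union> (F - a)" by blast
      then show "\<exists>F. finite_rect_union S T F \<and> measure m ((space S \<times> space T - a - F) \<union> (F - (space S \<times> space T - a))) < \<kappa>"
      proof (intro exI conjI)
        show "finite_rect_union S T (space S \<times> space T - F)"
          using finite_rect_union_compl[OF F(1)] unfolding space_pair_measure .
      qed (unfold eq, rule F(2))
    qed
  next
    case (Union a)
    have a: "a i \<in> sets m" for i
      using Union.hyps[of i] unfolding sets_m sets_pair_measure .
    have aU: "(\<Union>i<n. a i) \<in> sets m" for n :: nat
      by (rule sets.finite_UN) (simp_all add: a)
    have aR: "\<Union>(range a) \<in> sets m"
      using a by (intro sets.countable_UN) blast
    show ?case
    proof (intro allI impI)
      fix \<kappa> :: real assume "\<kappa> > 0"
      have "(\<lambda>n. measure m (\<Union>i<n. a i)) \<longlonglongrightarrow> measure m (\<Union>n. \<Union>i<n. a i)"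
      proof (rule finite_Lim_measure_incseq)
        show "range (\<lambda>n. \<Union>i<n. a i) \<subseteq> sets m"
          using aU by blast
        show "incseq (\<lambda>n. \<Union>i<n. a i)"
          unfolding incseq_def by (intro allI impI UN_mono) simp_all
      qed
      also have "(\<Union>n. \<Union>i<n. a i) = \<Union>(range a)" by auto
      finally have lim: "(\<lambda>n. measure m (\<Union>i<n. a i)) \<longlonglongrightarrow> measure m (\<Union>(range a))" .
      have "\<kappa> / 2 > 0" using \<open>\<kappa> > 0\<close> by simp
      from metric_LIMSEQ_D[OF lim this] obtain n where n: "dist (measure m (\<Union>i<n. a i)) (measure m (\<Union>(range a))) < \<kappa> / 2" by blast
      have "measure m (\<Union>(range a) - (\<Union>i<n. a i)) = measure m (\<Union>(range a)) - measure m (\<Union>i<n. a i)"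
      proof (rule finite_measure_Diff)
        show "\<Union>(range a) \<in> sets m" "(\<Union>i<n. a i) \<in> sets m" by (rule aR, rule aU)
      qed blast
      with n have tail: "measure m (\<Union>(range a) - (\<Union>i<n. a i)) < \<kappa> / 2"
        unfolding dist_real_def by linarith
      \<comment> \<open>Half of \<open>\<kappa>\<close> went to the tail of the union. The other
        half is shared by the \<open>n\<close> remaining sets; dividing by \<open>Suc n\<close> also
        covers \<open>n = 0\<close>.\<close>
      have "\<exists>F. finite_rect_union S T F \<and> measure m ((a i - F) \<union> (F - a i)) < \<kappa> / (2 * real (Suc n))" for i
        using Union.IH[of i] \<open>\<kappa> > 0\<close> by simp
      then have "\<exists>F. \<forall>i. finite_rect_union S T (F i) \<and> measure m ((a i - F i) \<union> (F i - a i)) < \<kappa> / (2 * real (Suc n))"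
        by (intro choice allI)
      then obtain F where F: "\<And>i. finite_rect_union S T (F i)"
          "\<And>i. measure m ((a i - F i) \<union> (F i - a i)) < \<kappa> / (2 * real (Suc n))"
        by blast
      have Fm [measurable]: "F i \<in> sets m" for i using finite_rect_union_sets[OF F(1)[of i]] by (simp add: sets_m)
      note a [measurable]
      define C where "C = \<Union>(range a) - (\<Union>i<n. a i)"
      define D where "D i = (a i - F i) \<union> (F i - a i)" for i
      have Cm: "C \<in> sets m" and Dm: "D i \<in> sets m" for i
        unfolding C_def D_def using aR aU Fm a by (intro sets.Diff sets.Un; blast)+
      have DUm: "(\<Union>i<n. D i) \<in> sets m"
        using Dm by (intro sets.finite_UN) simp_all
      have "measure m ((\<Union>(range a) - (\<Union>i<n. F i)) \<union> ((\<Union>i<n. F i) - \<Union>(range a)))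
        \<le> measure m (C \<union> (\<Union>i<n. D i))"
        proof (rule finite_measure_mono)
        show "(\<Union>(range a) - (\<Union>i<n. F i)) \<union> ((\<Union>i<n. F i) - \<Union>(range a)) \<subseteq> C \<union> (\<Union>i<n. D i)"
          unfolding C_def D_def by blast
      qed (rule sets.Un[OF Cm DUm])
      also have "\<dots> \<le> measure m C + measure m (\<Union>i<n. D i)"
        by (rule measure_Un_le[OF Cm DUm])
      also have "measure m (\<Union>i<n. D i) \<le> (\<Sum>i<n. measure m (D i))"
        by (rule measure_UNION_le) (simp_all add: Dm)
      also have "\<dots> \<le> (\<Sum>i<n. \<kappa> / (2 * real (Suc n)))"
        unfolding D_def by (intro sum_mono less_imp_le F(2))
      also have "\<dots> \<le> \<kappa> / 2" using \<open>\<kappa> > 0\<close> by (simp add: field_simps)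
      finally have "measure m ((\<Union>(range a) - (\<Union>i<n. F i)) \<union> ((\<Union>i<n. F i) - \<Union>(range a))) < \<kappa>"
        using tail unfolding C_def by linarith
      moreover have "finite_rect_union S T (\<Union>i<n. F i)"
        by (rule finite_rect_union_UN) (rule F(1))
      ultimately show "\<exists>F. finite_rect_union S T F \<and> measure m ((\<Union>(range a) - F) \<union> (F - \<Union>(range a))) < \<kappa>"
        by blast
    qed
  qed
  then show ?thesis using \<open>\<kappa> > 0\<close> by blast
qed

text \<open>Bounding each absolute value by the sum of its two terms gives total mass 1 twice. The
  bound makes the real suprema over partitions suprema of bounded sets.\<close>

lemma (in prob_space) beta_sum_le_1:
  assumes sub: "subalgebra M A" "subalgebra M B"
    and p: "finite p" "partition_on (space M) p" "p \<subseteq> sets A"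
    and r: "finite r" "partition_on (space M) r" "r \<subseteq> sets B"
  shows "1/2 * (\<Sum>U\<in>p. \<Sum>V\<in>r. \<bar>prob (U \<inter> V) - prob U * prob V\<bar>) \<le> 1"
proof -
  have pm: "U \<in> sets M" if "U \<in> p" for U using that p(3) sub(1) by (auto simp: subalgebra_def)
  have rm: "V \<in> sets M" if "V \<in> r" for V using that r(3) sub(2) by (auto simp: subalgebra_def)
  have sum1: "(\<Sum>U\<in>q. prob (C \<inter> U)) = prob C"
    if "finite q" "partition_on (space M) q" "\<And>U. U \<in> q \<Longrightarrow> U \<in> sets M" "C \<in> sets M" for q C
  proof -
    have "(\<Sum>U\<in>q. prob (C \<inter> U)) = prob (\<Union>U\<in>q. C \<inter> U)"
    proof (rule finite_measure_finite_Union[symmetric])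
      show "disjoint_family_on (\<lambda>U. C \<inter> U) q"
        using that(2) unfolding disjoint_family_on_def partition_on_def disjoint_def by blast
    qed (use that in auto)
    also have "(\<Union>U\<in>q. C \<inter> U) = C"
      using that sets.sets_into_space[OF that(4)] by (auto simp: partition_on_def)
    finally show ?thesis .
  qed
  have sum2: "(\<Sum>U\<in>q. prob U) = 1"
    if "finite q" "partition_on (space M) q" "\<And>U. U \<in> q \<Longrightarrow> U \<in> sets M" for q
  proof -
    have "(\<Sum>U\<in>q. prob U) = (\<Sum>U\<in>q. prob (space M \<inter> U))"
      using that(3) by (intro sum.cong refl) (simp add: sets.Int_space_eq1)
    then show ?thesis using sum1[OF that, of "space M"] by (simp add: prob_space)
  qed
  have "(\<Sum>U\<in>p. \<Sum>V\<in>r. \<bar>prob (U \<inter> V) - prob U * prob V\<bar>) \<le> (\<Sum>U\<in>p. \<Sum>V\<in>r. prob (U \<inter> V) + prob U * prob V)"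
  proof (intro sum_mono)
    fix U V
    have "0 \<le> prob (U \<inter> V)" "0 \<le> prob U * prob V" by simp_all
    then show "\<bar>prob (U \<inter> V) - prob U * prob V\<bar> \<le> prob (U \<inter> V) + prob U * prob V" by linarith
  qed
  also have "\<dots> = (\<Sum>U\<in>p. prob U) + (\<Sum>U\<in>p. prob U) * (\<Sum>V\<in>r. prob V)"
  proof -
    have "(\<Sum>U\<in>p. \<Sum>V\<in>r. prob (U \<inter> V)) = (\<Sum>U\<in>p. prob U)"
      by (intro sum.cong refl sum1[OF r(1,2)] rm pm)
    then show ?thesis unfolding sum.distrib sum_product by simp
  qed
  also have "\<dots> = 2"
  proof -
    have "(\<Sum>U\<in>p. prob U) = 1" "(\<Sum>V\<in>r. prob V) = 1"
      by (rule sum2[OF p(1,2)], rule pm, assumption) (rule sum2[OF r(1,2)], rule rm, assumption)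
    then show ?thesis by simp
  qed
  finally show ?thesis by simp
qed

lemma (in prob_space) beta_coeff_upper:
  assumes sub: "subalgebra M A" "subalgebra M B"
    and p: "finite p" "partition_on (space M) p" "p \<subseteq> sets A"
    and r: "finite r" "partition_on (space M) r" "r \<subseteq> sets B"
  shows "1/2 * (\<Sum>U\<in>p. \<Sum>V\<in>r. \<bar>prob (U \<inter> V) - prob U * prob V\<bar>) \<le> beta_coeff M A B"
proof -
  define PS where "PS = {(p, r). finite p \<and> partition_on (space M) p \<and> p \<subseteq> sets A \<and>
    finite r \<and> partition_on (space M) r \<and> r \<subseteq> sets B}"
  define f where "f = (\<lambda>(p, r). 1/2 * (\<Sum>U\<in>p. \<Sum>V\<in>r. \<bar>prob (U \<inter> V) - prob U * prob V\<bar>))"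
  have "bdd_above (f ` PS)"
  proof (rule bdd_aboveI2)
    fix x assume "x \<in> PS"
    then have x: "finite (fst x)" "partition_on (space M) (fst x)" "fst x \<subseteq> sets A"
      "finite (snd x)" "partition_on (space M) (snd x)" "snd x \<subseteq> sets B"
      unfolding PS_def by (simp_all add: case_prod_beta)
    show "f x \<le> 1"
      unfolding f_def case_prod_beta by (rule beta_sum_le_1[OF sub x])
  qed
  moreover have "(p, r) \<in> PS" using p r unfolding PS_def by blast
  ultimately have "f (p, r) \<le> (SUP x\<in>PS. f x)" by (intro cSUP_upper)
  then show ?thesis
    unfolding beta_coeff_def PS_def f_def case_prod_conv .
qed

lemma partition_on_singleton: "A \<noteq> {} \<Longrightarrow> partition_on A {A}"
  by (simp add: partition_on_def)

lemma (in prob_space) beta_coeff_least: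
  assumes sub: "subalgebra M A" "subalgebra M B"
    and le: "\<And>p r. finite p \<Longrightarrow> partition_on (space M) p \<Longrightarrow> p \<subseteq> sets A \<Longrightarrow> finite r \<Longrightarrow>
      partition_on (space M) r \<Longrightarrow> r \<subseteq> sets B \<Longrightarrow>
      1/2 * (\<Sum>U\<in>p. \<Sum>V\<in>r. \<bar>prob (U \<inter> V) - prob U * prob V\<bar>) \<le> c"
  shows "beta_coeff M A B \<le> c"
proof -
  have "space M \<in> sets A" "space M \<in> sets B"
    using sub sets.top[of A] sets.top[of B] by (auto simp: subalgebra_def)
  note top = this
  define PS where "PS = {(p, r). finite p \<and> partition_on (space M) p \<and> p \<subseteq> sets A \<and>
    finite r \<and> partition_on (space M) r \<and> r \<subseteq> sets B}"
  define f where "f = (\<lambda>(p, r). 1/2 * (\<Sum>U\<in>p. \<Sum>V\<in>r. \<bar>prob (U \<inter> V) - prob U * prob V\<bar>))"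
  have "({space M}, {space M}) \<in> PS"
    using top partition_on_singleton[OF not_empty] unfolding PS_def by simp
  then have "PS \<noteq> {}" by (metis empty_iff)
  moreover have "f x \<le> c" if "x \<in> PS" for x
    using that le[of "fst x" "snd x"] unfolding PS_def f_def case_prod_beta by blast
  ultimately have "(SUP x\<in>PS. f x) \<le> c" by (rule cSUP_least)
  then show ?thesis
    unfolding beta_coeff_def PS_def f_def case_prod_conv .
qed

lemma (in prob_space) beta_coeff_le_1:
  assumes sub: "subalgebra M A" "subalgebra M B"
  shows "beta_coeff M A B \<le> 1"
  by (rule beta_coeff_least[OF sub]) (rule beta_sum_le_1[OF sub])

text \<open>The first block of a sequence has no predecessors; the trivial sigma-algebra then serves
  as its past, at no cost.\<close>

lemma (in prob_space) beta_coeff_trivial: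
  assumes sub: "subalgebra M B"
  shows "subalgebra M (sigma (space M) {})" and "beta_coeff M (sigma (space M) {}) B \<le> 0"
proof -
  have sets: "sets (sigma (space M) {}) = {{}, space M}"
    by (simp add: sigma_sets_empty_eq)
  then show triv: "subalgebra M (sigma (space M) {})" by (auto simp: subalgebra_def)
  show "beta_coeff M (sigma (space M) {}) B \<le> 0"
  proof (rule beta_coeff_least[OF triv sub])
    fix p r assume p: "partition_on (space M) p" "p \<subseteq> sets (sigma (space M) {})" and r: "r \<subseteq> sets B"
    have "U = space M" if "U \<in> p" for U
      using that p unfolding sets partition_on_def by blast
    moreover have "prob (space M \<inter> V) - prob (space M) * prob V = 0" if "V \<in> r" for V
    proof -
      have "V \<in> sets M" using that r sub unfolding subalgebra_def by blast
      then show ?thesis by (simp add: prob_space sets.Int_space_eq1)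
    qed
    ultimately have "(\<Sum>U\<in>p. \<Sum>V\<in>r. \<bar>prob (U \<inter> V) - prob U * prob V\<bar>) = 0"
      by (intro sum.neutral ballI) simp
    then show "1/2 * (\<Sum>U\<in>p. \<Sum>V\<in>r. \<bar>prob (U \<inter> V) - prob U * prob V\<bar>) \<le> 0" by simp
  qed
qed

lemma partition_on_level_sets: "partition_on A ((\<lambda>i. x -` {i} \<inter> A) ` (x ` A))"
  by (auto simp: partition_on_def disjoint_def)

text \<open>The cell discrepancies have total sum zero, so the part over \<open>R\<close> and the
  part off \<open>R\<close> have the same absolute value. Hence each is at most half of the absolute
  sum, which is exactly the factor 1/2 in \<open>beta_coeff\<close>.\<close>

lemma (in prob_space) beta_coeff_finite_rect_union:
  assumes sub: "subalgebra M A" "subalgebra M B"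
    and \<xi>: "\<xi> \<in> A \<rightarrow>\<^sub>M S" and \<zeta>: "\<zeta> \<in> B \<rightarrow>\<^sub>M T"
    and E: "finite_rect_union S T E"
  shows "\<bar>prob {\<omega> \<in> space M. (\<xi> \<omega>, \<zeta> \<omega>) \<in> E}
    - measure (M \<Otimes>\<^sub>M M) {p \<in> space (M \<Otimes>\<^sub>M M). (\<xi> (fst p), \<zeta> (snd p)) \<in> E}\<bar> \<le> beta_coeff M A B"
proof -
  obtain \<alpha> \<alpha>' and R :: "(nat \<times> nat) set" where 1: "\<alpha> \<in> S \<rightarrow>\<^sub>M count_space UNIV" "finite (\<alpha> ` space S)"
     "\<alpha>' \<in> T \<rightarrow>\<^sub>M count_space UNIV" "finite (\<alpha>' ` space T)"
    and E: "E = {p \<in> space (S \<Otimes>\<^sub>M T). (\<alpha> (fst p), \<alpha>' (snd p)) \<in> R}"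
    using E unfolding finite_rect_union_def by blast
  have spA: "space A = space M" "space B = space M" using sub unfolding subalgebra_def by blast+
  have \<xi>S: "\<xi> \<omega> \<in> space S" "\<zeta> \<omega> \<in> space T" if "\<omega> \<in> space M" for \<omega>
    using measurable_space[OF \<xi>] measurable_space[OF \<zeta>] that unfolding spA by blast+
  define x y where "x \<omega> = \<alpha> (\<xi> \<omega>)" and "y \<omega> = \<alpha>' (\<zeta> \<omega>)" for \<omega>
  have x: "x \<in> A \<rightarrow>\<^sub>M count_space UNIV" and y: "y \<in> B \<rightarrow>\<^sub>M count_space UNIV"
    unfolding x_def y_def using measurable_compose[OF \<xi> 1(1)] measurable_compose[OF \<zeta> 1(3)] .
  define I J where "I = x ` space M" and "J = y ` space M"
  have fin: "finite I" "finite J"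
    using \<xi>S unfolding I_def J_def x_def y_def
    by (auto intro: finite_subset[OF _ 1(2)] finite_subset[OF _ 1(4)])
  define U V where "U i = x -` {i} \<inter> space M" and "V j = y -` {j} \<inter> space M" for i j
  have UA: "U i \<in> sets A" and VB: "V j \<in> sets B" for i j
    using measurable_sets[OF x, of "{i}"] measurable_sets[OF y, of "{j}"] unfolding U_def V_def spA by auto
  have UM [measurable]: "U i \<in> sets M" and VM [measurable]: "V j \<in> sets M" for i j
    using UA VB sub unfolding subalgebra_def by blast+
  have injU: "inj_on U I" unfolding U_def I_def by (rule inj_onI) blast
  have injV: "inj_on V J" unfolding V_def J_def by (rule inj_onI) blast
  have partU: "partition_on (space M) (U ` I)" and partV: "partition_on (space M) (V ` J)"
    unfolding U_def V_def I_def J_def by (rule partition_on_level_sets)+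
  define d where "d = (\<lambda>(i, j). prob (U i \<inter> V j) - prob (U i) * prob (V j))"
  have joint: "prob {\<omega> \<in> space M. (\<xi> \<omega>, \<zeta> \<omega>) \<in> E'} = (\<Sum>(i, j)\<in>I \<times> J \<inter> R'. prob (U i \<inter> V j))"
    if E': "E' = {p \<in> space (S \<Otimes>\<^sub>M T). (\<alpha> (fst p), \<alpha>' (snd p)) \<in> R'}" for E' R'
  proof -
    have "prob {\<omega> \<in> space M. (\<xi> \<omega>, \<zeta> \<omega>) \<in> E'} = prob (\<Union>p\<in>I \<times> J \<inter> R'. U (fst p) \<inter> V (snd p))"
    proof (intro arg_cong[where f = prob] set_eqI iffI)
      fix \<omega> assume "\<omega> \<in> {\<omega> \<in> space M. (\<xi> \<omega>, \<zeta> \<omega>) \<in> E'}"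
      then have "(x \<omega>, y \<omega>) \<in> I \<times> J \<inter> R'" "\<omega> \<in> U (x \<omega>) \<inter> V (y \<omega>)"
        by (auto simp: E' I_def J_def U_def V_def x_def y_def)
      then show "\<omega> \<in> (\<Union>p\<in>I \<times> J \<inter> R'. U (fst p) \<inter> V (snd p))" by force
    qed (use \<xi>S in \<open>auto simp: E' U_def V_def x_def y_def space_pair_measure\<close>)
    also have "\<dots> = (\<Sum>p\<in>I \<times> J \<inter> R'. prob (U (fst p) \<inter> V (snd p)))"
    proof (rule finite_measure_finite_Union)
      show "disjoint_family_on (\<lambda>p. U (fst p) \<inter> V (snd p)) (I \<times> J \<inter> R')"
        by (auto simp: disjoint_family_on_def U_def V_def)
    qed (use fin in auto)
    finally show ?thesis by (simp add: case_prod_beta)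
  qed
  interpret MM: pair_prob_space M M ..
  have prod: "measure (M \<Otimes>\<^sub>M M) {p \<in> space (M \<Otimes>\<^sub>M M). (\<xi> (fst p), \<zeta> (snd p)) \<in> E'} = (\<Sum>(i, j)\<in>I \<times> J \<inter> R'. prob (U i) * prob (V j))"
    if E': "E' = {p \<in> space (S \<Otimes>\<^sub>M T). (\<alpha> (fst p), \<alpha>' (snd p)) \<in> R'}" for E' R'
  proof -
    have "measure (M \<Otimes>\<^sub>M M) {p \<in> space (M \<Otimes>\<^sub>M M). (\<xi> (fst p), \<zeta> (snd p)) \<in> E'}
       = measure (M \<Otimes>\<^sub>M M) (\<Union>p\<in>I \<times> J \<inter> R'. U (fst p) \<times> V (snd p))"
    proof (intro arg_cong[where f = "measure (M \<Otimes>\<^sub>M M)"] set_eqI iffI)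
      fix \<omega> assume "\<omega> \<in> {p \<in> space (M \<Otimes>\<^sub>M M). (\<xi> (fst p), \<zeta> (snd p)) \<in> E'}"
      then have "(x (fst \<omega>), y (snd \<omega>)) \<in> I \<times> J \<inter> R'" "\<omega> \<in> U (x (fst \<omega>)) \<times> V (y (snd \<omega>))"
        by (auto simp: E' I_def J_def U_def V_def x_def y_def space_pair_measure)
      then show "\<omega> \<in> (\<Union>p\<in>I \<times> J \<inter> R'. U (fst p) \<times> V (snd p))" by force
    qed (use \<xi>S in \<open>auto simp: E' U_def V_def x_def y_def space_pair_measure\<close>)
    also have "\<dots> = (\<Sum>p\<in>I \<times> J \<inter> R'. measure (M \<Otimes>\<^sub>M M) (U (fst p) \<times> V (snd p)))"
    proof (rule MM.finite_measure_finite_Union)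
      show "disjoint_family_on (\<lambda>p. U (fst p) \<times> V (snd p)) (I \<times> J \<inter> R')"
        by (auto simp: disjoint_family_on_def U_def V_def)
    qed (use fin in auto)
    finally show ?thesis
      by (simp add: case_prod_beta measure_def emeasure_pair_measure_Times enn2real_mult)
  qed
  \<comment> \<open>Taking all labels in \<open>joint\<close> and \<open>prod\<close> gives the mass
    of the whole space on either side, which is 1 both times.\<close>
  have "(\<Sum>p\<in>I \<times> J. d p) = 0"
  proof -
    have "prob (space M) = (\<Sum>(i, j)\<in>I \<times> J. prob (U i \<inter> V j))"
      using joint[of _ UNIV, OF refl] \<xi>S by (simp add: space_pair_measure Collect_conj_eq Int_absorb2 subset_eq)
    moreover have "measure (M \<Otimes>\<^sub>M M) (space (M \<Otimes>\<^sub>M M)) = (\<Sum>(i, j)\<in>I \<times> J. prob (U i) * prob (V j))"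
      using prod[of _ UNIV, OF refl] \<xi>S by (simp add: space_pair_measure Collect_conj_eq Int_absorb2 subset_eq)
    ultimately show ?thesis
      unfolding d_def by (simp add: case_prod_beta sum_subtractf prob_space MM.prob_space)
  qed
  moreover have "(\<Sum>p\<in>I \<times> J. d p) = (\<Sum>p\<in>I \<times> J \<inter> R. d p) + (\<Sum>p\<in>I \<times> J - R. d p)"
    using fin by (subst sum.union_disjoint[symmetric]) (auto intro!: sum.cong)
  ultimately have "2 * \<bar>\<Sum>p\<in>I \<times> J \<inter> R. d p\<bar> = \<bar>\<Sum>p\<in>I \<times> J \<inter> R. d p\<bar> + \<bar>\<Sum>p\<in>I \<times> J - R. d p\<bar>"
    by linarith
  also have "\<dots> \<le> (\<Sum>p\<in>I \<times> J \<inter> R. \<bar>d p\<bar>) + (\<Sum>p\<in>I \<times> J - R. \<bar>d p\<bar>)"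
    by (intro add_mono sum_abs)
  also have "\<dots> = (\<Sum>p\<in>I \<times> J. \<bar>d p\<bar>)"
    using fin by (subst sum.union_disjoint[symmetric]) (auto intro!: sum.cong)
  also have "\<dots> = (\<Sum>X\<in>U ` I. \<Sum>Y\<in>V ` J. \<bar>prob (X \<inter> Y) - prob X * prob Y\<bar>)"
  proof -
    have "(\<Sum>X\<in>U ` I. \<Sum>Y\<in>V ` J. \<bar>prob (X \<inter> Y) - prob X * prob Y\<bar>)
      = (\<Sum>i\<in>I. \<Sum>j\<in>J. \<bar>prob (U i \<inter> V j) - prob (U i) * prob (V j)\<bar>)"
      by (simp only: sum.reindex[OF injU] sum.reindex[OF injV] o_def)
    then show ?thesis by (simp add: d_def sum.cartesian_product case_prod_beta)
  qed
  finally have "\<bar>\<Sum>p\<in>I \<times> J \<inter> R. d p\<bar> \<le> 1/2 * (\<Sum>X\<in>U ` I. \<Sum>Y\<in>V ` J. \<bar>prob (X \<inter> Y) - prob X * prob Y\<bar>)"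
    by simp
  also have "\<dots> \<le> beta_coeff M A B"
    using UA VB by (intro beta_coeff_upper sub finite_imageI fin partU partV) blast+
  finally show ?thesis
    unfolding joint[OF E] prod[OF E] by (simp add: d_def sum_subtractf case_prod_beta)
qed

text \<open>Finite partitions control only finite unions of rectangles; approximation carries the
  bound to every event, so the coefficient dominates the distance in total variation between the
  joint law and the product of the marginals.\<close>

lemma (in prob_space) beta_coeff_total_variation:
  assumes sub: "subalgebra M A" "subalgebra M B"
    and \<xi>: "\<xi> \<in> A \<rightarrow>\<^sub>M S" and \<zeta>: "\<zeta> \<in> B \<rightarrow>\<^sub>M T"
    and E: "E \<in> sets (S \<Otimes>\<^sub>M T)"
  shows "\<bar>prob {\<omega> \<in> space M. (\<xi> \<omega>, \<zeta> \<omega>) \<in> E}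
    - measure (M \<Otimes>\<^sub>M M) {p \<in> space (M \<Otimes>\<^sub>M M). (\<xi> (fst p), \<zeta> (snd p)) \<in> E}\<bar> \<le> beta_coeff M A B"
proof (rule field_le_epsilon)
  fix e :: real assume "e > 0"
  interpret MM: pair_prob_space M M ..
  have [measurable]: "\<xi> \<in> M \<rightarrow>\<^sub>M S" "\<zeta> \<in> M \<rightarrow>\<^sub>M T"
    using measurable_from_subalg[OF sub(1) \<xi>] measurable_from_subalg[OF sub(2) \<zeta>] .
  define m1 where "m1 = distr M (S \<Otimes>\<^sub>M T) (\<lambda>\<omega>. (\<xi> \<omega>, \<zeta> \<omega>))"
  define m2 where "m2 = distr (M \<Otimes>\<^sub>M M) (S \<Otimes>\<^sub>M T) (\<lambda>p. (\<xi> (fst p), \<zeta> (snd p)))"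
  have m1: "measure m1 F = prob {\<omega> \<in> space M. (\<xi> \<omega>, \<zeta> \<omega>) \<in> F}" if "F \<in> sets (S \<Otimes>\<^sub>M T)" for F
    unfolding m1_def using that by (subst measure_distr) (auto simp: vimage_def Int_def conj_commute)
  have m2: "measure m2 F = measure (M \<Otimes>\<^sub>M M) {p \<in> space (M \<Otimes>\<^sub>M M). (\<xi> (fst p), \<zeta> (snd p)) \<in> F}"
    if "F \<in> sets (S \<Otimes>\<^sub>M T)" for F
    unfolding m2_def using that by (subst measure_distr) (auto simp: vimage_def Int_def conj_commute)
  interpret m1: prob_space m1 unfolding m1_def by (rule prob_space_distr) measurable
  interpret m2: prob_space m2 unfolding m2_def by (rule MM.prob_space_distr) measurable
  have sets12: "sets m1 = sets (S \<Otimes>\<^sub>M T)" "sets m2 = sets (S \<Otimes>\<^sub>M T)" by (simp_all add: m1_def m2_def)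
  \<comment> \<open>One and the same approximating set must be good for both laws, so the
    approximation is made with respect to their sum.\<close>
  define m where "m = measure_of (space (S \<Otimes>\<^sub>M T)) (sets (S \<Otimes>\<^sub>M T)) (\<lambda>F. emeasure m1 F + emeasure m2 F)"
  have sets_m: "sets m = sets (S \<Otimes>\<^sub>M T)" unfolding m_def by simp
  have em: "emeasure m F = emeasure m1 F + emeasure m2 F" if "F \<in> sets (S \<Otimes>\<^sub>M T)" for F
    unfolding m_def
  proof (rule emeasure_measure_of_sigma)
    show "sigma_algebra (space (S \<Otimes>\<^sub>M T)) (sets (S \<Otimes>\<^sub>M T))" ..
    show "positive (sets (S \<Otimes>\<^sub>M T)) (\<lambda>F. emeasure m1 F + emeasure m2 F)" by (auto simp: positive_def)
    show "countably_additive (sets (S \<Otimes>\<^sub>M T)) (\<lambda>F. emeasure m1 F + emeasure m2 F)"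
    proof (rule countably_additiveI)
      fix A :: "nat \<Rightarrow> _" assume "range A \<subseteq> sets (S \<Otimes>\<^sub>M T)" "disjoint_family A"
      then show "(\<Sum>i. emeasure m1 (A i) + emeasure m2 (A i)) = emeasure m1 (\<Union>(range A)) + emeasure m2 (\<Union>(range A))"
        using sets12 by (subst suminf_add[symmetric]) (auto simp: suminf_emeasure)
    qed
  qed (rule that)
  interpret m: finite_measure m
    by (rule finite_measureI)
       (simp add: em sets_eq_imp_space_eq[OF sets_m] m1.emeasure_eq_measure m2.emeasure_eq_measure ennreal_plus[symmetric] del: ennreal_plus)
  have mm: "measure m F = measure m1 F + measure m2 F" if "F \<in> sets (S \<Otimes>\<^sub>M T)" for F
    using em[OF that] unfolding m1.emeasure_eq_measure m2.emeasure_eq_measure m.emeasure_eq_measure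
    by (simp add: ennreal_plus[symmetric] del: ennreal_plus)
  obtain F where F: "finite_rect_union S T F" "measure m ((E - F) \<union> (F - E)) < e"
    using finite_rect_union_approx[OF m.finite_measure_axioms sets_m E \<open>e > 0\<close>] by blast
  have FS: "F \<in> sets (S \<Otimes>\<^sub>M T)" by (rule finite_rect_union_sets[OF F(1)])
  have close: "\<bar>measure n E - measure n F\<bar> \<le> measure n ((E - F) \<union> (F - E))"
    if "finite_measure n" and n: "sets n = sets (S \<Otimes>\<^sub>M T)" for n
  proof -
    interpret n: finite_measure n by fact
    have [measurable]: "E \<in> sets n" "F \<in> sets n" using E FS n by auto
    have "measure n E \<le> measure n (F \<union> ((E - F) \<union> (F - E)))" "measure n F \<le> measure n (E \<union> ((E - F) \<union> (F - E)))"
      by (rule n.finite_measure_mono; auto)+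
    moreover have "measure n (F \<union> ((E - F) \<union> (F - E))) \<le> measure n F + measure n ((E - F) \<union> (F - E))"
      "measure n (E \<union> ((E - F) \<union> (F - E))) \<le> measure n E + measure n ((E - F) \<union> (F - E))"
      by (rule measure_Un_le; simp)+
    ultimately show ?thesis by linarith
  qed
  have "\<bar>measure m1 F - measure m2 F\<bar> \<le> beta_coeff M A B"
    unfolding m1[OF FS] m2[OF FS] by (rule beta_coeff_finite_rect_union[OF sub \<xi> \<zeta> F(1)])
  moreover have "\<bar>measure m1 E - measure m1 F\<bar> + \<bar>measure m2 E - measure m2 F\<bar> < e"
    using close[OF m1.finite_measure_axioms sets12(1)] close[OF m2.finite_measure_axioms sets12(2)] F(2) E FS
    by (simp add: mm)
  ultimately show "\<bar>prob {\<omega> \<in> space M. (\<xi> \<omega>, \<zeta> \<omega>) \<in> E}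
    - measure (M \<Otimes>\<^sub>M M) {p \<in> space (M \<Otimes>\<^sub>M M). (\<xi> (fst p), \<zeta> (snd p)) \<in> E}\<bar> \<le> beta_coeff M A B + e"
    unfolding m1[OF E, symmetric] m2[OF E, symmetric] by linarith
qed


section \<open>Concentration of weakly dependent sums\<close>

text \<open>The exponent is minimised at \<open>\<theta> = u / v\<close>. Since the moment bound is
  assumed for both signs of \<open>\<theta>\<close>, the two tails are the cases
  \<open>s = 1\<close> and \<open>s = - 1\<close>.\<close>

lemma (in prob_space) chernoff_two_sided:
  assumes X [measurable]: "X \<in> borel_measurable M"
    and mgf: "\<And>\<theta>. (\<integral>\<^sup>+\<omega>. ennreal (exp (\<theta> * X \<omega>)) \<partial>M) \<le> ennreal (exp (\<theta>\<^sup>2 * v / 2))"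
    and v: "v > 0" and u: "u \<ge> 0"
  shows "prob {\<omega>\<in>space M. \<bar>X \<omega>\<bar> > u} \<le> 2 * exp (- u\<^sup>2 / (2 * v))"
proof -
  have one: "prob {\<omega>\<in>space M. s * X \<omega> > u} \<le> exp (- u\<^sup>2 / (2 * v))" if s: "s\<^sup>2 = 1" for s :: real
  proof -
    define A where "A = {\<omega>\<in>space M. s * X \<omega> > u}"
    have A [measurable]: "A \<in> sets M" unfolding A_def by measurable
    define \<theta> where "\<theta> = u / v"
    have "\<theta> \<ge> 0" using u v by (simp add: \<theta>_def)
    have "ennreal (exp (\<theta> * u)) * emeasure M A = (\<integral>\<^sup>+\<omega>. ennreal (exp (\<theta> * u)) * indicator A \<omega> \<partial>M)"
      by (simp add: nn_integral_cmult)
    also have "\<dots> \<le> (\<integral>\<^sup>+\<omega>. ennreal (exp ((\<theta> * s) * X \<omega>)) \<partial>M)"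
      using \<open>\<theta> \<ge> 0\<close>
      by (intro nn_integral_mono) (auto simp: A_def indicator_def mult.assoc intro!: mult_left_mono)
    also have "\<dots> \<le> ennreal (exp ((\<theta> * s)\<^sup>2 * v / 2))" by (rule mgf)
    finally have "ennreal (exp (\<theta> * u) * prob A) \<le> ennreal (exp (\<theta>\<^sup>2 * v / 2))"
      using s by (simp add: ennreal_mult emeasure_eq_measure power_mult_distrib)
    then have "exp (\<theta> * u) * prob A \<le> exp (\<theta>\<^sup>2 * v / 2)" by simp
    then have "prob A \<le> exp (\<theta>\<^sup>2 * v / 2) / exp (\<theta> * u)"
      by (simp add: field_simps)
    also have "\<dots> = exp (\<theta>\<^sup>2 * v / 2 - \<theta> * u)" by (rule exp_diff[symmetric])
    also have "\<theta>\<^sup>2 * v / 2 - \<theta> * u = - u\<^sup>2 / (2 * v)"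
      using v unfolding \<theta>_def by (simp add: field_simps power2_eq_square)
    finally show ?thesis unfolding A_def .
  qed
  have "prob {\<omega>\<in>space M. \<bar>X \<omega>\<bar> > u} \<le> prob ({\<omega>\<in>space M. 1 * X \<omega> > u} \<union> {\<omega>\<in>space M. (- 1) * X \<omega> > u})"
  proof (rule finite_measure_mono)
    show "{\<omega>\<in>space M. \<bar>X \<omega>\<bar> > u} \<subseteq> {\<omega>\<in>space M. 1 * X \<omega> > u} \<union> {\<omega>\<in>space M. (- 1) * X \<omega> > u}"
      by auto
    show "{\<omega>\<in>space M. 1 * X \<omega> > u} \<union> {\<omega>\<in>space M. (- 1) * X \<omega> > u} \<in> events" by measurable
  qed
  also have "\<dots> \<le> prob {\<omega>\<in>space M. 1 * X \<omega> > u} + prob {\<omega>\<in>space M. (- 1) * X \<omega> > u}"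
    by (rule measure_Un_le) measurable
  also have "\<dots> \<le> 2 * exp (- u\<^sup>2 / (2 * v))"
    using one[of 1] one[of "- 1"] by simp
  finally show ?thesis .
qed

text \<open>Hoeffding's lemma treats positive \<open>\<theta>\<close>; for negative
  \<open>\<theta>\<close> it is applied to \<open>- f\<close> on the reflected interval, of the same
  length.\<close>

lemma (in prob_space) hoeffding_mgf:
  assumes f [measurable]: "f \<in> borel_measurable M"
    and bnd: "\<And>\<omega>. \<omega> \<in> space M \<Longrightarrow> f \<omega> \<in> {a..b}" and mean: "expectation f = 0"
  shows "(\<integral>\<^sup>+\<omega>. ennreal (exp (\<theta> * f \<omega>)) \<partial>M) \<le> ennreal (exp (\<theta>\<^sup>2 * (b - a)\<^sup>2 / 8))"
proof -
  consider "\<theta> = 0" | "\<theta> > 0" | "\<theta> < 0" by linarith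
  then show ?thesis
  proof cases
    case 1
    then show ?thesis by (simp add: emeasure_space_1)
  next
    case 2
    interpret interval_bounded_random_variable M f a b
      by unfold_locales (auto intro!: AE_I2 dest: bnd)
    show ?thesis by (rule Hoeffdings_lemma_nn_integral_0[OF 2 mean])
  next
    case 3
    interpret interval_bounded_random_variable M "\<lambda>\<omega>. - f \<omega>" "- b" "- a"
      by unfold_locales (auto intro!: AE_I2 dest: bnd)
    have "expectation (\<lambda>\<omega>. - f \<omega>) = 0" using mean by simp
    from Hoeffdings_lemma_nn_integral_0[OF _ this, of "- \<theta>"] 3 show ?thesis
      by (simp add: algebra_simps)
  qed
qed

text \<open>Slicing along the second factor allows two product measures with the same second factor,
  such as \<open>M \<Otimes>\<^sub>M M\<close> and \<open>Q \<Otimes>\<^sub>M M\<close>, to be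
  compared slice by slice.\<close>

lemma (in prob_space) measure_pair_slices:
  assumes "prob_space N" and C: "C \<in> sets (N \<Otimes>\<^sub>M M)"
  shows "integrable M (\<lambda>y. measure N ((\<lambda>x. (x, y)) -` C))"
    and "measure (N \<Otimes>\<^sub>M M) C = expectation (\<lambda>y. measure N ((\<lambda>x. (x, y)) -` C))"
proof -
  interpret N: prob_space N by fact
  interpret NM: pair_prob_space N M ..
  have "(\<lambda>y. measure N ((\<lambda>x. (x, y)) -` C)) \<in> borel_measurable M"
    using NM.measurable_emeasure_Pair2[OF C, THEN borel_measurable_enn2real] by (simp add: measure_def)
  then show int: "integrable M (\<lambda>y. measure N ((\<lambda>x. (x, y)) -` C))"
    by (intro integrable_const_bound[where B = 1]) auto
  have "emeasure (N \<Otimes>\<^sub>M M) C = (\<integral>\<^sup>+y. ennreal (measure N ((\<lambda>x. (x, y)) -` C)) \<partial>M)"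
    by (simp add: NM.emeasure_pair_measure_alt2[OF C] N.emeasure_eq_measure)
  also have "\<dots> = ennreal (expectation (\<lambda>y. measure N ((\<lambda>x. (x, y)) -` C)))"
    using int by (intro nn_integral_eq_integral) auto
  finally show "measure (N \<Otimes>\<^sub>M M) C = expectation (\<lambda>y. measure N ((\<lambda>x. (x, y)) -` C))"
    by (simp add: measure_def)
qed

text \<open>The block sums \<open>Y 0, ..., Y (m - 1)\<close> are compared with independent copies; the measure \<open>Q\<close>
  is the law of the sum of these copies.\<close>

lemma (in prob_space) decoupled_sum:
  fixes Y :: "nat \<Rightarrow> 'a \<Rightarrow> 'i \<Rightarrow> real"
  defines "L I \<equiv> PiM I (\<lambda>_. borel :: real measure)"
  assumes "\<beta> \<ge> 0"
    and dep: "\<And>j. j < m \<Longrightarrow> \<exists>A B. subalgebra M A \<and> subalgebra M B \<and> beta_coeff M A B \<le> \<beta> \<and>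
      (\<forall>i<j. Y i \<in> A \<rightarrow>\<^sub>M L I) \<and> Y j \<in> B \<rightarrow>\<^sub>M L I"
  shows "\<exists>Q. prob_space Q \<and> sets Q = sets (L I) \<and>
    (\<forall>E\<in>sets (L I). \<bar>prob {\<omega>\<in>space M. (\<lambda>g\<in>I. \<Sum>i<m. Y i \<omega> g) \<in> E} - measure Q E\<bar> \<le> real m * \<beta>) \<and>
    (\<forall>g\<in>I. \<forall>\<theta>. (\<integral>\<^sup>+y. ennreal (exp (\<theta> * y g)) \<partial>Q) = (\<Prod>i<m. \<integral>\<^sup>+\<omega>. ennreal (exp (\<theta> * Y i \<omega> g)) \<partial>M))"
  using dep
proof (induction m)
  case 0
  define z where "z = (\<lambda>g\<in>I. 0 :: real)"
  have z: "z \<in> space (L I)" by (simp add: z_def L_def space_PiM)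
  have z0: "(\<lambda>g\<in>I. \<Sum>i<(0::nat). Y i \<omega> g) = z" for \<omega>
    by (simp add: z_def)
  have 1: "prob {\<omega>\<in>space M. z \<in> E} = indicator E z" for E
    by (cases "z \<in> E") (simp_all add: prob_space)
  have 2: "measure (return (L I) z) E = indicator E z" if "E \<in> sets (L I)" for E
    using that by (simp add: measure_return)
  have 3: "(\<integral>\<^sup>+y. ennreal (exp (\<theta> * y g)) \<partial>return (L I) z) = 1" if "g \<in> I" for g \<theta>
  proof -
    have "(\<lambda>y. ennreal (exp (\<theta> * y g))) \<in> borel_measurable (L I)"
      unfolding L_def using that by measurable
    then show ?thesis using z that by (simp add: nn_integral_return z_def)
  qed
  show ?case
    unfolding z0 by (rule exI[of _ "return (L I) z"]) (use 1 2 3 in \<open>simp add: prob_space_return[OF z]\<close>)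
next
  case (Suc m)
  have "\<exists>Q. prob_space Q \<and> sets Q = sets (L I) \<and>
    (\<forall>E\<in>sets (L I). \<bar>prob {\<omega>\<in>space M. (\<lambda>g\<in>I. \<Sum>i<m. Y i \<omega> g) \<in> E} - measure Q E\<bar> \<le> real m * \<beta>) \<and>
    (\<forall>g\<in>I. \<forall>\<theta>. (\<integral>\<^sup>+y. ennreal (exp (\<theta> * y g)) \<partial>Q) = (\<Prod>i<m. \<integral>\<^sup>+\<omega>. ennreal (exp (\<theta> * Y i \<omega> g)) \<partial>M))"
    by (rule Suc.IH) (rule Suc.prems, simp)
  then obtain Q where Q: "prob_space Q" and sets_Q: "sets Q = sets (L I)"
    and TV: "\<And>E. E \<in> sets (L I) \<Longrightarrow> \<bar>prob {\<omega>\<in>space M. (\<lambda>g\<in>I. \<Sum>i<m. Y i \<omega> g) \<in> E} - measure Q E\<bar> \<le> real m * \<beta>"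
    and mgf: "\<And>g \<theta>. g \<in> I \<Longrightarrow> (\<integral>\<^sup>+y. ennreal (exp (\<theta> * y g)) \<partial>Q) = (\<Prod>i<m. \<integral>\<^sup>+\<omega>. ennreal (exp (\<theta> * Y i \<omega> g)) \<partial>M)"
    by blast
  obtain A B where AB: "subalgebra M A" "subalgebra M B" "beta_coeff M A B \<le> \<beta>"
    and YA: "\<And>i. i < m \<Longrightarrow> Y i \<in> A \<rightarrow>\<^sub>M L I" and YB: "Y m \<in> B \<rightarrow>\<^sub>M L I"
    using Suc.prems[of m] by auto
  interpret Q: prob_space Q by (rule Q)
  interpret QM: pair_prob_space Q M ..
  define S where "S \<omega> = (\<lambda>g\<in>I. \<Sum>i<m. Y i \<omega> g)" for \<omega>
  define add where "add = (\<lambda>(s :: 'i \<Rightarrow> real, y :: 'i \<Rightarrow> real). \<lambda>g\<in>I. s g + y g)"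
  have YAg: "(\<lambda>\<omega>. Y i \<omega> g) \<in> borel_measurable A" if "i < m" "g \<in> I" for i g
    using measurable_compose[OF YA[OF that(1), unfolded L_def] measurable_component_singleton[OF that(2)]] .
  have SA: "S \<in> A \<rightarrow>\<^sub>M L I"
    unfolding S_def[abs_def] L_def by (rule measurable_restrict) (auto intro!: borel_measurable_sum YAg)
  have S [measurable]: "S \<in> M \<rightarrow>\<^sub>M L I" by (rule measurable_from_subalg[OF AB(1) SA])
  have Y [measurable]: "Y m \<in> M \<rightarrow>\<^sub>M L I" by (rule measurable_from_subalg[OF AB(2) YB])
  have add [measurable]: "add \<in> L I \<Otimes>\<^sub>M L I \<rightarrow>\<^sub>M L I"
    unfolding add_def L_def case_prod_beta by (rule measurable_restrict) measurable
  have QL [measurable_cong]: "sets Q = sets (L I)" by (rule sets_Q)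
  \<comment> \<open>The copy of the last block lives on a fresh factor \<open>M\<close>, hence is
    independent of the sum already distributed as \<open>Q\<close>.\<close>
  define Q' where "Q' = distr (Q \<Otimes>\<^sub>M M) (L I) (\<lambda>p. add (fst p, Y m (snd p)))"
  have meas [measurable]: "(\<lambda>p. add (fst p, Y m (snd p))) \<in> Q \<Otimes>\<^sub>M M \<rightarrow>\<^sub>M L I"
    by measurable
  have "prob_space Q'" unfolding Q'_def by (rule QM.prob_space_distr) measurable
  moreover have "sets Q' = sets (L I)" by (simp add: Q'_def)
  moreover have "\<bar>prob {\<omega>\<in>space M. (\<lambda>g\<in>I. \<Sum>i<Suc m. Y i \<omega> g) \<in> E} - measure Q' E\<bar> \<le> real (Suc m) * \<beta>"
    if E: "E \<in> sets (L I)" for E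
  proof -
    define E' where "E' = add -` E \<inter> space (L I \<Otimes>\<^sub>M L I)"
    have E' [measurable]: "E' \<in> sets (L I \<Otimes>\<^sub>M L I)" unfolding E'_def by (rule measurable_sets[OF add E])
    have inE': "(s, y) \<in> E' \<longleftrightarrow> add (s, y) \<in> E" if "s \<in> space (L I)" "y \<in> space (L I)" for s y
      using that by (auto simp: E'_def space_pair_measure)
    have SY: "S \<omega> \<in> space (L I)" "Y m \<omega> \<in> space (L I)" if "\<omega> \<in> space M" for \<omega>
      using that measurable_space[OF S] measurable_space[OF Y] by auto
    have a: "{\<omega>\<in>space M. (\<lambda>g\<in>I. \<Sum>i<Suc m. Y i \<omega> g) \<in> E} = {\<omega>\<in>space M. (S \<omega>, Y m \<omega>) \<in> E'}"
    proof -
      have "(\<lambda>g\<in>I. \<Sum>i<Suc m. Y i \<omega> g) = add (S \<omega>, Y m \<omega>)" for \<omega>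
        by (auto simp: add_def S_def restrict_def)
      then show ?thesis using inE' SY by auto
    qed
    \<comment> \<open>Two exchanges: making \<open>Y m\<close> independent of the past sum
      \<open>S\<close> costs one coefficient \<open>\<beta>\<close>; then the law of
      \<open>S\<close> is replaced by \<open>Q\<close> in every slice, at the cost
      \<open>real m * \<beta>\<close> known by induction.\<close>
    have tv1: "\<bar>prob {\<omega> \<in> space M. (S \<omega>, Y m \<omega>) \<in> E'}
      - measure (M \<Otimes>\<^sub>M M) {p \<in> space (M \<Otimes>\<^sub>M M). (S (fst p), Y m (snd p)) \<in> E'}\<bar> \<le> \<beta>"
      using beta_coeff_total_variation[OF AB(1,2) SA YB E'] AB(3) by linarith
    interpret MM: pair_prob_space M M ..
    define sec where "sec y = {s \<in> space (L I). (s, y) \<in> E'}" for y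
    have sec: "sec y \<in> sets (L I)" if "y \<in> space (L I)" for y
      unfolding sec_def using that by measurable
    define F where "F \<omega> = prob {\<omega>'\<in>space M. S \<omega>' \<in> sec (Y m \<omega>)}" for \<omega>
    define H where "H \<omega> = measure Q (sec (Y m \<omega>))" for \<omega>
    define C where "C = {p \<in> space (M \<Otimes>\<^sub>M M). (S (fst p), Y m (snd p)) \<in> E'}"
    have C: "C \<in> sets (M \<Otimes>\<^sub>M M)" unfolding C_def by measurable
    have "(\<lambda>x. (x, y)) -` C = {\<omega>'\<in>space M. S \<omega>' \<in> sec (Y m y)}" if "y \<in> space M" for y
      using that SY by (auto simp: C_def sec_def space_pair_measure)
    then have F: "integrable M F" and MM_eq: "measure (M \<Otimes>\<^sub>M M) C = expectation F"
      using measure_pair_slices[OF prob_space_axioms C] unfolding F_def by (auto cong: Bochner_Integration.integrable_cong Bochner_Integration.integral_cong)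
    define D where "D = {p \<in> space (Q \<Otimes>\<^sub>M M). (fst p, Y m (snd p)) \<in> E'}"
    have D: "D \<in> sets (Q \<Otimes>\<^sub>M M)" unfolding D_def by measurable
    have spQ: "space Q = space (L I)" by (rule sets_eq_imp_space_eq[OF sets_Q])
    have "(\<lambda>x. (x, y)) -` D = sec (Y m y)" if "y \<in> space M" for y
      using that SY by (auto simp: D_def sec_def space_pair_measure spQ)
    then have H: "integrable M H" and "measure (Q \<Otimes>\<^sub>M M) D = expectation H"
      using measure_pair_slices[OF Q D] unfolding H_def by (auto cong: Bochner_Integration.integrable_cong Bochner_Integration.integral_cong)
    moreover have "measure Q' E = measure (Q \<Otimes>\<^sub>M M) D"
      unfolding Q'_def D_def using E inE' SY spQ
      by (subst measure_distr) (auto intro!: arg_cong[where f = "measure (Q \<Otimes>\<^sub>M M)"] simp: space_pair_measure)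
    ultimately have Q'_eq: "measure Q' E = expectation H" by simp
    have "\<bar>expectation F - expectation H\<bar> = \<bar>expectation (\<lambda>\<omega>. F \<omega> - H \<omega>)\<bar>"
      using F H by simp
    also have "\<dots> \<le> expectation (\<lambda>\<omega>. \<bar>F \<omega> - H \<omega>\<bar>)" by (rule integral_abs_bound)
    also have "\<dots> \<le> expectation (\<lambda>_. real m * \<beta>)"
    proof (rule integral_mono)
      show "integrable M (\<lambda>\<omega>. \<bar>F \<omega> - H \<omega>\<bar>)" using F H by simp
      show "\<bar>F \<omega> - H \<omega>\<bar> \<le> real m * \<beta>" if "\<omega> \<in> space M" for \<omega>
        unfolding F_def H_def S_def using TV[OF sec[OF SY(2)[OF that]]] .
    qed simp
    finally have tv2: "\<bar>expectation F - expectation H\<bar> \<le> real m * \<beta>" by (simp add: prob_space)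
    show ?thesis
      using tv1 tv2 unfolding a C_def[symmetric] MM_eq Q'_eq by (simp add: algebra_simps)
  qed
  moreover have "(\<integral>\<^sup>+y. ennreal (exp (\<theta> * y g)) \<partial>Q') = (\<Prod>i<Suc m. \<integral>\<^sup>+\<omega>. ennreal (exp (\<theta> * Y i \<omega> g)) \<partial>M)"
    if g: "g \<in> I" for g \<theta>
  proof -
    have [measurable]: "(\<lambda>y. y g) \<in> borel_measurable (L I)" unfolding L_def using g by measurable
    have "(\<integral>\<^sup>+y. ennreal (exp (\<theta> * y g)) \<partial>Q')
      = (\<integral>\<^sup>+p. ennreal (exp (\<theta> * fst p g)) * ennreal (exp (\<theta> * Y m (snd p) g)) \<partial>(Q \<Otimes>\<^sub>M M))"
      unfolding Q'_def using g
      by (subst nn_integral_distr[OF meas])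
        (auto simp: add_def ennreal_mult[symmetric] exp_add[symmetric] distrib_left intro!: nn_integral_cong)
    also have "\<dots> = (\<integral>\<^sup>+s. (\<integral>\<^sup>+\<omega>. ennreal (exp (\<theta> * s g)) * ennreal (exp (\<theta> * Y m \<omega> g)) \<partial>M) \<partial>Q)"
      by (subst nn_integral_fst[symmetric]) auto
    also have "\<dots> = (\<integral>\<^sup>+s. ennreal (exp (\<theta> * s g)) \<partial>Q) * (\<integral>\<^sup>+\<omega>. ennreal (exp (\<theta> * Y m \<omega> g)) \<partial>M)"
      by (simp add: nn_integral_cmult nn_integral_multc)
    finally show ?thesis by (simp add: mgf[OF g])
  qed
  ultimately show ?case by blast
qed

text \<open>The failure event for all \<open>g\<close> at once is a single event of the vector of
  sums, so it is transferred to \<open>Q\<close> once; the union bound over \<open>I\<close> is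
  taken afterwards, under \<open>Q\<close>.\<close>

lemma (in prob_space) mixing_concentration:
  fixes Y :: "nat \<Rightarrow> 'a \<Rightarrow> 'i \<Rightarrow> real"
  assumes I: "finite I" and "\<beta> \<ge> 0"
    and dep: "\<And>j. j < m \<Longrightarrow> \<exists>A B. subalgebra M A \<and> subalgebra M B \<and> beta_coeff M A B \<le> \<beta> \<and>
      (\<forall>i<j. Y i \<in> A \<rightarrow>\<^sub>M PiM I (\<lambda>_. borel)) \<and> Y j \<in> B \<rightarrow>\<^sub>M PiM I (\<lambda>_. borel)"
    and bnd: "\<And>j g \<omega>. j < m \<Longrightarrow> g \<in> I \<Longrightarrow> \<omega> \<in> space M \<Longrightarrow> Y j \<omega> g \<in> {a j g..a j g + r j}"
    and mean: "\<And>j g. j < m \<Longrightarrow> g \<in> I \<Longrightarrow> expectation (\<lambda>\<omega>. Y j \<omega> g) = 0"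
    and R: "(\<Sum>j<m. (r j)\<^sup>2) \<le> R" "R > 0" and u: "u \<ge> 0"
  shows "prob {\<omega>\<in>space M. \<exists>g\<in>I. \<bar>\<Sum>j<m. Y j \<omega> g\<bar> > u} \<le> real m * \<beta> + real (card I) * (2 * exp (- 2 * u\<^sup>2 / R))"
proof -
  let ?L = "PiM I (\<lambda>_. borel :: real measure)"
  obtain Q where Q: "prob_space Q" and sets_Q: "sets Q = sets ?L"
    and TV: "\<And>E. E \<in> sets ?L \<Longrightarrow> \<bar>prob {\<omega>\<in>space M. (\<lambda>g\<in>I. \<Sum>i<m. Y i \<omega> g) \<in> E} - measure Q E\<bar> \<le> real m * \<beta>"
    and mgf: "\<And>g \<theta>. g \<in> I \<Longrightarrow> (\<integral>\<^sup>+y. ennreal (exp (\<theta> * y g)) \<partial>Q) = (\<Prod>i<m. \<integral>\<^sup>+\<omega>. ennreal (exp (\<theta> * Y i \<omega> g)) \<partial>M)"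
    using decoupled_sum[OF \<open>\<beta> \<ge> 0\<close> dep] by blast
  interpret Q: prob_space Q by (rule Q)
  have QL [measurable_cong]: "sets Q = sets ?L" by (rule sets_Q)
  have spQ: "space Q = space ?L" by (rule sets_eq_imp_space_eq[OF sets_Q])
  have Ym: "(\<lambda>\<omega>. Y j \<omega> g) \<in> borel_measurable M" if j: "j < m" "g \<in> I" for j g
  proof -
    obtain B where "subalgebra M B" "Y j \<in> B \<rightarrow>\<^sub>M ?L" using dep[OF j(1)] by blast
    then have "Y j \<in> M \<rightarrow>\<^sub>M ?L" by (rule measurable_from_subalg)
    from measurable_compose[OF this measurable_component_singleton[OF j(2)]] show ?thesis .
  qed
  \<comment> \<open>Hoeffding's exponents \<open>(r i)\<^sup>2 / 8\<close> add up under
    \<open>Q\<close>, so the sum is sub-Gaussian with variance proxy \<open>R / 4\<close>; this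
    becomes \<open>- 2 * u\<^sup>2 / R\<close> in the Chernoff bound.\<close>
  have mgf': "(\<integral>\<^sup>+y. ennreal (exp (\<theta> * y g)) \<partial>Q) \<le> ennreal (exp (\<theta>\<^sup>2 * (R / 4) / 2))" if g: "g \<in> I" for g \<theta>
  proof -
    have "(\<integral>\<^sup>+y. ennreal (exp (\<theta> * y g)) \<partial>Q) \<le> (\<Prod>i<m. ennreal (exp (\<theta>\<^sup>2 * (r i)\<^sup>2 / 8)))"
      unfolding mgf[OF g]
    proof (rule prod_mono_ennreal)
      fix i assume "i \<in> {..<m}"
      then show "(\<integral>\<^sup>+\<omega>. ennreal (exp (\<theta> * Y i \<omega> g)) \<partial>M) \<le> ennreal (exp (\<theta>\<^sup>2 * (r i)\<^sup>2 / 8))"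
        using hoeffding_mgf[OF Ym[of i g] bnd[of i g] mean[of i g], of \<theta>] g by simp
    qed
    also have "\<dots> = ennreal (exp (\<theta>\<^sup>2 * (\<Sum>i<m. (r i)\<^sup>2) / 8))"
      by (simp add: prod_ennreal exp_sum[symmetric] sum_distrib_left sum_divide_distrib)
    also have "\<dots> \<le> ennreal (exp (\<theta>\<^sup>2 * (R / 4) / 2))"
      using mult_left_mono[OF R(1), of "\<theta>\<^sup>2"] by (intro ennreal_leI) simp
    finally show ?thesis .
  qed
  have comp [measurable]: "(\<lambda>y. y g) \<in> borel_measurable ?L" if "g \<in> I" for g using that by measurable
  define E where "E = (\<Union>g\<in>I. {y\<in>space ?L. \<bar>y g\<bar> > u})"
  have Eg: "{y\<in>space ?L. \<bar>y g\<bar> > u} \<in> sets ?L" if "g \<in> I" for g using that by measurable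
  have E: "E \<in> sets ?L" unfolding E_def using I Eg by (intro sets.finite_UN) auto
  have "measure Q E \<le> (\<Sum>g\<in>I. measure Q {y\<in>space ?L. \<bar>y g\<bar> > u})"
    unfolding E_def using I Eg by (intro measure_UNION_le) (auto simp: sets_Q)
  also have "\<dots> \<le> (\<Sum>g\<in>I. 2 * exp (- 2 * u\<^sup>2 / R))"
  proof (rule sum_mono)
    fix g assume g: "g \<in> I"
    have "measure Q {y\<in>space Q. \<bar>y g\<bar> > u} \<le> 2 * exp (- u\<^sup>2 / (2 * (R / 4)))"
      using R u by (intro Q.chernoff_two_sided mgf' g) (simp_all add: measurable_cong_sets[OF sets_Q refl] comp[OF g])
    then show "measure Q {y\<in>space ?L. \<bar>y g\<bar> > u} \<le> 2 * exp (- 2 * u\<^sup>2 / R)"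
      unfolding spQ by (simp add: mult.commute)
  qed
  finally have "measure Q E \<le> real (card I) * (2 * exp (- 2 * u\<^sup>2 / R))" by simp
  moreover have "{\<omega>\<in>space M. \<exists>g\<in>I. \<bar>\<Sum>j<m. Y j \<omega> g\<bar> > u} = {\<omega>\<in>space M. (\<lambda>g\<in>I. \<Sum>i<m. Y i \<omega> g) \<in> E}"
    by (auto simp: E_def space_PiM)
  moreover have "prob {\<omega>\<in>space M. (\<lambda>g\<in>I. \<Sum>i<m. Y i \<omega> g) \<in> E} \<le> real m * \<beta> + measure Q E"
    using TV[OF E] by (simp only: abs_le_iff diff_le_eq)
  ultimately show ?thesis by simp
qed


section \<open>The stationary segment process\<close>

lemma borel_measurable_vec:
  fixes f :: "'a \<Rightarrow> ('c::euclidean_space)^'n::finite"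
  assumes "\<And>i. (\<lambda>x. f x $ i) \<in> borel_measurable M"
  shows "f \<in> borel_measurable M"
proof (subst borel_measurable_euclidean_space, intro ballI)
  fix b :: "'c^'n" assume "b \<in> Basis"
  then obtain i u where b: "b = axis i u" by (auto simp: Basis_vec_def)
  show "(\<lambda>x. f x \<bullet> b) \<in> borel_measurable M"
    unfolding b inner_axis using assms[of i] by measurable
qed

locale stationary_sdde = prob_space M
  for M :: "'w measure"
    and F :: "real \<Rightarrow> 'w measure"
    and \<tau> :: "'b::{finite,linorder} \<Rightarrow> real"
    and G :: "(real^'d::finite, 'b) vec \<Rightarrow> real^'d"
    and S :: "real^'d^'d"
    and W X :: "real \<Rightarrow> 'w \<Rightarrow> real^'d"
    and P :: "real \<Rightarrow> (real \<Rightarrow> real^'d) \<Rightarrow> (real \<Rightarrow> real^'d) measure"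
    and \<pi> :: "(real \<Rightarrow> real^'d) measure"
    and \<mu> :: "((real^'d, 'b) vec) measure" +
  assumes delays: "is_delays \<tau>"
    and brownian: "brownian_motion M F W"
    and kernel: "segment_kernel M F \<tau> G S W P"
    and invariant: "invariant_measure (segment_space (tau_max \<tau>)) P \<pi>"
    and law: "\<mu> = stationary_law \<tau> \<pi>"
    and stationary: "stationary_solution M F \<tau> G S W \<pi> X"
    and drift_continuous: "continuous_on UNIV G"
begin

abbreviation \<C> :: "(real \<Rightarrow> real^'d) measure" where "\<C> \<equiv> segment_space (tau_max \<tau>)"

definition seg :: "real \<Rightarrow> 'w \<Rightarrow> real \<Rightarrow> real^'d" where
  "seg s \<omega> = segment (tau_max \<tau>) (\<lambda>r. X r \<omega>) s"

definition Z :: "real \<Rightarrow> 'w \<Rightarrow> (real^'d, 'b) vec" where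
  "Z s \<omega> = delay_vec \<tau> (\<lambda>r. X r \<omega>) s"

lemma delay_bounds: "0 \<le> \<tau> a" "\<tau> a \<le> tau_max \<tau>"
proof -
  have mono: "mono \<tau>" and "\<tau> block0 = 0"
    using delays by (auto simp: is_delays_def strict_mono_mono)
  then show "0 \<le> \<tau> a" "\<tau> a \<le> tau_max \<tau>"
    unfolding tau_max_def using monoD[OF mono, of block0 a] monoD[OF mono, of a "Max UNIV"] by auto
qed

lemma tau_max_nonneg: "0 \<le> tau_max \<tau>"
  using delay_bounds[of undefined] by linarith

lemma filtration: "t \<ge> 0 \<Longrightarrow> subalgebra M (F t)" "0 \<le> s \<Longrightarrow> s \<le> t \<Longrightarrow> sets (F s) \<subseteq> sets (F t)"
  using brownian by (auto simp: brownian_motion_def is_filtration_def)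

lemma space_filtration: "t \<ge> 0 \<Longrightarrow> space (F t) = space M"
  using filtration(1) by (auto simp: subalgebra_def)

lemma measurable_filtration_mono:
  assumes "f \<in> F s \<rightarrow>\<^sub>M N" "0 \<le> s" "s \<le> t"
  shows "f \<in> F t \<rightarrow>\<^sub>M N"
  using assms filtration(2)[of s t] space_filtration[of s] space_filtration[of t]
  by (auto simp: measurable_def)

lemma solution: "sdde_solution M F \<tau> G S W X"
  using stationary by (simp add: stationary_solution_def)

lemma X_adapted:
  assumes "- tau_max \<tau> \<le> r" "r \<le> t" "0 \<le> t"
  shows "X r \<in> borel_measurable (F t)"
proof -
  have "X r \<in> borel_measurable (F (max 0 r))"
    using solution assms by (simp add: sdde_solution_def)
  then show ?thesis
    by (rule measurable_filtration_mono) (use assms in auto)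
qed

lemma X_continuous: "\<omega> \<in> space M \<Longrightarrow> continuous_on {- tau_max \<tau>..} (\<lambda>t. X t \<omega>)"
  using solution by (simp add: sdde_solution_def)

lemma seg_adapted:
  assumes "0 \<le> s"
  shows "seg s \<in> F s \<rightarrow>\<^sub>M \<C>"
  unfolding segment_space_def
proof (rule measurable_restrict_space2)
  show "seg s \<in> F s \<rightarrow>\<^sub>M PiM {- tau_max \<tau>..0} (\<lambda>_. borel)"
    unfolding seg_def[abs_def] segment_def
    by (rule measurable_restrict) (use assms in \<open>auto intro!: X_adapted\<close>)
  show "seg s \<in> space (F s) \<rightarrow> {\<phi>. continuous_on {- tau_max \<tau>..0} \<phi>}"
  proof safe
    fix \<omega> assume "\<omega> \<in> space (F s)"
    then have "\<omega> \<in> space M" by (simp add: space_filtration assms)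
    have "continuous_on {- tau_max \<tau>..0} (\<lambda>r. X (s + r) \<omega>)"
      by (rule continuous_on_compose2[OF X_continuous[OF \<open>\<omega> \<in> space M\<close>]])
         (use assms in \<open>auto intro!: continuous_intros\<close>)
    then show "continuous_on {- tau_max \<tau>..0} (seg s \<omega>)"
      unfolding seg_def segment_def by (rule continuous_on_eq) simp
  qed
qed

lemma seg_measurable: "0 \<le> s \<Longrightarrow> seg s \<in> M \<rightarrow>\<^sub>M \<C>"
  by (rule measurable_from_subalg[OF filtration(1) seg_adapted])

lemma seg_space: "0 \<le> s \<Longrightarrow> \<omega> \<in> space M \<Longrightarrow> seg s \<omega> \<in> space \<C>"
  using seg_measurable[of s] by (auto simp: measurable_def)

lemma kernel_measurable: "0 \<le> t \<Longrightarrow> P t \<in> \<C> \<rightarrow>\<^sub>M prob_algebra \<C>"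
  using kernel by (simp add: segment_kernel_def)

lemma kernel_subprob: "0 \<le> t \<Longrightarrow> P t \<in> \<C> \<rightarrow>\<^sub>M subprob_algebra \<C>"
  by (rule measurable_prob_algebraD[OF kernel_measurable])

text \<open>In \<open>segment_kernel\<close> the identity holds outside a null set that may depend
  on \<open>A\<close>. Integrating over \<open>B\<close> in \<open>F s\<close> removes the null set
  and leaves an identity of measures; restriction to \<open>B\<close> is written as a density so
  that the result can be composed with \<open>P t\<close>.\<close>

lemma markov_property:
  assumes s: "0 \<le> s" and t: "0 \<le> t" and B: "B \<in> sets (F s)"
  shows "distr (density M (indicator B)) \<C> (seg (s + t))
    = distr (density M (indicator B)) \<C> (seg s) \<bind> P t"
proof (rule measure_eqI)
  have BM [measurable]: "B \<in> sets M" using B filtration(1)[OF s] by (auto simp: subalgebra_def)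
  note [measurable] = seg_measurable[OF s] seg_measurable[of "s + t"] kernel_subprob[OF t]
  have m: "seg s \<in> M \<rightarrow>\<^sub>M \<C>" "seg (s + t) \<in> M \<rightarrow>\<^sub>M \<C>" using s t by (auto intro: seg_measurable)
  have m': "seg s \<in> density M (indicator B) \<rightarrow>\<^sub>M \<C>" "seg (s + t) \<in> density M (indicator B) \<rightarrow>\<^sub>M \<C>"
    using m by auto
  have ne: "space (distr (density M (indicator B)) \<C> (seg s)) \<noteq> {}"
    using not_empty seg_space[OF s] by auto
  have N: "P t \<in> distr (density M (indicator B)) \<C> (seg s) \<rightarrow>\<^sub>M subprob_algebra \<C>"
    using kernel_subprob[OF t] by simp
  show "sets (distr (density M (indicator B)) \<C> (seg (s + t))) = sets (distr (density M (indicator B)) \<C> (seg s) \<bind> P t)"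
    using sets_bind[OF sets_kernel[OF N] ne] by simp
  fix A assume "A \<in> sets (distr (density M (indicator B)) \<C> (seg (s + t)))"
  then have A [measurable]: "A \<in> sets \<C>" by simp
  define E where "E = {\<omega>\<in>space M. seg (s + t) \<omega> \<in> A}"
  have E [measurable]: "E \<in> sets M"
    using measurable_sets[OF m(2) A] by (simp add: E_def vimage_def Int_def conj_commute)
  define p where "p \<omega> = measure (P t (seg s \<omega>)) A" for \<omega>
  have pm: "(\<lambda>\<omega>. emeasure (P t (seg s \<omega>)) A) \<in> borel_measurable M"
    by (rule measurable_compose[OF measurable_compose[OF m(1) kernel_subprob[OF t]] measurable_emeasure_subprob_algebra[OF A]])
  have ps: "prob_space (P t (seg s \<omega>))" if "\<omega> \<in> space M" for \<omega>
    using measurable_space[OF kernel_measurable[OF t] seg_space[OF s that]] by (simp add: space_prob_algebra)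
  have pe: "emeasure (P t (seg s \<omega>)) A = ennreal (p \<omega>)" if "\<omega> \<in> space M" for \<omega>
    unfolding p_def using ps[OF that] by (simp add: finite_measure.emeasure_eq_measure prob_space.finite_measure)
  have p_meas [measurable]: "p \<in> borel_measurable M"
    using borel_measurable_enn2real[OF pm] by (simp add: p_def[abs_def] measure_def)
  have p01: "p \<omega> \<le> 1" "0 \<le> p \<omega>" if "\<omega> \<in> space M" for \<omega>
    using prob_space.prob_le_1[OF ps[OF that]] by (auto simp: p_def)
  have p_int: "integrable M p"
    by (rule integrable_const_bound[where B = 1]) (use p01 in auto)
  interpret sigma_finite_subalgebra M "F s"
    by (rule finite_measure_subalgebra_is_sigma_finite)
       (simp add: finite_measure_subalgebra_def finite_measure_axioms finite_measure_subalgebra_axioms_def filtration(1)[OF s])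
  have "(\<integral>x\<in>B. indicator E x \<partial>M) = (\<integral>x\<in>B. real_cond_exp M (F s) (indicator E) x \<partial>M)"
    by (rule real_cond_exp_intA[OF _ B]) (auto intro!: integrable_real_indicator simp: emeasure_eq_measure)
  also have "\<dots> = (\<integral>x\<in>B. p x \<partial>M)"
  proof -
    have "AE \<omega> in M. real_cond_exp M (F s) (indicator E) \<omega> = p \<omega>"
      using kernel solution s t A unfolding segment_kernel_def E_def p_def seg_def by blast
    then show ?thesis
      unfolding set_lebesgue_integral_def by (intro integral_cong_AE) auto
  qed
  finally have eq: "(\<integral>x. indicator B x * indicator E x \<partial>M) = (\<integral>x. indicator B x * p x \<partial>M)"
    by (simp add: set_lebesgue_integral_def)
  have "emeasure (distr (density M (indicator B)) \<C> (seg (s + t))) A = (\<integral>\<^sup>+x. indicator B x * indicator E x \<partial>M)"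
    using m' A by (subst emeasure_distr) (auto simp: emeasure_density E_def indicator_def intro!: nn_integral_cong)
  also have "\<dots> = (\<integral>\<^sup>+x. ennreal (indicator B x * indicator E x) \<partial>M)"
    by (intro nn_integral_cong) (auto simp: indicator_def)
  also have "\<dots> = ennreal (\<integral>x. indicator B x * indicator E x \<partial>M)"
    by (intro nn_integral_eq_integral integrable_const_bound[where B = 1]) (auto simp: indicator_def)
  also have "\<dots> = (\<integral>\<^sup>+x. ennreal (indicator B x * p x) \<partial>M)"
    unfolding eq
  proof (intro nn_integral_eq_integral[symmetric] AE_I2)
    show "integrable M (\<lambda>x. indicator B x * p x)"
      by (rule integrable_const_bound[where B = 1]) (use p01 in \<open>auto simp: indicator_def\<close>)
  qed (use p01 in auto)
  also have "\<dots> = (\<integral>\<^sup>+x. indicator B x * emeasure (P t (seg s x)) A \<partial>M)"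
    by (intro nn_integral_cong) (auto simp: indicator_def pe)
  also have "\<dots> = (\<integral>\<^sup>+x. emeasure (P t (seg s x)) A \<partial>density M (indicator B))"
    using pm by (subst nn_integral_density) auto
  also have "\<dots> = (\<integral>\<^sup>+\<phi>. emeasure (P t \<phi>) A \<partial>distr (density M (indicator B)) \<C> (seg s))"
    using m' measurable_compose[OF kernel_subprob[OF t] measurable_emeasure_subprob_algebra[OF A]]
    by (subst nn_integral_distr) auto
  also have "\<dots> = emeasure (distr (density M (indicator B)) \<C> (seg s) \<bind> P t) A"
    by (rule emeasure_bind[OF ne N A, symmetric])
  finally show "emeasure (distr (density M (indicator B)) \<C> (seg (s + t))) A
    = emeasure (distr (density M (indicator B)) \<C> (seg s) \<bind> P t) A" .
qed

lemma markov_nn_integral: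
  assumes s: "0 \<le> s" and t: "0 \<le> t" and B: "B \<in> sets (F s)" and g [measurable]: "g \<in> borel_measurable \<C>"
  shows "(\<integral>\<^sup>+\<omega>. indicator B \<omega> * g (seg (s + t) \<omega>) \<partial>M)
    = (\<integral>\<^sup>+\<omega>. indicator B \<omega> * (\<integral>\<^sup>+\<psi>. g \<psi> \<partial>P t (seg s \<omega>)) \<partial>M)"
proof -
  have BM [measurable]: "B \<in> sets M" using B filtration(1)[OF s] by (auto simp: subalgebra_def)
  have m [measurable]: "seg s \<in> M \<rightarrow>\<^sub>M \<C>" "seg (s + t) \<in> M \<rightarrow>\<^sub>M \<C>" using s t by (auto intro: seg_measurable)
  have N: "P t \<in> distr (density M (indicator B)) \<C> (seg s) \<rightarrow>\<^sub>M subprob_algebra \<C>"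
    using kernel_subprob[OF t] by simp
  have gm: "(\<lambda>\<phi>. \<integral>\<^sup>+\<psi>. g \<psi> \<partial>P t \<phi>) \<in> borel_measurable \<C>"
    by (rule measurable_compose[OF kernel_subprob[OF t] nn_integral_measurable_subprob_algebra[OF g]])
  have "(\<integral>\<^sup>+\<omega>. indicator B \<omega> * g (seg (s + t) \<omega>) \<partial>M)
    = (\<integral>\<^sup>+\<psi>. g \<psi> \<partial>distr (density M (indicator B)) \<C> (seg (s + t)))"
    by (subst nn_integral_distr) (auto simp: nn_integral_density)
  also have "\<dots> = (\<integral>\<^sup>+\<phi>. (\<integral>\<^sup>+\<psi>. g \<psi> \<partial>P t \<phi>) \<partial>distr (density M (indicator B)) \<C> (seg s))"
    unfolding markov_property[OF s t B] by (rule nn_integral_bind[OF g N])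
  also have "\<dots> = (\<integral>\<^sup>+\<omega>. indicator B \<omega> * (\<integral>\<^sup>+\<psi>. g \<psi> \<partial>P t (seg s \<omega>)) \<partial>M)"
    using gm measurable_compose[OF m(1) gm]
    by (subst nn_integral_distr) (auto simp: nn_integral_density)
  finally show ?thesis .
qed

text \<open>The Markov property from time 0 over the whole space expresses this law as
  \<open>\<pi> \<bind> P s\<close>, which invariance identifies with \<open>\<pi>\<close>.\<close>

lemma seg_law:
  assumes s: "0 \<le> s"
  shows "distr M \<C> (seg s) = \<pi>"
proof -
  have [simp]: "density M (indicator (space M)) = M"
  proof (rule measure_eqI)
    fix A assume "A \<in> sets (density M (indicator (space M)))"
    then have A: "A \<in> sets M" by simp
    have "(\<integral>\<^sup>+x. indicator (space M) x * indicator A x \<partial>M) = (\<integral>\<^sup>+x. indicator A x \<partial>M)"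
      by (intro nn_integral_cong) simp
    then show "emeasure (density M (indicator (space M))) A = emeasure M A"
      using A by (simp add: emeasure_density)
  qed simp
  have "space M \<in> sets (F 0)" using space_filtration[of 0] sets.top[of "F 0"] by simp
  from markov_property[OF order_refl s this] have "distr M \<C> (seg s) = distr M \<C> (seg 0) \<bind> P s" by simp
  also have "distr M \<C> (seg 0) = \<pi>"
    using stationary unfolding stationary_solution_def seg_def[abs_def] by simp
  also have "\<pi> \<bind> P s = \<pi>" using invariant s by (simp add: invariant_measure_def)
  finally show ?thesis .
qed

section \<open>Stationarity of the finite-dimensional laws\<close>

primrec path_event :: "(real \<times> (real \<Rightarrow> real^'d) set) list \<Rightarrow> real \<Rightarrow> 'w set" where
  "path_event [] s = space M"
| "path_event (x # l) s = {\<omega>\<in>path_event l (s + fst x). seg (s + fst x) \<omega> \<in> snd x}"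

text \<open>List entries are a waiting time since the previous visit and the set to be visited.
  Because only waiting times occur, this function of the present segment does not see the starting
  time, and that is the source of stationarity.\<close>

primrec path_kernel :: "(real \<times> (real \<Rightarrow> real^'d) set) list \<Rightarrow> (real \<Rightarrow> real^'d) \<Rightarrow> ennreal" where
  "path_kernel [] \<phi> = 1"
| "path_kernel (x # l) \<phi> = (\<integral>\<^sup>+\<psi>. indicator (snd x) \<psi> * path_kernel l \<psi> \<partial>P (fst x) \<phi>)"

lemma path_kernel_measurable:
  assumes "\<forall>x\<in>set l. 0 \<le> fst x \<and> snd x \<in> sets \<C>"
  shows "path_kernel l \<in> borel_measurable \<C>"
  using assms
proof (induction l)
  case Nil
  have "path_kernel [] = (\<lambda>_. 1)" by (rule ext) simp
  then show ?case by simp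
next
  case (Cons x l)
  then have m: "snd x \<in> sets \<C>" "path_kernel l \<in> borel_measurable \<C>" "0 \<le> fst x" by auto
  then have "(\<lambda>\<psi>. indicator (snd x) \<psi> * path_kernel l \<psi>) \<in> borel_measurable \<C>" by measurable
  from measurable_compose[OF kernel_subprob[OF m(3)] nn_integral_measurable_subprob_algebra[OF this]]
  have "(\<lambda>\<phi>. path_kernel (x # l) \<phi>) \<in> borel_measurable \<C>" by simp
  then show ?case by simp
qed

text \<open>The induction generalises over \<open>B\<close>: the first visit is an event of the
  filtration at its own time, so it is absorbed into \<open>B\<close> there, and the Markov property
  then leads back to time \<open>s\<close>.\<close>

lemma path_event_kernel:
  assumes "\<forall>x\<in>set l. 0 \<le> fst x \<and> snd x \<in> sets \<C>" "0 \<le> s" "B \<in> sets (F s)"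
  shows "path_event l s \<in> sets M \<and>
    emeasure M (B \<inter> path_event l s) = (\<integral>\<^sup>+\<omega>. indicator B \<omega> * path_kernel l (seg s \<omega>) \<partial>M)"
  using assms
proof (induction l arbitrary: s B)
  case Nil
  then have "B \<in> sets M" using filtration(1)[of s] by (auto simp: subalgebra_def)
  then show ?case by (simp add: sets.Int_space_eq2)
next
  case (Cons x l)
  define u where "u = s + fst x"
  have u: "0 \<le> u" "s \<le> u" "0 \<le> fst x" using Cons.prems by (auto simp: u_def)
  have A: "snd x \<in> sets \<C>" using Cons.prems by auto
  define E where "E = {\<omega>\<in>space M. seg u \<omega> \<in> snd x}"
  have E: "E \<in> sets (F u)"
    using measurable_sets[OF seg_adapted[OF u(1)] A] space_filtration[OF u(1)]
    by (simp add: E_def vimage_def Int_def conj_commute)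
  have EM: "E \<in> sets M" using E filtration(1)[OF u(1)] by (auto simp: subalgebra_def)
  have Bu: "B \<in> sets (F u)" using Cons.prems filtration(2)[of s u] u by auto
  have IH: "path_event l u \<in> sets M"
    "emeasure M ((B \<inter> E) \<inter> path_event l u) = (\<integral>\<^sup>+\<omega>. indicator (B \<inter> E) \<omega> * path_kernel l (seg u \<omega>) \<partial>M)"
    using Cons.IH[of u "B \<inter> E"] Cons.prems u Bu E by auto
  have eq: "path_event (x # l) s = E \<inter> path_event l u"
    using sets.sets_into_space[OF IH(1)] by (auto simp: E_def u_def)
  have "emeasure M (B \<inter> path_event (x # l) s) = (\<integral>\<^sup>+\<omega>. indicator (B \<inter> E) \<omega> * path_kernel l (seg u \<omega>) \<partial>M)"
    unfolding eq using IH(2) by (simp add: Int_assoc)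
  also have "\<dots> = (\<integral>\<^sup>+\<omega>. indicator B \<omega> * (indicator (snd x) (seg u \<omega>) * path_kernel l (seg u \<omega>)) \<partial>M)"
    by (intro nn_integral_cong) (auto simp: indicator_def E_def)
  also have "\<dots> = (\<integral>\<^sup>+\<omega>. indicator B \<omega> * path_kernel (x # l) (seg s \<omega>) \<partial>M)"
    unfolding u_def path_kernel.simps
    using Cons.prems A u path_kernel_measurable[of l]
    by (subst markov_nn_integral[where g = "\<lambda>\<psi>. indicator (snd x) \<psi> * path_kernel l \<psi>"]) auto
  finally show ?case using IH(1) EM eq by simp
qed

lemma path_event_stationary:
  assumes l: "\<forall>x\<in>set l. 0 \<le> fst x \<and> snd x \<in> sets \<C>" and s: "0 \<le> s"
  shows "emeasure M (path_event l s) = emeasure M (path_event l 0)"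
proof -
  have *: "emeasure M (path_event l s) = (\<integral>\<^sup>+\<phi>. path_kernel l \<phi> \<partial>\<pi>)" if s: "0 \<le> s" for s
  proof -
    have "space M \<in> sets (F s)" using space_filtration[OF s] sets.top[of "F s"] by simp
    from path_event_kernel[OF l s this]
    have "emeasure M (path_event l s) = (\<integral>\<^sup>+\<omega>. indicator (space M) \<omega> * path_kernel l (seg s \<omega>) \<partial>M)"
      by (metis sets.Int_space_eq1)
    also have "\<dots> = (\<integral>\<^sup>+\<omega>. path_kernel l (seg s \<omega>) \<partial>M)"
      by (intro nn_integral_cong) simp
    also have "\<dots> = (\<integral>\<^sup>+\<phi>. path_kernel l \<phi> \<partial>\<pi>)"
      unfolding seg_law[OF s, symmetric]
      by (rule nn_integral_distr[symmetric, OF seg_measurable[OF s]]) (simp add: path_kernel_measurable[OF l])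
    finally show ?thesis .
  qed
  show ?thesis using *[OF s] *[of 0] by simp
qed

text \<open>Translation from absolute times to waiting times; \<open>v\<close> is the time reached
  so far, and the entries are the consecutive differences.\<close>

lemma path_event_sorted:
  assumes "sorted us" "\<forall>u\<in>set us. v \<le> u"
  shows "\<exists>l. (\<forall>x\<in>set l. 0 \<le> fst x \<and> snd x \<in> A ` set us) \<and>
    (\<forall>s. path_event l s = {\<omega>\<in>space M. \<forall>u\<in>set us. seg (s + (u - v)) \<omega> \<in> A u})"
  using assms
proof (induction us arbitrary: v)
  case Nil
  show ?case by (rule exI[of _ "[]"]) simp
next
  case (Cons u us)
  obtain l where l: "\<forall>x\<in>set l. 0 \<le> fst x \<and> snd x \<in> A ` set us"
    and ev: "\<And>s. path_event l s = {\<omega>\<in>space M. \<forall>w\<in>set us. seg (s + (w - u)) \<omega> \<in> A w}"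
    using Cons.IH[of u] Cons.prems by auto
  show ?case
    by (rule exI[of _ "(u - v, A u) # l"]) (use l ev Cons.prems in \<open>auto simp: algebra_simps\<close>)
qed

lemma seg_finite_dim_stationary:
  assumes U: "finite U" "\<forall>u\<in>U. 0 \<le> u" and A: "\<forall>u\<in>U. A u \<in> sets \<C>" and s: "0 \<le> s"
  shows "emeasure M {\<omega>\<in>space M. \<forall>u\<in>U. seg (s + u) \<omega> \<in> A u} = emeasure M {\<omega>\<in>space M. \<forall>u\<in>U. seg u \<omega> \<in> A u}"
proof -
  obtain l where l: "\<forall>x\<in>set l. 0 \<le> fst x \<and> snd x \<in> A ` set (sorted_list_of_set U)"
    and ev: "\<And>s. path_event l s = {\<omega>\<in>space M. \<forall>u\<in>set (sorted_list_of_set U). seg (s + (u - 0)) \<omega> \<in> A u}"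
    using path_event_sorted[of "sorted_list_of_set U" 0 A] U by auto
  have l': "\<forall>x\<in>set l. 0 \<le> fst x \<and> snd x \<in> sets \<C>" using l A U by auto
  show ?thesis
    using path_event_stationary[OF l' s] U unfolding ev by simp
qed

definition eval_delays :: "(real \<Rightarrow> real^'d) \<Rightarrow> (real^'d, 'b) vec" where
  "eval_delays \<phi> = delay_vec \<tau> \<phi> 0"

lemma eval_delays_measurable [measurable]: "eval_delays \<in> borel_measurable \<C>"
proof (rule borel_measurable_vec)
  fix a
  have "(\<lambda>\<phi>. \<phi> (- \<tau> a)) \<in> borel_measurable (PiM {- tau_max \<tau>..0} (\<lambda>_. borel :: (real^'d) measure))"
    by (rule measurable_component_singleton) (use delay_bounds in auto)
  then show "(\<lambda>\<phi>. eval_delays \<phi> $ a) \<in> borel_measurable \<C>"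
    unfolding segment_space_def eval_delays_def delay_vec_def by (auto intro: measurable_restrict_space1)
qed

lemma Z_seg: "Z s \<omega> = eval_delays (seg s \<omega>)"
  using delay_bounds by (auto simp: Z_def eval_delays_def delay_vec_def seg_def segment_def vec_eq_iff)

lemma Z_adapted: "0 \<le> s \<Longrightarrow> Z s \<in> borel_measurable (F s)"
  unfolding Z_seg[abs_def] by (rule measurable_compose[OF seg_adapted eval_delays_measurable])

lemma Z_measurable: "0 \<le> s \<Longrightarrow> Z s \<in> borel_measurable M"
  by (rule measurable_from_subalg[OF filtration(1) Z_adapted])

lemma Z_continuous:
  assumes "\<omega> \<in> space M"
  shows "continuous_on {0..} (\<lambda>s. Z s \<omega>)"
  unfolding Z_def delay_vec_def
proof (rule continuous_on_vec_lambda)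
  fix a
  show "continuous_on {0..} (\<lambda>s. X (s - \<tau> a) \<omega>)"
    by (rule continuous_on_compose2[OF X_continuous[OF assms]])
       (use delay_bounds[of a] in \<open>auto intro!: continuous_intros\<close>)
qed

lemma Z_law:
  assumes "0 \<le> s"
  shows "distr M borel (Z s) = \<mu>"
proof -
  have "distr M borel (Z s) = distr (distr M \<C> (seg s)) borel eval_delays"
    using seg_measurable[OF assms] by (subst distr_distr) (auto simp: o_def Z_seg[abs_def])
  then show ?thesis
    unfolding seg_law[OF assms] law stationary_law_def eval_delays_def[abs_def] .
qed

lemma Z_finite_dim_stationary:
  assumes U: "finite U" "\<forall>u\<in>U. 0 \<le> u" and A: "\<forall>u\<in>U. A u \<in> sets borel" and s: "0 \<le> s"
  shows "emeasure M {\<omega>\<in>space M. \<forall>u\<in>U. Z (s + u) \<omega> \<in> A u} = emeasure M {\<omega>\<in>space M. \<forall>u\<in>U. Z u \<omega> \<in> A u}"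
proof -
  have "\<forall>u\<in>U. eval_delays -` A u \<inter> space \<C> \<in> sets \<C>"
    using A by (auto intro: measurable_sets)
  from seg_finite_dim_stationary[OF U this s] show ?thesis
    unfolding Z_seg using U(2) s seg_space
    by (subst (asm) (1 2) Collect_cong) (auto cong: ball_cong)
qed

text \<open>Rectangles generate the product sigma-algebra and are stable under intersection, so
  equality of the two-time probabilities determines the joint law.\<close>

lemma Z_pair_stationary:
  assumes u: "0 \<le> u" and s: "0 \<le> s"
  shows "distr M (borel \<Otimes>\<^sub>M borel) (\<lambda>\<omega>. (Z s \<omega>, Z (s + u) \<omega>)) = distr M (borel \<Otimes>\<^sub>M borel) (\<lambda>\<omega>. (Z 0 \<omega>, Z u \<omega>))"
    (is "distr M ?B ?f = distr M ?B ?g")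
proof (rule measure_eqI_generator_eq[where E = "{a \<times> b | a b. a \<in> sets (borel :: ((real^'d, 'b) vec) measure) \<and> b \<in> sets (borel :: ((real^'d, 'b) vec) measure)}" and \<Omega> = UNIV and A = "\<lambda>_. UNIV"])
  have m [measurable]: "Z s \<in> borel_measurable M" "Z (s + u) \<in> borel_measurable M" "Z 0 \<in> borel_measurable M" "Z u \<in> borel_measurable M"
    using u s by (auto intro: Z_measurable)
  show "Int_stable {a \<times> b | a b. a \<in> sets (borel :: ((real^'d, 'b) vec) measure) \<and> b \<in> sets (borel :: ((real^'d, 'b) vec) measure)}"
    by (rule Int_stable_pair_measure_generator)
  show "{a \<times> b | a b. a \<in> sets (borel :: ((real^'d, 'b) vec) measure) \<and> b \<in> sets (borel :: ((real^'d, 'b) vec) measure)} \<subseteq> Pow UNIV" by simp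
  show "sets (distr M ?B ?f) = sigma_sets UNIV {a \<times> b | a b. a \<in> sets (borel :: ((real^'d, 'b) vec) measure) \<and> b \<in> sets (borel :: ((real^'d, 'b) vec) measure)}"
    "sets (distr M ?B ?g) = sigma_sets UNIV {a \<times> b | a b. a \<in> sets (borel :: ((real^'d, 'b) vec) measure) \<and> b \<in> sets (borel :: ((real^'d, 'b) vec) measure)}"
    by (simp_all add: sets_pair_measure)
  interpret f: prob_space "distr M ?B ?f" by (rule prob_space_distr) measurable
  show "emeasure (distr M ?B ?f) UNIV \<noteq> \<infinity>"
    using f.emeasure_finite by simp
  fix Y assume "Y \<in> {a \<times> b | a b. a \<in> sets (borel :: ((real^'d, 'b) vec) measure) \<and> b \<in> sets (borel :: ((real^'d, 'b) vec) measure)}"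
  then obtain a b where Y: "Y = a \<times> b" and ab: "a \<in> sets (borel :: ((real^'d, 'b) vec) measure)" "b \<in> sets (borel :: ((real^'d, 'b) vec) measure)" by auto
  have ab' [measurable]: "a \<times> b \<in> sets ?B" using ab by auto
  define A where "A v = (if v = 0 \<and> u = 0 then a \<inter> b else if v = 0 then a else b)" for v :: real
  have "emeasure M {\<omega>\<in>space M. \<forall>v\<in>{0, u}. Z (s + v) \<omega> \<in> A v} = emeasure M {\<omega>\<in>space M. \<forall>v\<in>{0, u}. Z v \<omega> \<in> A v}"
    by (rule Z_finite_dim_stationary) (use u s ab in \<open>auto simp: A_def\<close>)
  moreover have "{\<omega>\<in>space M. \<forall>v\<in>{0, u}. Z (s + v) \<omega> \<in> A v} = ?f -` (a \<times> b) \<inter> space M"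
    "{\<omega>\<in>space M. \<forall>v\<in>{0, u}. Z v \<omega> \<in> A v} = ?g -` (a \<times> b) \<inter> space M"
    by (auto simp: A_def)
  ultimately show "emeasure (distr M ?B ?f) Y = emeasure (distr M ?B ?g) Y"
    unfolding Y by (simp add: emeasure_distr)
qed (auto intro!: exI[of _ UNIV])

end


section \<open>Noise, bias and martingale moments\<close>

text \<open>The adjoint has no larger operator norm: the squared norm equals
  \<open>x \<bullet> (S *v (x v* S))\<close>, and one factor cancels. It is used when
  \<open>S\<close> is moved from the noise onto the test function.\<close>

lemma norm_vector_matrix_le:
  fixes S :: "real^'n^'n"
  shows "norm (x v* S) \<le> op_norm S * norm x"
proof (cases "x v* S = 0")
  case True
  then show ?thesis
    unfolding op_norm_def by (simp add: onorm_pos_le[OF matrix_vector_mul_bounded_linear])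
next
  case False
  have "norm (x v* S) * norm (x v* S) = x \<bullet> (S *v (x v* S))"
    by (simp add: dot_lmul_matrix[symmetric] power2_norm_eq_inner[symmetric] power2_eq_square)
  also have "\<dots> \<le> norm x * (op_norm S * norm (x v* S))"
    unfolding op_norm_def
    by (rule order_trans[OF norm_cauchy_schwarz mult_left_mono[OF onorm[OF matrix_vector_mul_bounded_linear]]]) simp
  finally show ?thesis using False by (simp add: mult.commute mult.left_commute)
qed

context stationary_sdde
begin

lemma increment:
  assumes "0 \<le> s" "s < t"
  shows "indep_set (sets (F s)) {(\<lambda>\<omega>. W t \<omega> - W s \<omega>) -` B \<inter> space M | B. B \<in> sets borel}"
    and "indep_vars (\<lambda>_. borel) (\<lambda>i \<omega>. (W t \<omega> - W s \<omega>) $ i) UNIV"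
    and "distributed M lborel (\<lambda>\<omega>. (W t \<omega> - W s \<omega>) $ i) (normal_density 0 (sqrt (t - s)))"
  using brownian assms unfolding brownian_motion_def by blast+

lemma W_adapted: "0 \<le> s \<Longrightarrow> s \<le> t \<Longrightarrow> W s \<in> borel_measurable (F t)"
  using brownian measurable_filtration_mono unfolding brownian_motion_def by blast

lemma W_measurable: "0 \<le> s \<Longrightarrow> W s \<in> borel_measurable M"
  using measurable_from_subalg[OF filtration(1) W_adapted[of s s]] by simp

text \<open>Conditionally on the past, the increment is Gaussian with covariance
  \<open>t - s\<close> times the identity and \<open>V\<close> is a constant. The weight
  \<open>Y\<close> carries the exponential of the earlier increments.\<close>

lemma increment_mgf:
  assumes st: "0 \<le> s" "s < t" and Y: "Y \<in> borel_measurable (F s)" and V: "V \<in> borel_measurable (F s)"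
  shows "(\<integral>\<^sup>+\<omega>. Y \<omega> * ennreal (exp (V \<omega> \<bullet> (W t \<omega> - W s \<omega>))) \<partial>M)
    = (\<integral>\<^sup>+\<omega>. Y \<omega> * ennreal (exp ((t - s) * (norm (V \<omega>))\<^sup>2 / 2)) \<partial>M)"
proof -
  have w: "(\<lambda>\<omega>. W t \<omega> - W s \<omega>) \<in> borel_measurable M"
    using st by (intro borel_measurable_diff W_measurable) auto
  have "(\<integral>\<^sup>+\<omega>. Y \<omega> * ennreal (exp (V \<omega> \<bullet> (W t \<omega> - W s \<omega>))) \<partial>M)
    = (\<integral>\<^sup>+\<omega>. (\<lambda>p x. fst p * ennreal (exp (snd p \<bullet> x))) (Y \<omega>, V \<omega>) (W t \<omega> - W s \<omega>) \<partial>M)"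
    by simp
  also have "\<dots> = (\<integral>\<^sup>+\<omega>. (\<integral>\<^sup>+\<omega>'. (\<lambda>p x. fst p * ennreal (exp (snd p \<bullet> x))) (Y \<omega>, V \<omega>) (W t \<omega>' - W s \<omega>') \<partial>M) \<partial>M)"
    by (rule indep_increment_nn_integral[OF filtration(1)[OF st(1)] w increment(1)[OF st], where L = "borel \<Otimes>\<^sub>M borel"])
       (use Y V in measurable)
  also have "\<dots> = (\<integral>\<^sup>+\<omega>. Y \<omega> * ennreal (exp ((t - s) * (norm (V \<omega>))\<^sup>2 / 2)) \<partial>M)"
  proof (rule nn_integral_cong)
    fix \<omega>
    have "(\<integral>\<^sup>+\<omega>'. Y \<omega> * ennreal (exp (V \<omega> \<bullet> (W t \<omega>' - W s \<omega>'))) \<partial>M)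
      = Y \<omega> * (\<integral>\<^sup>+\<omega>'. ennreal (exp (V \<omega> \<bullet> (W t \<omega>' - W s \<omega>'))) \<partial>M)"
      by (intro nn_integral_cmult measurable_compose[OF w]) measurable
    also have "\<dots> = Y \<omega> * ennreal (exp ((t - s) * (norm (V \<omega>))\<^sup>2 / 2))"
      using gaussian_vector_mgf[OF increment(2)[OF st] increment(3)[OF st]] st by simp
    finally show "(\<integral>\<^sup>+\<omega>'. (\<lambda>p x. fst p * ennreal (exp (snd p \<bullet> x))) (Y \<omega>, V \<omega>) (W t \<omega>' - W s \<omega>') \<partial>M)
      = Y \<omega> * ennreal (exp ((t - s) * (norm (V \<omega>))\<^sup>2 / 2))" by simp
  qed
  finally show ?thesis .
qed

text \<open>The exponential of the partial sum is known at the start of the last increment, which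
  can therefore be integrated out conditionally. The resulting factor is bounded by a constant only
  because \<open>\<phi>\<close> is bounded on the whole space; this is why truncated functions are
  tested.\<close>

lemma martingale_mgf:
  assumes grid: "\<And>k. k < m \<Longrightarrow> 0 \<le> t k \<and> t k < t (Suc k)"
    and \<phi> [measurable]: "\<phi> \<in> borel_measurable borel" and bnd: "\<And>z. norm (\<phi> z) \<le> E"
  shows "(\<integral>\<^sup>+\<omega>. ennreal (exp (\<theta> * (\<Sum>k\<in>{k\<in>I. k < m}. (S *v (W (t (Suc k)) \<omega> - W (t k) \<omega>)) \<bullet> \<phi> (Z (t k) \<omega>)))) \<partial>M)
    \<le> ennreal (exp (\<theta>\<^sup>2 * ((op_norm S * E)\<^sup>2 * (\<Sum>k\<in>{k\<in>I. k < m}. mesh t k)) / 2))"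
  using grid
proof (induction m)
  case 0
  then show ?case by (simp add: emeasure_space_1)
next
  case (Suc m)
  let ?m = "\<lambda>k \<omega>. (S *v (W (t (Suc k)) \<omega> - W (t k) \<omega>)) \<bullet> \<phi> (Z (t k) \<omega>)"
  define L where "L \<omega> = (\<Sum>k\<in>{k\<in>I. k < m}. ?m k \<omega>)" for \<omega>
  have IH: "(\<integral>\<^sup>+\<omega>. ennreal (exp (\<theta> * L \<omega>)) \<partial>M)
    \<le> ennreal (exp (\<theta>\<^sup>2 * ((op_norm S * E)\<^sup>2 * (\<Sum>k\<in>{k\<in>I. k < m}. mesh t k)) / 2))"
    unfolding L_def by (rule Suc.IH) (simp add: Suc.prems)
  show ?case
  proof (cases "m \<in> I")
    case False
    then have "{k\<in>I. k < Suc m} = {k\<in>I. k < m}" by (auto simp: less_Suc_eq)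
    then show ?thesis using IH unfolding L_def by simp
  next
    case True
    then have ins: "{k\<in>I. k < Suc m} = insert m {k\<in>I. k < m}" by (auto simp: less_Suc_eq)
    have tm: "0 \<le> t m" "t m < t (Suc m)" using Suc.prems[of m] by auto
    have mono: "t i \<le> t j" if "i \<le> j" "j \<le> m" for i j
      using that
    proof (induction j rule: dec_induct)
      case (step j)
      then show ?case using Suc.prems[of j] by simp
    qed simp
    have L: "L \<in> borel_measurable (F (t m))"
      unfolding L_def[abs_def]
    proof (rule borel_measurable_sum)
      fix k assume "k \<in> {k\<in>I. k < m}"
      then have k: "0 \<le> t k" "t k \<le> t m" "0 \<le> t (Suc k)" "t (Suc k) \<le> t m"
        using mono[of k m] mono[of "Suc k" m] Suc.prems[of k] by auto
      have "(\<lambda>\<omega>. S *v (W (t (Suc k)) \<omega> - W (t k) \<omega>)) \<in> borel_measurable (F (t m))"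
        by (rule borel_measurable_continuous_on[OF matrix_vector_mult_linear_continuous_on borel_measurable_diff[OF W_adapted[OF k(3,4)] W_adapted[OF k(1,2)]]])
      moreover have "(\<lambda>\<omega>. \<phi> (Z (t k) \<omega>)) \<in> borel_measurable (F (t m))"
        by (rule measurable_compose[OF measurable_filtration_mono[OF Z_adapted[OF k(1)] k(1,2)] \<phi>])
      ultimately show "?m k \<in> borel_measurable (F (t m))" by (rule borel_measurable_inner)
    qed
    \<comment> \<open>Moving \<open>S\<close> to the other side of the inner product writes the last
      summand as a known vector tested against the Brownian increment.\<close>
    define V where "V \<omega> = \<theta> *\<^sub>R (\<phi> (Z (t m) \<omega>) v* S)" for \<omega>
    have V: "V \<in> borel_measurable (F (t m))"
    proof -
      have "(\<lambda>\<omega>. transpose S *v \<phi> (Z (t m) \<omega>)) \<in> borel_measurable (F (t m))"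
        by (rule borel_measurable_continuous_on[OF matrix_vector_mult_linear_continuous_on measurable_compose[OF Z_adapted[OF tm(1)] \<phi>]])
      then show ?thesis unfolding V_def[abs_def] by (simp add: borel_measurable_const_scaleR)
    qed
    have Vn: "(norm (V \<omega>))\<^sup>2 \<le> \<theta>\<^sup>2 * (op_norm S * E)\<^sup>2" for \<omega>
    proof -
      have "norm (\<phi> (Z (t m) \<omega>) v* S) \<le> op_norm S * norm (\<phi> (Z (t m) \<omega>))" by (rule norm_vector_matrix_le)
      also have "\<dots> \<le> op_norm S * E"
        using bnd onorm_pos_le[OF matrix_vector_mul_bounded_linear, of S] unfolding op_norm_def by (intro mult_left_mono) auto
      finally have "(norm (\<phi> (Z (t m) \<omega>) v* S))\<^sup>2 \<le> (op_norm S * E)\<^sup>2" by (rule power_mono) simp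
      then show ?thesis unfolding V_def by (simp add: power_mult_distrib mult_left_mono)
    qed
    have "(\<integral>\<^sup>+\<omega>. ennreal (exp (\<theta> * (\<Sum>k\<in>{k\<in>I. k < Suc m}. ?m k \<omega>))) \<partial>M)
      = (\<integral>\<^sup>+\<omega>. ennreal (exp (\<theta> * L \<omega>)) * ennreal (exp (V \<omega> \<bullet> (W (t (Suc m)) \<omega> - W (t m) \<omega>))) \<partial>M)"
    proof (rule nn_integral_cong)
      fix \<omega>
      have "V \<omega> \<bullet> (W (t (Suc m)) \<omega> - W (t m) \<omega>) = \<theta> * ?m m \<omega>"
        unfolding V_def by (simp add: dot_lmul_matrix inner_commute)
      then have "\<theta> * (\<Sum>k\<in>{k\<in>I. k < Suc m}. ?m k \<omega>) = \<theta> * L \<omega> + V \<omega> \<bullet> (W (t (Suc m)) \<omega> - W (t m) \<omega>)"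
        unfolding ins L_def by (simp add: distrib_left)
      then show "ennreal (exp (\<theta> * (\<Sum>k\<in>{k\<in>I. k < Suc m}. ?m k \<omega>)))
        = ennreal (exp (\<theta> * L \<omega>)) * ennreal (exp (V \<omega> \<bullet> (W (t (Suc m)) \<omega> - W (t m) \<omega>)))"
        by (simp only: exp_add ennreal_mult exp_ge_zero)
    qed
    also have "\<dots> = (\<integral>\<^sup>+\<omega>. ennreal (exp (\<theta> * L \<omega>)) * ennreal (exp ((t (Suc m) - t m) * (norm (V \<omega>))\<^sup>2 / 2)) \<partial>M)"
      by (rule increment_mgf[OF tm _ V]) (use L in measurable)
    also have "\<dots> \<le> (\<integral>\<^sup>+\<omega>. ennreal (exp (\<theta> * L \<omega>)) * ennreal (exp (mesh t m * (\<theta>\<^sup>2 * (op_norm S * E)\<^sup>2) / 2)) \<partial>M)"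
      using tm Vn unfolding mesh_def
      by (intro nn_integral_mono mult_left_mono ennreal_leI) (auto intro!: mult_left_mono)
    also have "\<dots> = (\<integral>\<^sup>+\<omega>. ennreal (exp (\<theta> * L \<omega>)) \<partial>M) * ennreal (exp (mesh t m * (\<theta>\<^sup>2 * (op_norm S * E)\<^sup>2) / 2))"
      using measurable_from_subalg[OF filtration(1)[OF tm(1)] L] by (intro nn_integral_multc) measurable
    also have "\<dots> \<le> ennreal (exp (\<theta>\<^sup>2 * ((op_norm S * E)\<^sup>2 * (\<Sum>k\<in>{k\<in>I. k < m}. mesh t k)) / 2))
       * ennreal (exp (mesh t m * (\<theta>\<^sup>2 * (op_norm S * E)\<^sup>2) / 2))"
      by (rule mult_right_mono[OF IH]) simp
    also have "\<dots> = ennreal (exp (\<theta>\<^sup>2 * ((op_norm S * E)\<^sup>2 * (\<Sum>k\<in>{k\<in>I. k < Suc m}. mesh t k)) / 2))"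
      unfolding ins by (simp add: ennreal_mult[symmetric] exp_add[symmetric] field_simps)
    finally show ?thesis .
  qed
qed

text \<open>Mixed second moments of distinct coordinates vanish, so the mean square is
  \<open>t - s\<close> times the trace of \<open>S ** transpose S\<close>; Cauchy-Schwarz against
  the constant 1 passes to the first moment.\<close>

lemma noise_increment_norm:
  assumes st: "0 \<le> s" "s < t"
  shows "(\<integral>\<^sup>+\<omega>. ennreal (norm (S *v (W t \<omega> - W s \<omega>))) \<partial>M) \<le> ennreal (frob_norm S * sqrt (t - s))"
proof -
  define w where "w i \<omega> = (W t \<omega> - W s \<omega>) $ i" for i \<omega>
  have dist: "distributed M lborel (w i) (normal_density 0 (sqrt (t - s)))" for i
    using increment(3)[OF st] unfolding w_def .
  have sd: "0 < sqrt (t - s)" using st by simp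
  have wm [measurable]: "w i \<in> borel_measurable M" for i using dist[of i] by (auto simp: distributed_def)
  have mean: "expectation (w i) = 0" for i
    using normal_distributed_expectation[OF sd dist[of i]] .
  have sq: "integrable M (\<lambda>\<omega>. (w i \<omega>)\<^sup>2)" for i
    using integrable_normal_moment[OF sd, of 0 2]
    by (subst distributed_integrable[OF dist[of i], symmetric]) auto
  have wint: "integrable M (w i)" for i
    by (rule square_integrable_imp_integrable[OF wm sq])
  have var: "expectation (\<lambda>\<omega>. (w i \<omega>)\<^sup>2) = t - s" for i
    using normal_distributed_variance[OF sd dist[of i]] st by (simp add: mean)
  have prod: "integrable M (\<lambda>\<omega>. w i \<omega> * w j \<omega>) \<and> expectation (\<lambda>\<omega>. w i \<omega> * w j \<omega>) = (if i = j then t - s else 0)" for i j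
  proof (cases "i = j")
    case True
    then show ?thesis using sq[of i] var[of i] by (simp add: power2_eq_square)
  next
    case False
    have "indep_vars (\<lambda>_. borel) w {i, j}"
      using indep_vars_subset[OF increment(2)[OF st], of "{i, j}"] by (simp add: w_def[abs_def])
    from indep_vars_lebesgue_integral[OF _ this] indep_vars_integrable[OF _ this]
    show ?thesis using wint mean False by simp
  qed
  have expand: "(norm (S *v (W t \<omega> - W s \<omega>)))\<^sup>2 = (\<Sum>i\<in>UNIV. \<Sum>j\<in>UNIV. \<Sum>k\<in>UNIV. S $ i $ j * S $ i $ k * (w j \<omega> * w k \<omega>))" for \<omega>
    unfolding power2_norm_eq_inner inner_vec_def
    by (simp add: matrix_vector_mult_def w_def sum_product mult_ac)
  have int: "integrable M (\<lambda>\<omega>. (norm (S *v (W t \<omega> - W s \<omega>)))\<^sup>2)"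
    unfolding expand using prod by (intro Bochner_Integration.integrable_sum integrable_mult_right) simp
  have "expectation (\<lambda>\<omega>. (norm (S *v (W t \<omega> - W s \<omega>)))\<^sup>2)
    = (\<Sum>i\<in>UNIV. \<Sum>j\<in>UNIV. \<Sum>k\<in>UNIV. S $ i $ j * S $ i $ k * (if j = k then t - s else 0))"
    unfolding expand using prod
    by (simp add: Bochner_Integration.integral_sum Bochner_Integration.integrable_sum)
  also have "\<dots> = (t - s) * trace (S ** transpose S)"
    by (simp add: trace_def matrix_matrix_mult_def transpose_def sum_distrib_left if_distrib cong: if_cong) (simp add: mult_ac)
  finally have E: "expectation (\<lambda>\<omega>. (norm (S *v (W t \<omega> - W s \<omega>)))\<^sup>2) = (t - s) * trace (S ** transpose S)" .
  have "(\<lambda>\<omega>. W t \<omega> - W s \<omega>) \<in> borel_measurable M"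
    using st by (intro borel_measurable_diff W_measurable) auto
  from borel_measurable_continuous_on[OF matrix_vector_mult_linear_continuous_on this, of S]
  have m: "(\<lambda>\<omega>. norm (S *v (W t \<omega> - W s \<omega>))) \<in> borel_measurable M" by measurable
  have i1: "integrable M (\<lambda>\<omega>. norm (S *v (W t \<omega> - W s \<omega>)))"
    by (rule square_integrable_imp_integrable[OF m int])
  have "expectation (\<lambda>\<omega>. norm (S *v (W t \<omega> - W s \<omega>))) \<le> sqrt (expectation (\<lambda>\<omega>. (norm (S *v (W t \<omega> - W s \<omega>)))\<^sup>2))"
    using cauchy_schwarz_integral(2)[OF m borel_measurable_const[of 1] int] by (simp add: prob_space)
  also have "\<dots> = frob_norm S * sqrt (t - s)"
    unfolding E frob_norm_def by (simp add: real_sqrt_mult mult.commute)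
  finally show ?thesis
    using i1 by (subst nn_integral_eq_integral) (auto intro: ennreal_leI)
qed

lemma G_measurable [measurable]: "G \<in> borel_measurable borel"
  by (rule borel_measurable_continuous_onI[OF drift_continuous])

text \<open>Two-time stationarity shifts the increment to time 0, where \<open>drift_modulus\<close>
  measures it. The uniform bound by four times the second moment of the drift shows that the real
  supremum there is that of a bounded set.\<close>

lemma drift_increment_moment:
  assumes L2: "integrable M (\<lambda>\<omega>. (norm (G (Z 0 \<omega>)))\<^sup>2)" and su: "0 \<le> s" "0 \<le> u" "u \<le> h"
  shows "integrable M (\<lambda>\<omega>. (norm (G (Z (s + u) \<omega>) - G (Z s \<omega>)))\<^sup>2)"
    and "sqrt (expectation (\<lambda>\<omega>. (norm (G (Z (s + u) \<omega>) - G (Z s \<omega>)))\<^sup>2)) \<le> drift_modulus M Z G h"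
proof -
  have L2\<mu>: "integrable \<mu> (\<lambda>z. (norm (G z))\<^sup>2)"
    unfolding Z_law[of 0, simplified, symmetric] using Z_measurable[of 0] L2 by (subst integrable_distr_eq) auto
  have L2r: "integrable M (\<lambda>\<omega>. (norm (G (Z r \<omega>)))\<^sup>2)
      \<and> expectation (\<lambda>\<omega>. (norm (G (Z r \<omega>)))\<^sup>2) = (\<integral>z. (norm (G z))\<^sup>2 \<partial>\<mu>)" if "0 \<le> r" for r
    using L2\<mu> Z_measurable[OF that] unfolding Z_law[OF that, symmetric]
    by (subst (asm) integrable_distr_eq) (auto simp: integral_distr)
  have I: "integrable M (\<lambda>\<omega>. (norm (G (Z r \<omega>) - G (Z r' \<omega>)))\<^sup>2)"
    and B: "expectation (\<lambda>\<omega>. (norm (G (Z r \<omega>) - G (Z r' \<omega>)))\<^sup>2) \<le> 4 * (\<integral>z. (norm (G z))\<^sup>2 \<partial>\<mu>)"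
    if r: "0 \<le> r" "0 \<le> r'" for r r'
  proof -
    note [measurable] = Z_measurable[OF r(1)] Z_measurable[OF r(2)]
    have b: "integrable M (\<lambda>\<omega>. 2 * (norm (G (Z r \<omega>)))\<^sup>2 + 2 * (norm (G (Z r' \<omega>)))\<^sup>2)"
      using L2r[OF r(1)] L2r[OF r(2)] by simp
    show i: "integrable M (\<lambda>\<omega>. (norm (G (Z r \<omega>) - G (Z r' \<omega>)))\<^sup>2)"
      using L2r[OF r(1)] L2r[OF r(2)] by (intro integrable_norm_diff_square) auto
    have "expectation (\<lambda>\<omega>. (norm (G (Z r \<omega>) - G (Z r' \<omega>)))\<^sup>2) \<le> expectation (\<lambda>\<omega>. 2 * (norm (G (Z r \<omega>)))\<^sup>2 + 2 * (norm (G (Z r' \<omega>)))\<^sup>2)"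
      by (rule integral_mono[OF i b norm_diff_square_le])
    then show "expectation (\<lambda>\<omega>. (norm (G (Z r \<omega>) - G (Z r' \<omega>)))\<^sup>2) \<le> 4 * (\<integral>z. (norm (G z))\<^sup>2 \<partial>\<mu>)"
      using L2r[OF r(1)] L2r[OF r(2)] by simp
  qed
  show "integrable M (\<lambda>\<omega>. (norm (G (Z (s + u) \<omega>) - G (Z s \<omega>)))\<^sup>2)" using I su by simp
  have "expectation (\<lambda>\<omega>. (norm (G (Z (s + u) \<omega>) - G (Z s \<omega>)))\<^sup>2)
    = (\<integral>p. (norm (G (snd p) - G (fst p)))\<^sup>2 \<partial>distr M (borel \<Otimes>\<^sub>M borel) (\<lambda>\<omega>. (Z s \<omega>, Z (s + u) \<omega>)))"
    using su Z_measurable[of s] Z_measurable[of "s + u"] by (subst integral_distr) auto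
  also have "\<dots> = expectation (\<lambda>\<omega>. (norm (G (Z u \<omega>) - G (Z 0 \<omega>)))\<^sup>2)"
    unfolding Z_pair_stationary[OF su(2,1)]
    using su Z_measurable[of 0] Z_measurable[of u] by (subst integral_distr) auto
  finally have eq: "expectation (\<lambda>\<omega>. (norm (G (Z (s + u) \<omega>) - G (Z s \<omega>)))\<^sup>2)
    = expectation (\<lambda>\<omega>. (norm (G (Z u \<omega>) - G (Z 0 \<omega>)))\<^sup>2)" .
  show "sqrt (expectation (\<lambda>\<omega>. (norm (G (Z (s + u) \<omega>) - G (Z s \<omega>)))\<^sup>2)) \<le> drift_modulus M Z G h"
    unfolding eq drift_modulus_def
  proof (rule cSUP_upper)
    show "bdd_above ((\<lambda>u. sqrt (expectation (\<lambda>\<omega>. (norm (G (Z u \<omega>) - G (Z 0 \<omega>)))\<^sup>2))) ` {0..h})"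
      by (rule bdd_aboveI2[where M = "sqrt (4 * (\<integral>z. (norm (G z))\<^sup>2 \<partial>\<mu>))"]) (use B in auto)
  qed (use su in auto)
qed

text \<open>The integrals over time and sample space are exchanged, and at each fixed time
  Cauchy-Schwarz separates the drift increment from the weight, whose law is
  \<open>\<mu>\<close>.\<close>

lemma bias_moment:
  assumes L2: "integrable M (\<lambda>\<omega>. (norm (G (Z 0 \<omega>)))\<^sup>2)"
    and e [measurable]: "e \<in> borel_measurable borel" and e0: "\<And>z. 0 \<le> e z" and e2: "integrable \<mu> (\<lambda>z. (e z)\<^sup>2)"
    and s: "0 \<le> s" "s \<le> s'" "s' - s \<le> h"
  shows "(\<lambda>\<omega>. (\<integral>\<^sup>+r\<in>{s..s'}. ennreal (norm (G (Z r \<omega>) - G (Z s \<omega>)) * e (Z s \<omega>)) \<partial>lborel)) \<in> borel_measurable M"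
    and "(\<integral>\<^sup>+\<omega>. (\<integral>\<^sup>+r\<in>{s..s'}. ennreal (norm (G (Z r \<omega>) - G (Z s \<omega>)) * e (Z s \<omega>)) \<partial>lborel) \<partial>M)
     \<le> ennreal ((s' - s) * (drift_modulus M Z G h * sqrt (\<integral>z. (e z)\<^sup>2 \<partial>\<mu>)))"
proof -
  note [measurable] = Z_measurable[OF s(1)]
  \<comment> \<open>The path is frozen before time \<open>s\<close>, which makes it continuous on
    the whole line, as joint measurability requires; on \<open>{s..s'}\<close> nothing
    changes.\<close>
  define f where "f \<omega> r = G (Z (max s r) \<omega>)" for \<omega> and r :: real
  have "(\<lambda>(\<omega>, r). f \<omega> r) \<in> borel_measurable (M \<Otimes>\<^sub>M borel)"
  proof (rule measurable_Caratheodory)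
    show "(\<lambda>\<omega>. f \<omega> r) \<in> borel_measurable M" for r
    proof -
      have "0 \<le> max s r" using s by simp
      note [measurable] = Z_measurable[OF this]
      show ?thesis unfolding f_def by measurable
    qed
    show "continuous_on UNIV (f \<omega>)" if "\<omega> \<in> space M" for \<omega>
    proof -
      have "continuous_on UNIV (\<lambda>r. Z (max s r) \<omega>)"
        by (rule continuous_on_compose2[OF Z_continuous[OF that]]) (use s in \<open>auto intro!: continuous_intros\<close>)
      then show ?thesis
        unfolding f_def by (rule continuous_on_compose2[OF drift_continuous]) auto
    qed
  qed
  then have f [measurable]: "(\<lambda>p. f (fst p) (snd p)) \<in> borel_measurable (M \<Otimes>\<^sub>M borel)"
    by (simp add: case_prod_beta)
  have eq: "(\<integral>\<^sup>+r\<in>{s..s'}. ennreal (norm (G (Z r \<omega>) - G (Z s \<omega>)) * e (Z s \<omega>)) \<partial>lborel)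
    = (\<integral>\<^sup>+r. ennreal (norm (f \<omega> r - G (Z s \<omega>)) * e (Z s \<omega>)) * indicator {s..s'} r \<partial>lborel)" for \<omega>
    by (intro nn_integral_cong) (auto simp: f_def indicator_def max_def)
  interpret pair_sigma_finite M "lborel :: real measure" ..
  have mm: "(\<lambda>(\<omega>, r). ennreal (norm (f \<omega> r - G (Z s \<omega>)) * e (Z s \<omega>)) * indicator {s..s'} r) \<in> borel_measurable (M \<Otimes>\<^sub>M lborel)"
  proof -
    have "(\<lambda>p. ennreal (norm (f (fst p) (snd p) - G (Z s (fst p))) * e (Z s (fst p))) * indicator {s..s'} (snd p)) \<in> borel_measurable (M \<Otimes>\<^sub>M borel)"
      by measurable
    then show ?thesis
      by (simp add: case_prod_beta measurable_cong_sets[OF sets_pair_measure_cong[OF refl sets_lborel] refl])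
  qed
  show "(\<lambda>\<omega>. (\<integral>\<^sup>+r\<in>{s..s'}. ennreal (norm (G (Z r \<omega>) - G (Z s \<omega>)) * e (Z s \<omega>)) \<partial>lborel)) \<in> borel_measurable M"
    unfolding eq using lborel.borel_measurable_nn_integral[OF mm] .
  have inner: "(\<integral>\<^sup>+\<omega>. ennreal (norm (f \<omega> r - G (Z s \<omega>)) * e (Z s \<omega>)) * indicator {s..s'} r \<partial>M)
    \<le> ennreal (drift_modulus M Z G h * sqrt (\<integral>z. (e z)\<^sup>2 \<partial>\<mu>)) * indicator {s..s'} r" for r
  proof (cases "r \<in> {s..s'}")
    case True
    then have r: "0 \<le> r" "0 \<le> r - s" "r - s \<le> h" "s + (r - s) = r" using s by auto
    note [measurable] = Z_measurable[OF r(1)]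
    let ?D = "\<lambda>\<omega>. norm (G (Z r \<omega>) - G (Z s \<omega>))"
    have D2: "integrable M (\<lambda>\<omega>. (?D \<omega>)\<^sup>2)" and Dm: "sqrt (expectation (\<lambda>\<omega>. (?D \<omega>)\<^sup>2)) \<le> drift_modulus M Z G h"
      using drift_increment_moment[OF L2 s(1) r(2,3)] unfolding r(4) by auto
    have e2M: "integrable M (\<lambda>\<omega>. (e (Z s \<omega>))\<^sup>2)" "expectation (\<lambda>\<omega>. (e (Z s \<omega>))\<^sup>2) = (\<integral>z. (e z)\<^sup>2 \<partial>\<mu>)"
      using e2 unfolding Z_law[OF s(1), symmetric] by (simp_all add: integrable_distr_eq integral_distr)
    have Dme: "?D \<in> borel_measurable M" "(\<lambda>\<omega>. e (Z s \<omega>)) \<in> borel_measurable M" by measurable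
    have "(\<integral>\<^sup>+\<omega>. ennreal (?D \<omega> * e (Z s \<omega>)) \<partial>M) = ennreal (expectation (\<lambda>\<omega>. ?D \<omega> * e (Z s \<omega>)))"
      using cauchy_schwarz_integral(1)[OF Dme D2 e2M(1)] e0 by (intro nn_integral_eq_integral) auto
    also have "expectation (\<lambda>\<omega>. ?D \<omega> * e (Z s \<omega>)) \<le> sqrt (expectation (\<lambda>\<omega>. (?D \<omega>)\<^sup>2)) * sqrt (\<integral>z. (e z)\<^sup>2 \<partial>\<mu>)"
      using cauchy_schwarz_integral(2)[OF Dme D2 e2M(1)] unfolding e2M(2) .
    also have "\<dots> \<le> drift_modulus M Z G h * sqrt (\<integral>z. (e z)\<^sup>2 \<partial>\<mu>)"
      by (rule mult_right_mono[OF Dm]) simp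
    finally have "(\<integral>\<^sup>+\<omega>. ennreal (?D \<omega> * e (Z s \<omega>)) \<partial>M) \<le> ennreal (drift_modulus M Z G h * sqrt (\<integral>z. (e z)\<^sup>2 \<partial>\<mu>))"
      by (simp add: ennreal_leI)
    then show ?thesis using True by (simp add: f_def max_def)
  qed simp
  have "(\<integral>\<^sup>+\<omega>. (\<integral>\<^sup>+r\<in>{s..s'}. ennreal (norm (G (Z r \<omega>) - G (Z s \<omega>)) * e (Z s \<omega>)) \<partial>lborel) \<partial>M)
    = (\<integral>\<^sup>+r. (\<integral>\<^sup>+\<omega>. ennreal (norm (f \<omega> r - G (Z s \<omega>)) * e (Z s \<omega>)) * indicator {s..s'} r \<partial>M) \<partial>lborel)"
    unfolding eq using Fubini'[OF mm] by simp
  also have "\<dots> \<le> (\<integral>\<^sup>+r. ennreal (drift_modulus M Z G h * sqrt (\<integral>z. (e z)\<^sup>2 \<partial>\<mu>)) * indicator {s..s'} r \<partial>lborel)"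
    by (rule nn_integral_mono[OF inner])
  also have "\<dots> = ennreal (drift_modulus M Z G h * sqrt (\<integral>z. (e z)\<^sup>2 \<partial>\<mu>)) * ennreal (s' - s)"
    using s by (simp add: nn_integral_cmult_indicator)
  also have "\<dots> = ennreal ((s' - s) * (drift_modulus M Z G h * sqrt (\<integral>z. (e z)\<^sup>2 \<partial>\<mu>)))"
    using s by (simp add: ennreal_mult' mult.commute)
  finally show "(\<integral>\<^sup>+\<omega>. (\<integral>\<^sup>+r\<in>{s..s'}. ennreal (norm (G (Z r \<omega>) - G (Z s \<omega>)) * e (Z s \<omega>)) \<partial>lborel) \<partial>M)
     \<le> ennreal ((s' - s) * (drift_modulus M Z G h * sqrt (\<integral>z. (e z)\<^sup>2 \<partial>\<mu>)))" .
qed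

text \<open>Subtracting the integral equation at two times; one null set serves all pairs of times.
  The equation uses the gauge integral, and continuity of the path turns it into a Lebesgue
  integral, for which the norm can be taken inside.\<close>

lemma solution_increment:
  "AE \<omega> in M. \<forall>s s'. 0 \<le> s \<longrightarrow> s \<le> s' \<longrightarrow>
    ennreal (norm (X s' \<omega> - X s \<omega> - S *v (W s' \<omega> - W s \<omega>) - (s' - s) *\<^sub>R G (Z s \<omega>)))
    \<le> (\<integral>\<^sup>+r\<in>{s..s'}. ennreal (norm (G (Z r \<omega>) - G (Z s \<omega>))) \<partial>lborel)"
proof -
  have "AE \<omega> in M. \<forall>t\<ge>0. ((\<lambda>s. G (Z s \<omega>)) has_integral (X t \<omega> - X 0 \<omega> - S *v W t \<omega>)) {0..t}"
    using solution unfolding sdde_solution_def Z_def by blast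
  then show ?thesis
    using AE_space
  proof eventually_elim
    case (elim \<omega>)
    show ?case
    proof (intro allI impI)
      fix s s' :: real assume s: "0 \<le> s" "s \<le> s'"
      have cont: "continuous_on {s..s'} (\<lambda>r. G (Z r \<omega>) - G (Z s \<omega>))"
      proof (intro continuous_intros)
        show "continuous_on {s..s'} (\<lambda>r. G (Z r \<omega>))"
          by (rule continuous_on_compose2[OF drift_continuous continuous_on_subset[OF Z_continuous[OF elim(2)]]]) (use s in auto)
      qed
      have I0: "((\<lambda>r. G (Z r \<omega>)) has_integral (X s \<omega> - X 0 \<omega> - S *v W s \<omega>)) {0..s}"
        "((\<lambda>r. G (Z r \<omega>)) has_integral (X s' \<omega> - X 0 \<omega> - S *v W s' \<omega>)) {0..s'}"
        using elim(1) s by auto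
      have "(\<lambda>r. G (Z r \<omega>)) integrable_on {s..s'}"
        by (rule integrable_subinterval_real[OF has_integral_integrable[OF I0(2)]]) (use s in auto)
      then obtain J where J: "((\<lambda>r. G (Z r \<omega>)) has_integral J) {s..s'}" by blast
      from has_integral_combine[OF s I0(1) J] has_integral_unique[OF I0(2)]
      have "X s' \<omega> - X 0 \<omega> - S *v W s' \<omega> = (X s \<omega> - X 0 \<omega> - S *v W s \<omega>) + J" by blast
      then have "J = X s' \<omega> - X s \<omega> - S *v (W s' \<omega> - W s \<omega>)"
        by (simp add: matrix_vector_mult_diff_distrib algebra_simps)
      moreover have "((\<lambda>r. G (Z s \<omega>)) has_integral ((s' - s) *\<^sub>R G (Z s \<omega>))) {s..s'}"
        using has_integral_const_real[of "G (Z s \<omega>)" s s'] s by simp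
      ultimately have HI: "((\<lambda>r. G (Z r \<omega>) - G (Z s \<omega>)) has_integral
          (X s' \<omega> - X s \<omega> - S *v (W s' \<omega> - W s \<omega>) - (s' - s) *\<^sub>R G (Z s \<omega>))) {s..s'}"
        using has_integral_diff[OF J] by blast
      have si: "set_integrable lborel {s..s'} (\<lambda>r. G (Z r \<omega>) - G (Z s \<omega>))"
        by (rule borel_integrable_atLeastAtMost'[OF cont])
      have "(LINT r:{s..s'}|lborel. G (Z r \<omega>) - G (Z s \<omega>)) = X s' \<omega> - X s \<omega> - S *v (W s' \<omega> - W s \<omega>) - (s' - s) *\<^sub>R G (Z s \<omega>)"
        using set_borel_integral_eq_integral(2)[OF si] integral_unique[OF HI] by simp
      then have "ennreal (norm (X s' \<omega> - X s \<omega> - S *v (W s' \<omega> - W s \<omega>) - (s' - s) *\<^sub>R G (Z s \<omega>)))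
        \<le> (\<integral>\<^sup>+r. norm (indicator {s..s'} r *\<^sub>R (G (Z r \<omega>) - G (Z s \<omega>))) \<partial>lborel)"
        using integral_norm_bound_ennreal[OF si[unfolded set_integrable_def]] by (simp add: set_lebesgue_integral_def)
      also have "\<dots> = (\<integral>\<^sup>+r\<in>{s..s'}. ennreal (norm (G (Z r \<omega>) - G (Z s \<omega>))) \<partial>lborel)"
        by (intro nn_integral_cong) (auto simp: indicator_def)
      finally show "ennreal (norm (X s' \<omega> - X s \<omega> - S *v (W s' \<omega> - W s \<omega>) - (s' - s) *\<^sub>R G (Z s \<omega>)))
        \<le> (\<integral>\<^sup>+r\<in>{s..s'}. ennreal (norm (G (Z r \<omega>) - G (Z s \<omega>))) \<partial>lborel)" .
    qed
  qed
qed

end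


section \<open>Grids and hypothesis classes\<close>

lemma grid_step: "is_grid t n T \<Longrightarrow> k < n \<Longrightarrow> t k < t (Suc k)"
  by (simp add: is_grid_def)

lemma grid_mono:
  assumes "is_grid t n T" "i \<le> j" "j \<le> n"
  shows "t i \<le> t j"
  using assms(2,3)
proof (induction j rule: dec_induct)
  case (step j)
  then show ?case using grid_step[OF assms(1), of j] by simp
qed simp

lemma grid_nonneg: "is_grid t n T \<Longrightarrow> k \<le> n \<Longrightarrow> 0 \<le> t k"
  using grid_mono[of t n T 0 k] by (simp add: is_grid_def)

lemma mesh_pos: "is_grid t n T \<Longrightarrow> k < n \<Longrightarrow> 0 < mesh t k"
  by (simp add: mesh_def is_grid_def)

lemma mesh_le_mesh_max: "k < n \<Longrightarrow> mesh t k \<le> mesh_max t n"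
  unfolding mesh_max_def by (intro Max_ge) auto

lemma finite_obs_index [simp]: "finite (obs_index \<tau> t n)"
  unfolding obs_index_def by simp

text \<open>As the largest delay is a grid point, the observation indices are an interval beginning
  there, and the sum of the mesh widths telescopes.\<close>

lemma obs_time_eq:
  assumes grid: "is_grid t n T" and start: "\<exists>k\<le>n. t k = tau_max \<tau>"
  shows "obs_time \<tau> t n = T - tau_max \<tau>"
proof -
  obtain k0 where k0: "k0 \<le> n" "t k0 = tau_max \<tau>" using start by blast
  have "obs_index \<tau> t n = {k0..<n}"
  proof (intro set_eqI iffI)
    fix k assume k: "k \<in> obs_index \<tau> t n"
    show "k \<in> {k0..<n}"
    proof (rule ccontr)
      assume "k \<notin> {k0..<n}"
      then have "k < k0" using k by (auto simp: obs_index_def)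
      then have "t k < t (Suc k)" "t (Suc k) \<le> t k0"
        using grid_step[OF grid, of k] grid_mono[OF grid, of "Suc k" k0] k0 by auto
      then show False using k k0 by (simp add: obs_index_def)
    qed
  next
    fix k assume "k \<in> {k0..<n}"
    then show "k \<in> obs_index \<tau> t n"
      using grid_mono[OF grid, of k0 k] k0 by (simp add: obs_index_def)
  qed
  then have "obs_time \<tau> t n = (\<Sum>k\<in>{k0..<n}. t (Suc k) - t k)"
    by (simp add: obs_time_def mesh_def)
  also have "\<dots> = t n - t k0" by (rule sum_Suc_diff'[OF k0(1)])
  finally show ?thesis using grid k0 by (simp add: is_grid_def)
qed

text \<open>Grid cells do not overlap, and a cell that starts inside the window can protrude beyond
  it by less than one mesh width. This is why \<open>b + mesh_max t n\<close> and not
  \<open>b\<close> appears in \<open>eps_n\<close>.\<close>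

lemma mesh_sum_window:
  assumes grid: "is_grid t n T" and "lo \<le> hi" "n > 0"
  shows "(\<Sum>k\<in>{k. k < n \<and> lo \<le> t k \<and> t k < hi}. mesh t k) \<le> hi - lo + mesh_max t n"
proof -
  have D: "0 < mesh_max t n"
    using mesh_pos[OF grid, of 0] mesh_le_mesh_max[of 0 n t] \<open>n > 0\<close> by linarith
  \<comment> \<open>The invariant is the length from \<open>lo\<close> to the grid point reached,
    capped one mesh width after \<open>hi\<close>.\<close>
  have "(\<Sum>k\<in>{k. k < m \<and> lo \<le> t k \<and> t k < hi}. mesh t k) \<le> max 0 (min (t m) (hi + mesh_max t n) - lo)"
    if "m \<le> n" for m
    using that
  proof (induction m)
    case (Suc m)
    then have m: "m < n" and step: "t (Suc m) = t m + mesh t m" "0 < mesh t m" "mesh t m \<le> mesh_max t n"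
      using mesh_pos[OF grid, of m] mesh_le_mesh_max[of m n t] by (auto simp: mesh_def)
    show ?case
    proof (cases "lo \<le> t m \<and> t m < hi")
      case True
      then have "{k. k < Suc m \<and> lo \<le> t k \<and> t k < hi} = insert m {k. k < m \<and> lo \<le> t k \<and> t k < hi}"
        by (auto simp: less_Suc_eq)
      then show ?thesis using Suc.IH m step True D by (simp add: max_def min_def split: if_splits)
    next
      case False
      then have "{k. k < Suc m \<and> lo \<le> t k \<and> t k < hi} = {k. k < m \<and> lo \<le> t k \<and> t k < hi}"
        by (auto simp: less_Suc_eq)
      then show ?thesis using Suc.IH m step by (simp add: max_def min_def split: if_splits)
    qed
  qed simp
  from this[of n] show ?thesis using D \<open>lo \<le> hi\<close> by (simp add: max_def min_def split: if_splits)
qed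

lemma class_continuous:
  assumes "admissible_class H" "g \<in> fst ` H"
  shows "continuous_on UNIV g"
proof -
  obtain m f where f: "\<And>j. continuous_on UNIV (f j)" and g: "g = masked_drift f m"
    using assms unfolding admissible_class_def by fastforce
  show ?thesis
    unfolding g masked_drift_def
  proof (rule continuous_on_vec_lambda, rule continuous_on_compose2[OF f])
    have eq: "(\<chi> a. column j (m $ a) * z $ a) = (\<chi> a. \<chi> i. column j (m $ a) $ i * z $ a $ i)" for j and z :: "real^'a^'b"
      by (simp add: vec_eq_iff)
    show "continuous_on UNIV (\<lambda>z :: real^'a^'b. \<chi> a. column j (m $ a) * z $ a)" for j
      unfolding eq by (intro continuous_on_vec_lambda continuous_intros)
  qed auto
qed

context
  fixes H :: "('d::finite, 'b::finite) hyp_class" and K :: "(real^'d^'b) set" and \<epsilon> :: real and A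
  assumes net: "internal_net H K \<epsilon> A" and adm: "admissible_class H"
begin

text \<open>At a point of \<open>K\<close> each drift is within \<open>\<epsilon>\<close> of a net
  member, whose norm is at most the sum over the net. The bound is uniform in the class and
  continuous in \<open>z\<close>, so it serves both the pointwise supremum and its supremum over a
  compact \<open>K\<close>.\<close>

lemma class_diam_bound:
  assumes "g \<in> fst ` H" "g' \<in> fst ` H" "z \<in> K"
  shows "norm (g z - g' z) \<le> 2 * (\<epsilon> + (\<Sum>a\<in>A. norm (a z)))"
proof -
  have *: "norm (u z) \<le> \<epsilon> + (\<Sum>a\<in>A. norm (a z))" if "u \<in> fst ` H" for u
  proof -
    have fin: "finite A" and "\<exists>a\<in>A. \<forall>z\<in>K. norm (u z - a z) \<le> \<epsilon>"
      using net that unfolding internal_net_def by (simp, metis)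
    then obtain a where a: "a \<in> A" "norm (u z - a z) \<le> \<epsilon>" using assms(3) by metis
    have "norm (a z) \<le> (\<Sum>a\<in>A. norm (a z))"
      by (rule member_le_sum[OF a(1) _ fin]) (rule norm_ge_zero)
    moreover have "norm (u z) \<le> norm (a z) + norm (u z - a z)" by (rule norm_triangle_sub)
    ultimately show ?thesis using a(2) by linarith
  qed
  show ?thesis
    unfolding mult_2
    by (rule order_trans[OF norm_triangle_ineq4 add_mono[OF *[OF assms(1)] *[OF assms(2)]]])
qed

lemma class_diam_upper:
  assumes "g \<in> fst ` H" "g' \<in> fst ` H" "z \<in> K"
  shows "norm (g z - g' z) \<le> class_diam H z"
proof -
  have "bdd_above ((\<lambda>(g, g'). norm (g z - g' z)) ` (fst ` H \<times> fst ` H))"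
    by (rule bdd_aboveI2[where M = "2 * (\<epsilon> + (\<Sum>a\<in>A. norm (a z)))"]) (use class_diam_bound assms(3) in auto)
  from cSUP_upper[OF _ this, of "(g, g')"] show ?thesis
    using assms unfolding class_diam_def by auto
qed

lemma class_diam_bdd_above:
  assumes "compact K" "H \<noteq> {}"
  shows "bdd_above (class_diam H ` K)"
proof -
  have "continuous_on K (\<lambda>z. 2 * (\<epsilon> + (\<Sum>a\<in>A. norm (a z))))"
    using net class_continuous[OF adm]
    by (intro continuous_intros continuous_on_subset[OF class_continuous[OF adm]]) (auto simp: internal_net_def)
  from compact_imp_bounded[OF compact_continuous_image[OF this assms(1)]]
  obtain B where B: "\<And>z. z \<in> K \<Longrightarrow> 2 * (\<epsilon> + (\<Sum>a\<in>A. norm (a z))) \<le> B"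
    unfolding bounded_iff by (force simp: abs_le_iff)
  show ?thesis
  proof (rule bdd_aboveI2)
    fix z assume z: "z \<in> K"
    have "class_diam H z \<le> 2 * (\<epsilon> + (\<Sum>a\<in>A. norm (a z)))"
      unfolding class_diam_def using assms(2) class_diam_bound z by (intro cSUP_least) auto
    then show "class_diam H z \<le> B" using B[OF z] by linarith
  qed
qed

end

lemma compact_K_ball: "compact (K_ball c \<rho>)"
proof -
  have "K_ball c \<rho> = cball (\<chi> a. c) \<rho>"
    by (auto simp: K_ball_def dist_norm norm_minus_commute)
  then show ?thesis by (metis compact_cball)
qed

lemma K_ball_borel [measurable]: "K_ball c \<rho> \<in> sets borel"
  by (rule borel_compact[OF compact_K_ball])

subsection \<open>The orthogonal projection that omits one coordinate\<close>

text \<open>The functions of all coordinates but coordinate \<open>i\<close> of block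
  \<open>a\<close> are those that factor through this map; its pullback of the Borel sets is the
  sigma-algebra to condition on.\<close>

definition zero_coord :: "'d \<Rightarrow> 'b \<Rightarrow> real^'d^'b::finite \<Rightarrow> real^'d::finite^'b" where
  "zero_coord i a z = (\<chi> b k. if (k, b) = (i, a) then 0 else z $ b $ k)"

lemma zero_coord_measurable: "zero_coord i a \<in> borel_measurable borel"
proof (rule borel_measurable_continuous_onI)
  have "continuous_on UNIV (\<lambda>z. if (k, b) = (i, a) then 0 else z $ b $ k :: real)" for b k
  proof (cases "(k, b) = (i, a)")
    case True
    then show ?thesis by (simp only: simp_thms if_True continuous_on_const)
  next
    case False
    then show ?thesis
      by (simp only: if_False) (rule continuous_on_component[OF continuous_on_component[OF continuous_on_id]])
  qed
  then show "continuous_on UNIV (zero_coord i a)"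
    unfolding zero_coord_def[abs_def] by (intro continuous_on_vec_lambda)
qed

text \<open>The projection is the conditional expectation given the pullback along
  \<open>zero_coord\<close>; Jensen's inequality keeps it square-integrable. Existence is what gives
  the choice in \<open>L2_proj\<close> its meaning.\<close>

lemma L2_omit_projection:
  assumes "prob_space \<mu>" and sets_\<mu>: "sets \<mu> = sets borel"
    and g [measurable]: "g \<in> borel_measurable borel" and g2: "integrable \<mu> (\<lambda>z. (g z)\<^sup>2)"
  shows "\<exists>p\<in>L2_omit \<mu> i a. \<forall>v\<in>L2_omit \<mu> i a. (\<integral>z. (g z - p z) * v z \<partial>\<mu>) = 0"
proof -
  interpret prob_space \<mu> by fact
  have cong [measurable_cong]: "sets \<mu> = sets borel" by (rule sets_\<mu>)
  have sp: "space \<mu> = UNIV" using sets_eq_imp_space_eq[OF sets_\<mu>] by simp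
  have mb: "f \<in> borel_measurable \<mu> \<longleftrightarrow> f \<in> borel_measurable borel" for f :: "_ \<Rightarrow> real"
    using measurable_cong_sets[OF sets_\<mu> refl] by blast
  let ?T = "zero_coord i a"
  define V where "V = vimage_algebra UNIV ?T borel"
  have sub: "subalgebra \<mu> V"
    unfolding subalgebra_def V_def
    using measurable_sets[OF zero_coord_measurable, of _ i a] by (auto simp: sp sets_\<mu> sets_vimage_algebra2)
  interpret sigma_finite_subalgebra \<mu> V
    by (rule finite_measure_subalgebra_is_sigma_finite)
       (simp add: finite_measure_subalgebra_def finite_measure_axioms finite_measure_subalgebra_axioms_def sub)
  have gi: "integrable \<mu> g" using g by (intro square_integrable_imp_integrable[OF _ g2]) (simp add: mb)
  define p where "p = real_cond_exp \<mu> V g"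
  have pV: "p \<in> borel_measurable V" unfolding p_def by simp
  have pb: "p \<in> borel_measurable borel" using measurable_from_subalg[OF sub pV] by (simp add: mb)
  have p2: "integrable \<mu> (\<lambda>z. (p z)\<^sup>2)"
    unfolding p_def
    by (rule integrable_convex_cond_exp[where I = UNIV and q = "\<lambda>x. x\<^sup>2", OF gi])
       (use g2 in \<open>auto simp: convex_power2\<close>)
  \<comment> \<open>Invariance holds exactly, not only almost everywhere: the level set of
    \<open>p\<close> through \<open>z\<close> is a preimage under \<open>zero_coord\<close>, hence
    contains every point that differs from \<open>z\<close> in the omitted coordinate only.\<close>
  have inv: "p z = p z'" if "\<forall>b k. (k, b) \<noteq> (i, a) \<longrightarrow> z $ b $ k = z' $ b $ k" for z z'
  proof -
    have T: "?T z = ?T z'" using that by (auto simp: zero_coord_def vec_eq_iff)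
    have "p -` {p z} \<inter> space V \<in> sets V" by (rule measurable_sets[OF pV]) simp
    then obtain B where "p -` {p z} = ?T -` B"
      unfolding V_def by (auto simp: sets_vimage_algebra2)
    moreover from this have "z \<in> ?T -` B" by blast
    then have "z' \<in> ?T -` B" using T by simp
    ultimately have "z' \<in> p -` {p z}" by simp
    then show ?thesis by simp
  qed
  have "p \<in> L2_omit \<mu> i a"
    unfolding L2_omit_def using pb p2 inv by blast
  moreover have "(\<integral>z. (g z - p z) * v z \<partial>\<mu>) = 0" if v: "v \<in> L2_omit \<mu> i a" for v
  proof -
    have vb: "v \<in> borel_measurable borel" and v2: "integrable \<mu> (\<lambda>z. (v z)\<^sup>2)"
      and vinv: "\<And>z z'. (\<forall>b k. (k, b) \<noteq> (i, a) \<longrightarrow> z $ b $ k = z' $ b $ k) \<Longrightarrow> v z = v z'"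
      using v unfolding L2_omit_def by blast+
    have "v z = v (?T z)" for z by (rule vinv) (simp add: zero_coord_def)
    then have "v = (\<lambda>z. v (?T z))" by blast
    moreover have "(\<lambda>z. v (?T z)) \<in> borel_measurable V"
      unfolding V_def by (rule measurable_compose[OF measurable_vimage_algebra1 vb]) simp
    ultimately have vV: "v \<in> borel_measurable V" by simp
    have prod: "integrable \<mu> (\<lambda>z. v z * g z)" "integrable \<mu> (\<lambda>z. v z * p z)"
      using vb g pb v2 g2 p2 by (intro cauchy_schwarz_integral(1); simp add: mb)+
    have "(\<integral>z. v z * p z \<partial>\<mu>) = (\<integral>z. v z * g z \<partial>\<mu>)"
      unfolding p_def using prod g by (intro real_cond_exp_intg(2) vV) (simp_all add: mb)
    moreover have "(g z - p z) * v z = v z * g z - v z * p z" for z by (simp add: algebra_simps)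
    ultimately show ?thesis
      using prod by simp
  qed
  ultimately show ?thesis by blast
qed

text \<open>Pythagoras: \<open>p - v\<close> lies in the subspace and is orthogonal to the residual
  of the projection, so the projection is a best approximation.\<close>

lemma signal_square_le:
  fixes G :: "(real^'d::finite, 'b::finite) vec \<Rightarrow> real^'d"
  assumes \<mu>: "prob_space \<mu>" "sets \<mu> = sets borel"
    and G: "(\<lambda>z. G z $ j) \<in> borel_measurable borel" and G2: "integrable \<mu> (\<lambda>z. (G z $ j)\<^sup>2)"
    and v: "v \<in> L2_omit \<mu> i a"
  shows "(signal \<mu> G i j a)\<^sup>2 \<le> (\<integral>z. (v z - G z $ j)\<^sup>2 \<partial>\<mu>)"
proof -
  interpret prob_space \<mu> by (rule \<mu>(1))
  have mb: "f \<in> borel_measurable \<mu> \<longleftrightarrow> f \<in> borel_measurable borel" for f :: "_ \<Rightarrow> real"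
    using measurable_cong_sets[OF \<mu>(2) refl] by blast
  let ?V = "L2_omit \<mu> i a"
  define p where "p = L2_proj \<mu> ?V (\<lambda>z. G z $ j)"
  have "\<exists>p. p \<in> ?V \<and> (\<forall>v\<in>?V. (\<integral>z. (G z $ j - p z) * v z \<partial>\<mu>) = 0)"
    using L2_omit_projection[OF \<mu> G G2, of i a] by blast
  from someI_ex[OF this] have p: "p \<in> ?V" and orth: "\<And>v. v \<in> ?V \<Longrightarrow> (\<integral>z. (G z $ j - p z) * v z \<partial>\<mu>) = 0"
    unfolding p_def L2_proj_def by blast+
  have Vb: "u \<in> borel_measurable borel" "integrable \<mu> (\<lambda>z. (u z)\<^sup>2)" if "u \<in> ?V" for u
    using that by (auto simp: L2_omit_def)
  have diff2: "integrable \<mu> (\<lambda>z. (u z - w z)\<^sup>2)" if "u \<in> borel_measurable borel" "w \<in> borel_measurable borel"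
     "integrable \<mu> (\<lambda>z. (u z)\<^sup>2)" "integrable \<mu> (\<lambda>z. (w z)\<^sup>2)" for u w :: "_ \<Rightarrow> real"
    using integrable_norm_diff_square[of u \<mu> w] that by (simp add: mb)
  have pv: "(\<lambda>z. p z - v z) \<in> ?V"
    unfolding L2_omit_def
  proof (safe)
    show "(\<lambda>z. p z - v z) \<in> borel_measurable borel" using Vb(1)[OF p] Vb(1)[OF v] by simp
    show "integrable \<mu> (\<lambda>z. (p z - v z)\<^sup>2)" by (rule diff2[OF Vb(1)[OF p] Vb(1)[OF v] Vb(2)[OF p] Vb(2)[OF v]])
    fix z z' :: "(real^'d, 'b) vec" assume e: "\<forall>b k. (k, b) \<noteq> (i, a) \<longrightarrow> z $ b $ k = z' $ b $ k"
    have "p z = p z'" "v z = v z'" using p v e unfolding L2_omit_def by blast+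
    then show "p z - v z = p z' - v z'" by simp
  qed
  let ?u = "\<lambda>z. G z $ j - p z" and ?w = "\<lambda>z. p z - v z"
  have u2: "integrable \<mu> (\<lambda>z. (?u z)\<^sup>2)" by (rule diff2[OF G Vb(1)[OF p] G2 Vb(2)[OF p]])
  have w2: "integrable \<mu> (\<lambda>z. (?w z)\<^sup>2)" using Vb(2)[OF pv] .
  have s2: "integrable \<mu> (\<lambda>z. (G z $ j - v z)\<^sup>2)" by (rule diff2[OF G Vb(1)[OF v] G2 Vb(2)[OF v]])
  \<comment> \<open>Polarisation: the inner product of residual and difference is written through
    three squares known to be integrable.\<close>
  have uw: "?u z * ?w z = ((G z $ j - v z)\<^sup>2 - (?u z)\<^sup>2 - (?w z)\<^sup>2) / 2" for z
    by (simp add: power2_eq_square algebra_simps)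
  have "0 = (\<integral>z. ((G z $ j - v z)\<^sup>2 - (?u z)\<^sup>2 - (?w z)\<^sup>2) / 2 \<partial>\<mu>)"
    using orth[OF pv] unfolding uw by simp
  also have "\<dots> = ((\<integral>z. (G z $ j - v z)\<^sup>2 \<partial>\<mu>) - (\<integral>z. (?u z)\<^sup>2 \<partial>\<mu>) - (\<integral>z. (?w z)\<^sup>2 \<partial>\<mu>)) / 2"
    using u2 w2 s2 by simp
  finally have "0 = ((\<integral>z. (G z $ j - v z)\<^sup>2 \<partial>\<mu>) - (\<integral>z. (?u z)\<^sup>2 \<partial>\<mu>) - (\<integral>z. (?w z)\<^sup>2 \<partial>\<mu>)) / 2" .
  moreover have "0 \<le> (\<integral>z. (?w z)\<^sup>2 \<partial>\<mu>)" by simp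
  moreover have "0 = (a - b - c) / 2 \<Longrightarrow> 0 \<le> c \<Longrightarrow> b \<le> a" for a b c :: real by simp
  ultimately have "(\<integral>z. (?u z)\<^sup>2 \<partial>\<mu>) \<le> (\<integral>z. (G z $ j - v z)\<^sup>2 \<partial>\<mu>)" by blast
  also have "(\<integral>z. (?u z)\<^sup>2 \<partial>\<mu>) = (signal \<mu> G i j a)\<^sup>2"
    unfolding signal_def p_def[symmetric] L2_dist_sq_def by simp
  finally show ?thesis by (simp add: power2_commute)
qed

section \<open>Edge counts and recovery of the mask\<close>

definition mask_support :: "real^'d^'d^'b \<Rightarrow> ('b \<times> 'd \<times> 'd) set" where
  "mask_support m = (SIGMA a:UNIV. {(i, j). m $ a $ i $ j \<noteq> 0})"

lemma card_mask_support:
  fixes m :: "(real^'d::finite^'d, 'b::finite) vec"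
  shows "(\<Sum>a\<in>UNIV. mat_l0 (m $ a)) = card (mask_support m)"
  unfolding mask_support_def mat_l0_def by (subst card_SigmaI) auto

text \<open>Several edges missing in one column do not add up in the risk, so only the affected
  columns are charged there; this turns the number of missing edges into a number of columns. Each
  column contains at most \<open>d_max m\<close> edges.\<close>

lemma card_missing_edges:
  fixes m :: "(real^'d::finite^'d, 'b::finite) vec"
  assumes E: "E \<subseteq> mask_support m"
  shows "card E \<le> d_max m * card ((\<lambda>(a, i, j). j) ` E)"
proof -
  have col: "card {e\<in>E. snd (snd e) = j} \<le> d_max m" for j
  proof -
    have "card {e\<in>E. snd (snd e) = j} \<le> card (SIGMA a:UNIV. {i. m $ a $ i $ j \<noteq> 0})"
    proof (rule card_inj_on_le)
      show "inj_on (\<lambda>(a, i, j). (a, i)) {e\<in>E. snd (snd e) = j}" by (auto simp: inj_on_def)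
    qed (use E in \<open>auto simp: mask_support_def\<close>)
    also have "\<dots> = (\<Sum>a\<in>UNIV. vec_l0 (column j (m $ a)))"
      unfolding vec_l0_def column_def by (subst card_SigmaI) auto
    also have "\<dots> \<le> d_max m" unfolding d_max_def by (intro Max_ge) auto
    finally show ?thesis .
  qed
  let ?J = "(\<lambda>(a, i, j). j) ` E"
  have "E = (\<Union>j\<in>?J. {e\<in>E. snd (snd e) = j})" by force
  then have "card E = card (\<Union>j\<in>?J. {e\<in>E. snd (snd e) = j})" by simp
  also have "\<dots> \<le> (\<Sum>j\<in>?J. card {e\<in>E. snd (snd e) = j})" by (rule card_UN_le) simp
  also have "\<dots> \<le> (\<Sum>j\<in>?J. d_max m)" by (intro sum_mono col)
  finally show ?thesis by (simp add: mult.commute)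
qed

lemma support_recovery:
  fixes G :: "(real^'d::finite, 'b::finite) vec \<Rightarrow> real^'d" and mask m :: "(real^'d^'d, 'b) vec"
  assumes \<mu>: "prob_space \<mu>" "sets \<mu> = sets borel"
    and adm: "admissible_class H" and GH: "(G, mask) \<in> H" and gH: "(g, m) \<in> H"
    and G2: "integrable \<mu> (\<lambda>z. (norm (G z))\<^sup>2)" and gG: "integrable \<mu> (\<lambda>z. (norm (g z - G z))\<^sup>2)"
    and To: "To > 0" and lam: "0 < lam" "lam < To * (s_min \<mu> G mask)\<^sup>2 / real (d_max mask)"
    and s: "s_min \<mu> G mask > 0"
    and eps: "eps < min lam (To * (s_min \<mu> G mask)\<^sup>2 - lam * real (d_max mask))"
    and dev: "\<bar>(Rg - RG) - To * L2_dist_sq \<mu> g G\<bar> \<le> eps"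
    and min: "Rg + lam * real (\<Sum>a\<in>UNIV. mat_l0 (m $ a)) \<le> RG + lam * real (\<Sum>a\<in>UNIV. mat_l0 (mask $ a))"
  shows "m = mask" and "L2_dist_sq \<mu> g G \<le> eps / To"
proof -
  let ?s = "s_min \<mu> G mask" and ?d = "real (d_max mask)"
  have masks: "is_mask m" "is_mask mask" using adm GH gH by (auto simp: admissible_class_def)
  have cont: "continuous_on UNIV g" "continuous_on UNIV G"
    using class_continuous[OF adm] GH gH by force+
  have mb: "f \<in> borel_measurable \<mu> \<longleftrightarrow> f \<in> borel_measurable borel" for f :: "_ \<Rightarrow> real"
    using measurable_cong_sets[OF \<mu>(2) refl] by blast
  have comp_meas: "(\<lambda>z. u z $ j) \<in> borel_measurable borel" if "continuous_on UNIV u" for u :: "real^'d^'b \<Rightarrow> real^'d" and j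
    using that by (intro borel_measurable_continuous_onI continuous_intros)
  have comp_sq: "integrable \<mu> (\<lambda>z. (u z $ j)\<^sup>2)" if "continuous_on UNIV u" "integrable \<mu> (\<lambda>z. (norm (u z))\<^sup>2)"
    for u :: "real^'d^'b \<Rightarrow> real^'d" and j
  proof (rule Bochner_Integration.integrable_bound[OF that(2)])
    show "(\<lambda>z. (u z $ j)\<^sup>2) \<in> borel_measurable \<mu>" using comp_meas[OF that(1)] by (simp add: mb)
    show "AE z in \<mu>. norm ((u z $ j)\<^sup>2) \<le> norm ((norm (u z))\<^sup>2)"
      by (rule AE_I2) (simp add: abs_le_square_iff[symmetric] component_le_norm_cart)
  qed
  have contd: "continuous_on UNIV (\<lambda>z. g z - G z)" using cont by (intro continuous_intros)
  have d2: "integrable \<mu> (\<lambda>z. (g z $ j - G z $ j)\<^sup>2)" for j using comp_sq[OF contd gG, of j] by simp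
  have split: "L2_dist_sq \<mu> g G = (\<Sum>j\<in>UNIV. \<integral>z. (g z $ j - G z $ j)\<^sup>2 \<partial>\<mu>)"
    unfolding L2_dist_sq_def using d2
    by (subst Bochner_Integration.integral_sum[symmetric])
       (auto simp: norm_vec_def L2_set_def sum_nonneg)
  define E where "E = mask_support mask - mask_support m"
  define J where "J = (\<lambda>(a, i, j). j) ` E"
  \<comment> \<open>Without the edge, component \<open>j\<close> of \<open>g\<close> does not depend
    on that coordinate, so it competes with the projection and its distance to the true component is
    at least the signal.\<close>
  have miss: "?s\<^sup>2 \<le> (\<integral>z. (g z $ j - G z $ j)\<^sup>2 \<partial>\<mu>)" if jJ: "j \<in> J" for j
  proof -
    obtain a i where e: "mask $ a $ i $ j \<noteq> 0" "m $ a $ i $ j = 0"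
      using jJ by (auto simp: J_def E_def mask_support_def)
    have e1: "mask $ a $ i $ j = 1" using masks(2) e(1) by (auto simp: is_mask_def)
    obtain f where f: "g = masked_drift f m" using adm gH by (auto simp: admissible_class_def)
    have "(\<lambda>z. g z $ j) \<in> L2_omit \<mu> i a"
      unfolding L2_omit_def
    proof (safe)
      show "(\<lambda>z. g z $ j) \<in> borel_measurable borel" by (rule comp_meas[OF cont(1)])
      show "integrable \<mu> (\<lambda>z. (g z $ j)\<^sup>2)"
        using integrable_norm_diff_square[of "\<lambda>z. g z $ j - G z $ j" \<mu> "\<lambda>z. - (G z $ j)"]
          comp_meas[OF contd, of j] comp_meas[OF cont(2), of j] d2[of j] comp_sq[OF cont(2) G2, of j] by (simp add: mb)
      fix z z' :: "real^'d^'b" assume eq: "\<forall>b k. (k, b) \<noteq> (i, a) \<longrightarrow> z $ b $ k = z' $ b $ k"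
      have "(\<chi> b. column j (m $ b) * z $ b) = (\<chi> b. column j (m $ b) * z' $ b)"
      proof (simp add: vec_eq_iff column_def, intro allI)
        fix b k
        show "m $ b $ k $ j = 0 \<or> z $ b $ k = z' $ b $ k"
          using e(2) eq by (cases "(k, b) = (i, a)") auto
      qed
      then show "g z $ j = g z' $ j" unfolding f masked_drift_def by simp
    qed
    from signal_square_le[OF \<mu> comp_meas[OF cont(2)] comp_sq[OF cont(2) G2] this]
    have "(signal \<mu> G i j a)\<^sup>2 \<le> (\<integral>z. (g z $ j - G z $ j)\<^sup>2 \<partial>\<mu>)" .
    moreover have "?s \<le> signal \<mu> G i j a"
      unfolding s_min_def
    proof (rule Min_le)
      have "{signal \<mu> G i j a | i j a. mask $ a $ i $ j = 1} \<subseteq> range (\<lambda>(i, j, a). signal \<mu> G i j a)"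
      proof
        fix x assume "x \<in> {signal \<mu> G i j a | i j a. mask $ a $ i $ j = 1}"
        then obtain i j a where "x = (\<lambda>(i, j, a). signal \<mu> G i j a) (i, j, a)" by auto
        then show "x \<in> range (\<lambda>(i, j, a). signal \<mu> G i j a)" by (rule range_eqI)
      qed
      then show "finite {signal \<mu> G i j a | i j a. mask $ a $ i $ j = 1}" by (rule finite_subset) simp
    qed (use e1 in blast)
    ultimately show ?thesis using power_mono[of ?s "signal \<mu> G i j a" 2] s by linarith
  qed
  have "real (card J) * ?s\<^sup>2 = (\<Sum>j\<in>J. ?s\<^sup>2)" by simp
  also have "\<dots> \<le> (\<Sum>j\<in>J. \<integral>z. (g z $ j - G z $ j)\<^sup>2 \<partial>\<mu>)" by (intro sum_mono miss)
  also have "\<dots> \<le> L2_dist_sq \<mu> g G"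
    unfolding split by (intro sum_mono2) auto
  finally have lower: "real (card J) * ?s\<^sup>2 \<le> L2_dist_sq \<mu> g G" .
  have cardE: "real (card E) \<le> ?d * real (card J)"
    using card_missing_edges[of E mask] unfolding J_def E_def by (simp flip: of_nat_mult)
  have fin: "finite (mask_support mask)" "finite (mask_support m)" by (auto intro: finite_subset[OF subset_UNIV])
  define E' where "E' = mask_support m - mask_support mask"
  have cards: "real (card (mask_support mask)) - real (card (mask_support m)) = real (card E) - real (card E')"
  proof -
    have "mask_support mask = E \<union> (mask_support mask \<inter> mask_support m)"
      "mask_support m = E' \<union> (mask_support mask \<inter> mask_support m)"
      unfolding E_def E'_def by blast+
    moreover have "card (E \<union> (mask_support mask \<inter> mask_support m)) = card E + card (mask_support mask \<inter> mask_support m)"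
      "card (E' \<union> (mask_support mask \<inter> mask_support m)) = card E' + card (mask_support mask \<inter> mask_support m)"
      using fin unfolding E_def E'_def by (intro card_Un_disjoint; blast)+
    ultimately have "card (mask_support mask) = card E + card (mask_support mask \<inter> mask_support m)"
      "card (mask_support m) = card E' + card (mask_support mask \<inter> mask_support m)" by metis+
    then show ?thesis by simp
  qed
  \<comment> \<open>Comparison of the minimiser with the truth, with the risk difference replaced by
    its population value up to \<open>eps\<close>; common edges cancel in the penalty.\<close>
  have main: "To * L2_dist_sq \<mu> g G - eps \<le> lam * (real (card E) - real (card E'))"
    using dev min unfolding card_mask_support cards[symmetric] by (simp add: abs_le_iff right_diff_distrib)
  have "J = {}"
  proof (rule ccontr)
    assume "J \<noteq> {}"
    then have "1 \<le> real (card J)" by (simp add: Suc_le_eq card_gt_0_iff)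
    define \<gamma> where "\<gamma> = To * ?s\<^sup>2 - lam * ?d"
    \<comment> \<open>If \<open>d_max mask\<close> were 0, the upper bound on \<open>lam\<close>
      would be a quotient by zero, that is 0, contradicting \<open>0 < lam\<close>.\<close>
    have "0 \<le> \<gamma>"
      using lam To by (cases "?d = 0") (auto simp: \<gamma>_def field_simps)
    then have "\<gamma> \<le> real (card J) * \<gamma>" using \<open>1 \<le> real (card J)\<close> mult_right_mono[of 1 "real (card J)" \<gamma>] by simp
    also have "real (card J) * \<gamma> \<le> eps"
    proof -
      have "To * (real (card J) * ?s\<^sup>2) \<le> To * L2_dist_sq \<mu> g G" using lower To by (intro mult_left_mono) auto
      moreover have "lam * (real (card E) - real (card E')) \<le> lam * (?d * real (card J))"
        using cardE lam by (intro mult_left_mono) auto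
      ultimately show ?thesis using main unfolding \<gamma>_def by (simp add: algebra_simps)
    qed
    finally show False using eps unfolding \<gamma>_def by simp
  qed
  then have E: "E = {}" by (simp add: J_def)
  have r0: "0 \<le> L2_dist_sq \<mu> g G" unfolding L2_dist_sq_def by simp
  have "E' = {}"
  proof (rule ccontr)
    assume "E' \<noteq> {}"
    then have "1 \<le> real (card E')" using fin by (simp add: E'_def Suc_le_eq card_gt_0_iff)
    then have "lam \<le> lam * real (card E')" using lam by simp
    moreover have "0 \<le> To * L2_dist_sq \<mu> g G" using r0 To by simp
    ultimately show False using main E eps by simp
  qed
  with E have "mask_support m = mask_support mask" unfolding E_def E'_def by blast
  then have supp: "m $ a $ i $ j \<noteq> 0 \<longleftrightarrow> mask $ a $ i $ j \<noteq> 0" for a i j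
    unfolding mask_support_def by blast
  show "m = mask"
  proof (simp add: vec_eq_iff, intro allI)
    fix a i j
    show "m $ a $ i $ j = mask $ a $ i $ j"
      using supp[of a i j] masks unfolding is_mask_def by (metis insertE singletonD)
  qed
  show "L2_dist_sq \<mu> g G \<le> eps / To"
    using main E \<open>E' = {}\<close> To by (simp add: field_simps)
qed


section \<open>Tail event and block decomposition\<close>

lemma sum_even_odd:
  fixes f :: "nat \<Rightarrow> 'a::comm_monoid_add"
  shows "(\<Sum>i<J. f i) = (\<Sum>j<(J + 1) div 2. f (2 * j)) + (\<Sum>j<J div 2. f (2 * j + 1))"
proof (induction J)
  case (Suc J)
  show ?case
  proof (cases "even J")
    case True
    then obtain k where J: "J = 2 * k" by (rule evenE)
    then have "(Suc J + 1) div 2 = Suc k" "Suc J div 2 = k" "(J + 1) div 2 = k" "J div 2 = k" by auto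
    then show ?thesis using Suc.IH J by (simp add: ac_simps)
  next
    case False
    then obtain k where J: "J = 2 * k + 1" by (rule oddE)
    then have "(Suc J + 1) div 2 = Suc k" "Suc J div 2 = Suc k" "(J + 1) div 2 = Suc k" "J div 2 = k" by auto
    then show ?thesis using Suc.IH J by (simp add: ac_simps)
  qed
qed simp

lemma space_generated_sigma [simp]: "space (generated_sigma M I Z) = space M"
  unfolding generated_sigma_def by (rule space_measure_of) auto

lemma generated_sigma_measurable:
  assumes "r \<in> I"
  shows "Z r \<in> borel_measurable (generated_sigma M I Z)"
proof (rule measurableI)
  fix B :: "'b set" assume "B \<in> sets borel"
  then have "Z r -` B \<inter> space M \<in> {Z r -` B \<inter> space M |r B. r \<in> I \<and> B \<in> sets borel}"
    using assms by blast
  then show "Z r -` B \<inter> space (generated_sigma M I Z) \<in> sets (generated_sigma M I Z)"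
    unfolding space_generated_sigma unfolding generated_sigma_def by (intro in_measure_of) auto
qed simp

lemma generated_sigma_subalgebra:
  assumes "\<And>r. r \<in> I \<Longrightarrow> Z r \<in> borel_measurable M"
  shows "subalgebra M (generated_sigma M I Z)"
  unfolding subalgebra_def space_generated_sigma
proof (intro conjI refl)
  show "sets (generated_sigma M I Z) \<subseteq> sets M"
    unfolding generated_sigma_def
  proof (rule sets.sigma_sets_subset[THEN order_trans[rotated]])
    show "{Z r -` B \<inter> space M |r B. r \<in> I \<and> B \<in> sets borel} \<subseteq> sets M"
      using measurable_sets[OF assms] by blast
    show "sets (sigma (space M) {Z r -` B \<inter> space M |r B. r \<in> I \<and> B \<in> sets borel})
      \<subseteq> sigma_sets (space M) {Z r -` B \<inter> space M |r B. r \<in> I \<and> B \<in> sets borel}"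
      by (subst sets_measure_of) auto
  qed
qed

text \<open>An infinite \<open>x\<close> has an infinite root, which the hypothesis excludes; for
  finite \<open>x\<close> powers are monotone.\<close>

lemma ennreal_root_le_iff:
  assumes "ennreal_root k x \<le> ennreal y" "0 \<le> y" "0 < k"
  shows "x \<le> ennreal (y ^ k)"
proof (cases x)
  case (real r)
  then have "root k r \<le> y" using assms by (simp add: ennreal_root_def)
  then have "root k r ^ k \<le> y ^ k" using real assms by (intro power_mono) auto
  then show ?thesis using real assms by (simp add: ennreal_leI)
next
  case top
  then show ?thesis using assms by (simp add: ennreal_root_def top_unique)
qed

context stationary_sdde
begin

text \<open>Every coefficient is at most 1, so the supremum over the splitting time is that of a
  bounded set.\<close>

lemma beta_mixing_upper:
  assumes "0 \<le> s" "0 \<le> u"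
  shows "beta_coeff M (generated_sigma M {0..s} Z) (generated_sigma M {s + u..} Z) \<le> beta_mixing M Z u"
proof -
  have sub: "subalgebra M (generated_sigma M {0..s} Z)" "subalgebra M (generated_sigma M {s + u..} Z)"
    if "0 \<le> s" for s
    using assms(2) that by (auto intro!: generated_sigma_subalgebra Z_measurable)
  have "bdd_above ((\<lambda>s. beta_coeff M (generated_sigma M {0..s} Z) (generated_sigma M {s + u..} Z)) ` {0..})"
    by (rule bdd_aboveI2[where M = 1]) (rule beta_coeff_le_1[OF sub]; simp)
  then show ?thesis
    unfolding beta_mixing_def using assms(1) by (intro cSUP_upper) auto
qed

text \<open>Stationarity moves the window to the unit interval seen by \<open>moment_sup\<close>.
  Outside the ball \<open>\<rho>\<^sup>2\<close> is at most the sum of the squared norms of the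
  blocks, each at most the squared segment norm; this produces the factor
  \<open>CARD('b) ^ p\<close>. A finite \<open>U\<close> makes finite-dimensional laws
  sufficient.\<close>

lemma tail_moment:
  assumes U: "finite U" "U \<subseteq> {0..1}" and s: "0 \<le> s" and \<rho>: "0 < \<rho>"
  shows "ennreal (\<rho> ^ (2 * p)) * emeasure M {\<omega>\<in>space M. \<exists>u\<in>U. Z (s + u) \<omega> \<notin> K_ball c \<rho>}
    \<le> of_nat CARD('b) ^ p * moment_sup M (tau_max \<tau>) X c p"
proof -
  let ?K = "K_ball c \<rho> :: ((real^'d, 'b) vec) set"
  have Zm: "Z r \<in> borel_measurable M" if "0 \<le> r" for r by (rule Z_measurable[OF that])
  have good: "{\<omega>\<in>space M. \<forall>u\<in>U. Z (r + u) \<omega> \<in> ?K} \<in> sets M" if "0 \<le> r" for r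
  proof -
    have *: "{\<omega>\<in>space M. Z (r + u) \<omega> \<in> ?K} \<in> sets M" if "u \<in> U" for u
    proof -
      have "0 \<le> r + u" using that U(2) \<open>0 \<le> r\<close> by (auto intro!: add_nonneg_nonneg)
      from measurable_sets[OF Zm[OF this] K_ball_borel[of c \<rho>]] show ?thesis
        by (simp add: vimage_def Int_def conj_commute)
    qed
    show ?thesis by (rule sets.sets_Collect_finite_All[OF * U(1)])
  qed
  define B where "B r = {\<omega>\<in>space M. \<exists>u\<in>U. Z (r + u) \<omega> \<notin> ?K}" for r
  have B_eq: "B r = space M - {\<omega>\<in>space M. \<forall>u\<in>U. Z (r + u) \<omega> \<in> ?K}" for r
    unfolding B_def by blast
  have Bm: "B r \<in> sets M" if "0 \<le> r" for r unfolding B_eq using good[OF that] by auto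
  have U0: "\<forall>u\<in>U. 0 \<le> u" using U(2) by auto
  have "emeasure M {\<omega>\<in>space M. \<forall>u\<in>U. Z (s + u) \<omega> \<in> ?K} = emeasure M {\<omega>\<in>space M. \<forall>u\<in>U. Z u \<omega> \<in> ?K}"
    by (rule Z_finite_dim_stationary[OF U(1) U0 _ s]) simp
  then have eq: "emeasure M (B s) = emeasure M (B 0)"
    unfolding B_eq emeasure_eq_measure using prob_compl[OF good[OF s]] prob_compl[OF good[OF order_refl]] by simp
  have q: "0 < real CARD('b)" by (simp add: card_gt_0_iff)
  have le: "ennreal (\<rho> ^ (2 * p) / real CARD('b) ^ p) * indicator (B 0) \<omega>
    \<le> (SUP u\<in>{0..1}. ennreal (segment_norm (tau_max \<tau>) (\<lambda>r. segment (tau_max \<tau>) (\<lambda>r. X r \<omega>) u r - c) ^ (2 * p)))"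
    (is "_ \<le> ?S") if \<omega>: "\<omega> \<in> space M" for \<omega>
  proof (cases "\<omega> \<in> B 0")
    case True
    then obtain u where u: "u \<in> U" "Z u \<omega> \<notin> ?K" by (auto simp: B_def)
    then have u01: "0 \<le> u" "u \<le> 1" using U(2) by auto
    define \<phi> where "\<phi> r = segment (tau_max \<tau>) (\<lambda>r. X r \<omega>) u r - c" for r
    define N where "N = segment_norm (tau_max \<tau>) \<phi>"
    have "continuous_on {- tau_max \<tau>..0} (seg u \<omega>)"
      using seg_space[OF u01(1) \<omega>] by (simp add: segment_space_def space_restrict_space)
    then have "continuous_on {- tau_max \<tau>..0} (\<lambda>r. norm (\<phi> r))"
      unfolding \<phi>_def seg_def by (intro continuous_intros)
    from compact_imp_bounded[OF compact_continuous_image[OF this compact_Icc]]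
    have bdd: "bdd_above ((\<lambda>r. norm (\<phi> r)) ` {- tau_max \<tau>..0})" by (rule bounded_imp_bdd_above)
    have comp: "norm (Z u \<omega> $ a - c) \<le> N" for a
    proof -
      have "norm (\<phi> (- \<tau> a)) \<le> N"
        unfolding N_def segment_norm_def using delay_bounds[of a] by (intro cSUP_upper bdd) auto
      moreover have "\<phi> (- \<tau> a) = Z u \<omega> $ a - c"
        using delay_bounds[of a] by (simp add: \<phi>_def segment_def Z_def delay_vec_def)
      ultimately show ?thesis by simp
    qed
    have N0: "0 \<le> N" using order_trans[OF norm_ge_zero comp] .
    have "\<rho> ^ 2 \<le> (norm (Z u \<omega> - (\<chi> a. c)))\<^sup>2"
      using u(2) \<rho> by (intro power_mono) (auto simp: K_ball_def)
    also have "\<dots> = (\<Sum>a\<in>UNIV. (norm (Z u \<omega> $ a - c))\<^sup>2)"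
      by (simp add: norm_vec_def[where 'a = "real^'d" and 'b = 'b] L2_set_def sum_nonneg)
    also have "\<dots> \<le> (\<Sum>a\<in>(UNIV :: 'b set). N\<^sup>2)"
      by (intro sum_mono power_mono comp) simp
    finally have "\<rho> ^ 2 \<le> real CARD('b) * N\<^sup>2" by simp
    then have "(\<rho> ^ 2) ^ p \<le> (real CARD('b) * N\<^sup>2) ^ p" by (rule power_mono) simp
    then have "\<rho> ^ (2 * p) \<le> real CARD('b) ^ p * N ^ (2 * p)"
      by (simp add: power_mult power_mult_distrib)
    then have "\<rho> ^ (2 * p) / real CARD('b) ^ p \<le> N ^ (2 * p)"
      using q by (simp add: divide_le_eq mult.commute)
    then have "ennreal (\<rho> ^ (2 * p) / real CARD('b) ^ p) \<le> ennreal (N ^ (2 * p))" by (rule ennreal_leI)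
    also have "\<dots> \<le> ?S"
      unfolding N_def \<phi>_def using u01 by (intro SUP_upper) auto
    finally show ?thesis using True by simp
  qed simp
  have "ennreal (\<rho> ^ (2 * p) / real CARD('b) ^ p) * emeasure M (B 0)
    = (\<integral>\<^sup>+\<omega>. ennreal (\<rho> ^ (2 * p) / real CARD('b) ^ p) * indicator (B 0) \<omega> \<partial>M)"
    using Bm[of 0] by (simp add: nn_integral_cmult)
  also have "\<dots> \<le> moment_sup M (tau_max \<tau>) X c p"
    unfolding moment_sup_def by (intro nn_integral_mono le)
  finally have "of_nat CARD('b) ^ p * (ennreal (\<rho> ^ (2 * p) / real CARD('b) ^ p) * emeasure M (B 0))
    \<le> of_nat CARD('b) ^ p * moment_sup M (tau_max \<tau>) X c p"
    by (rule mult_left_mono) simp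
  moreover have "of_nat CARD('b) ^ p * ennreal (\<rho> ^ (2 * p) / real CARD('b) ^ p) = ennreal (\<rho> ^ (2 * p))"
  proof -
    have "of_nat CARD('b) ^ p = ennreal (real CARD('b) ^ p)"
      by (simp add: ennreal_power[symmetric] ennreal_of_nat_eq_real_of_nat)
    then show ?thesis using q \<rho> by (simp add: ennreal_mult[symmetric])
  qed
  ultimately have "ennreal (\<rho> ^ (2 * p)) * emeasure M (B 0) \<le> of_nat CARD('b) ^ p * moment_sup M (tau_max \<tau>) X c p"
    by (simp add: mult.assoc[symmetric])
  then show ?thesis using eq unfolding B_def by simp
qed

text \<open>The observation window is covered by \<open>J\<close> unit intervals, which is where the
  factor \<open>J\<close> under the root comes from.\<close>

lemma tail_probability:
  assumes I: "I \<subseteq> {k. tau_max \<tau> \<le> t k \<and> t k \<le> tau_max \<tau> + real J}" "finite I"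
    and \<rho>: "1 \<le> \<rho>" and \<eta>: "0 < \<eta>" and J: "1 \<le> J" and p: "1 \<le> p"
    and root: "ennreal_root (2 * p) (of_nat J * of_nat CARD('b) ^ p * moment_sup M (tau_max \<tau>) X c p / ennreal \<eta>) \<le> ennreal \<rho>"
  shows "prob {\<omega>\<in>space M. \<exists>k\<in>I. Z (t k) \<omega> \<notin> K_ball c \<rho>} \<le> \<eta>"
proof -
  let ?K = "K_ball c \<rho> :: ((real^'d, 'b) vec) set"
  define s where "s j = tau_max \<tau> + real j" for j :: nat
  have s0: "0 \<le> s j" for j using tau_max_nonneg by (simp add: s_def)
  define U where "U j = (\<lambda>k. t k - s j) ` {k\<in>I. s j \<le> t k \<and> t k \<le> s j + 1}" for j
  have U: "finite (U j)" "U j \<subseteq> {0..1}" for j using I(2) by (auto simp: U_def)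
  define B where "B j = {\<omega>\<in>space M. \<exists>u\<in>U j. Z (s j + u) \<omega> \<notin> ?K}" for j
  have Bm: "B j \<in> sets M" for j
    unfolding B_def
  proof (rule sets.sets_Collect_finite_Ex[OF _ U(1)])
    fix u assume "u \<in> U j"
    then have "0 \<le> s j + u" using U(2)[of j] s0[of j] by (auto intro!: add_nonneg_nonneg)
    from measurable_sets[OF Z_measurable[OF this] borel_comp[OF K_ball_borel[of c \<rho>]]]
    show "{\<omega>\<in>space M. Z (s j + u) \<omega> \<notin> ?K} \<in> sets M" by (simp add: vimage_def Int_def conj_commute)
  qed
  have cover: "{\<omega>\<in>space M. \<exists>k\<in>I. Z (t k) \<omega> \<notin> ?K} \<subseteq> (\<Union>j<J. B j)"
  proof
    fix \<omega> assume "\<omega> \<in> {\<omega>\<in>space M. \<exists>k\<in>I. Z (t k) \<omega> \<notin> ?K}"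
    then obtain k where \<omega>: "\<omega> \<in> space M" and k: "k \<in> I" "Z (t k) \<omega> \<notin> ?K" by blast
    define x where "x = t k - tau_max \<tau>"
    have x: "0 \<le> x" "x \<le> real J" using I(1) k(1) by (auto simp: x_def)
    \<comment> \<open>The minimum puts an observation at the right end of the window into the last
      closed unit interval.\<close>
    define j where "j = min (nat \<lfloor>x\<rfloor>) (J - 1)"
    have "j < J" using J by (auto simp: j_def)
    moreover have "real j \<le> x \<and> x \<le> real j + 1"
    proof (cases "nat \<lfloor>x\<rfloor> \<le> J - 1")
      case True
      then have "real j = of_int \<lfloor>x\<rfloor>" using x by (simp add: j_def)
      then show ?thesis by linarith
    next
      case False
      then have "real j = real J - 1" "real J \<le> of_int \<lfloor>x\<rfloor>" using J x by (auto simp: j_def of_nat_diff le_nat_iff)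
      then show ?thesis using x by linarith
    qed
    then have "t k - s j \<in> U j" using k(1) by (auto simp: U_def s_def x_def)
    then have "\<omega> \<in> B j" using \<omega> k(2) by (auto simp: B_def intro!: bexI[of _ "t k - s j"])
    ultimately show "\<omega> \<in> (\<Union>j<J. B j)" by blast
  qed
  have "ennreal (\<rho> ^ (2 * p)) * emeasure M (\<Union>j<J. B j) \<le> ennreal (\<rho> ^ (2 * p)) * (\<Sum>j<J. emeasure M (B j))"
    using Bm by (intro mult_left_mono emeasure_subadditive_finite) auto
  also have "\<dots> = (\<Sum>j<J. ennreal (\<rho> ^ (2 * p)) * emeasure M (B j))" by (rule sum_distrib_left)
  also have "\<dots> \<le> (\<Sum>j<J. of_nat CARD('b) ^ p * moment_sup M (tau_max \<tau>) X c p)"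
    unfolding B_def using \<rho> by (intro sum_mono tail_moment[OF U s0]) simp
  also have "\<dots> = of_nat J * of_nat CARD('b) ^ p * moment_sup M (tau_max \<tau>) X c p"
    by (simp add: mult.assoc)
  also have "\<dots> = (of_nat J * of_nat CARD('b) ^ p * moment_sup M (tau_max \<tau>) X c p / ennreal \<eta>) * ennreal \<eta>"
  proof -
    have "inverse (ennreal \<eta>) * ennreal \<eta> = 1"
      using \<eta> by (simp add: inverse_ennreal ennreal_mult[symmetric])
    then show ?thesis by (simp add: divide_ennreal_def mult.assoc)
  qed
  also have "\<dots> \<le> ennreal (\<rho> ^ (2 * p)) * ennreal \<eta>"
    using \<rho> p by (intro mult_right_mono ennreal_root_le_iff[OF root]) auto
  finally have "ennreal (\<rho> ^ (2 * p) * prob (\<Union>j<J. B j)) \<le> ennreal (\<rho> ^ (2 * p) * \<eta>)"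
    using \<rho> \<eta> by (simp add: emeasure_eq_measure ennreal_mult)
  then have "\<rho> ^ (2 * p) * prob (\<Union>j<J. B j) \<le> \<rho> ^ (2 * p) * \<eta>"
    using \<rho> \<eta> by (subst (asm) ennreal_le_iff) auto
  then have "prob (\<Union>j<J. B j) \<le> \<eta>" using \<rho> by simp
  moreover have "prob {\<omega>\<in>space M. \<exists>k\<in>I. Z (t k) \<omega> \<notin> ?K} \<le> prob (\<Union>j<J. B j)"
    using Bm by (intro finite_measure_mono[OF cover]) auto
  ultimately show ?thesis by simp
qed

text \<open>All earlier blocks are functions of the path up to the end of the previous block and the
  current one starts at least \<open>b\<close> later, so one coefficient at lag \<open>b\<close> is
  paid per block. Because \<open>\<phi>\<close> takes values in \<open>{0..C}\<close>, a centred
  block sum ranges over an interval of length \<open>C\<close> times its weight, and not twice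
  that.\<close>

lemma block_deviation:
  fixes \<Phi> :: "((real^'d, 'b) vec \<Rightarrow> real) set"
  assumes \<Phi>: "finite \<Phi>" "\<And>\<phi>. \<phi> \<in> \<Phi> \<Longrightarrow> \<phi> \<in> borel_measurable borel" "\<And>\<phi> z. \<phi> \<in> \<Phi> \<Longrightarrow> \<phi> z \<in> {0..C}"
    and blk: "finite I" "\<And>j k. j < m \<Longrightarrow> k \<in> blk j \<Longrightarrow> k \<in> I \<and> lo j \<le> t k \<and> t k \<le> hi j"
    and lohi: "\<And>j. j < m \<Longrightarrow> 0 \<le> lo j" "\<And>i j. i < j \<Longrightarrow> j < m \<Longrightarrow> hi i + b \<le> lo j" "\<And>j. j < m \<Longrightarrow> 0 \<le> hi j" "\<And>i j. i \<le> j \<Longrightarrow> j < m \<Longrightarrow> hi i \<le> hi j"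
    and w: "\<And>k. k \<in> I \<Longrightarrow> 0 \<le> w k"
    and \<beta>: "0 \<le> \<beta>" "beta_mixing M Z b \<le> \<beta>" and b: "0 < b"
    and R: "(\<Sum>j<m. ((\<Sum>k\<in>blk j. w k) * C)\<^sup>2) \<le> R" "R > 0" and u: "0 \<le> u"
  shows "prob {\<omega>\<in>space M. \<exists>\<phi>\<in>\<Phi>. \<bar>\<Sum>j<m. \<Sum>k\<in>blk j. w k * (\<phi> (Z (t k) \<omega>) - (\<integral>z. \<phi> z \<partial>\<mu>))\<bar> > u}
    \<le> real m * \<beta> + real (card \<Phi>) * (2 * exp (- 2 * u\<^sup>2 / R))"
proof -
  define Y where "Y j \<omega> = (\<lambda>\<phi>\<in>\<Phi>. \<Sum>k\<in>blk j. w k * (\<phi> (Z (t k) \<omega>) - (\<integral>z. \<phi> z \<partial>\<mu>)))" for j \<omega>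
  interpret \<mu>: prob_space \<mu>
    unfolding Z_law[OF order_refl, symmetric] by (rule prob_space_distr) (rule Z_measurable, simp)
  have mub: "f \<in> borel_measurable \<mu> \<longleftrightarrow> f \<in> borel_measurable borel" for f :: "_ \<Rightarrow> real"
    unfolding Z_law[OF order_refl, symmetric] by simp
  have \<Phi>int: "integrable \<mu> \<phi>" if "\<phi> \<in> \<Phi>" for \<phi>
    by (rule \<mu>.integrable_const_bound[where B = C]) (use \<Phi>(2,3)[OF that] in \<open>auto simp: mub abs_le_iff\<close>)
  have q: "0 \<le> (\<integral>z. \<phi> z \<partial>\<mu>)" if "\<phi> \<in> \<Phi>" for \<phi> using \<Phi>(3)[OF that] by (intro integral_nonneg_AE) auto
  have mean: "integrable M (\<lambda>\<omega>. \<phi> (Z r \<omega>)) \<and> expectation (\<lambda>\<omega>. \<phi> (Z r \<omega>)) = (\<integral>z. \<phi> z \<partial>\<mu>)" if "\<phi> \<in> \<Phi>" "0 \<le> r" for \<phi> r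
    using \<Phi>int[OF that(1)] \<Phi>(2)[OF that(1)] Z_measurable[OF that(2)] unfolding Z_law[OF that(2), symmetric]
    by (simp add: integrable_distr_eq integral_distr)
  have t0: "0 \<le> t k" if "j < m" "k \<in> blk j" for j k using blk(2)[OF that] lohi(1)[OF that(1)] by linarith
  have Ymeas: "Y j \<in> A \<rightarrow>\<^sub>M PiM \<Phi> (\<lambda>_. borel)"
    if "j < m" "\<And>k. k \<in> blk j \<Longrightarrow> Z (t k) \<in> borel_measurable A" for j A
    unfolding Y_def[abs_def]
  proof (rule measurable_restrict)
    fix \<phi> assume \<phi>: "\<phi> \<in> \<Phi>"
    show "(\<lambda>\<omega>. \<Sum>k\<in>blk j. w k * (\<phi> (Z (t k) \<omega>) - (\<integral>z. \<phi> z \<partial>\<mu>))) \<in> borel_measurable A"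
    proof (rule borel_measurable_sum)
      fix k assume "k \<in> blk j"
      have "(\<lambda>\<omega>. \<phi> (Z (t k) \<omega>)) \<in> borel_measurable A"
        by (rule measurable_compose[OF that(2)[OF \<open>k \<in> blk j\<close>] \<Phi>(2)[OF \<phi>]])
      then show "(\<lambda>\<omega>. w k * (\<phi> (Z (t k) \<omega>) - (\<integral>z. \<phi> z \<partial>\<mu>))) \<in> borel_measurable A" by measurable
    qed
  qed
  have main: "prob {\<omega>\<in>space M. \<exists>\<phi>\<in>\<Phi>. \<bar>\<Sum>j<m. Y j \<omega> \<phi>\<bar> > u} \<le> real m * \<beta> + real (card \<Phi>) * (2 * exp (- 2 * u\<^sup>2 / R))"
  proof (rule mixing_concentration[where a = "\<lambda>j \<phi>. - ((\<Sum>k\<in>blk j. w k) * (\<integral>z. \<phi> z \<partial>\<mu>))" and r = "\<lambda>j. (\<Sum>k\<in>blk j. w k) * C"])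
    fix j assume j: "j < m"
    show "\<exists>A B. subalgebra M A \<and> subalgebra M B \<and> beta_coeff M A B \<le> \<beta> \<and>
      (\<forall>i<j. Y i \<in> A \<rightarrow>\<^sub>M PiM \<Phi> (\<lambda>_. borel)) \<and> Y j \<in> B \<rightarrow>\<^sub>M PiM \<Phi> (\<lambda>_. borel)"
    proof (cases "j = 0")
      case True
      have sub: "subalgebra M (generated_sigma M {0..} Z)"
        by (rule generated_sigma_subalgebra) (simp add: Z_measurable)
      have "Y j \<in> generated_sigma M {0..} Z \<rightarrow>\<^sub>M PiM \<Phi> (\<lambda>_. borel)"
        by (rule Ymeas[OF j]) (use t0[OF j] in \<open>auto intro!: generated_sigma_measurable\<close>)
      then show ?thesis
        using beta_coeff_trivial[OF sub] sub \<beta>(1) True by (intro exI conjI) (auto intro: order_trans)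
    next
      case False
      define s where "s = hi (j - 1)"
      have s: "0 \<le> s" "s + b \<le> lo j" using lohi(3)[of "j - 1"] lohi(2)[of "j - 1" j] j False by (auto simp: s_def)
      have subs: "subalgebra M (generated_sigma M {0..s} Z)" "subalgebra M (generated_sigma M {s + b..} Z)"
        using s b by (auto intro!: generated_sigma_subalgebra Z_measurable)
      have past: "Y i \<in> generated_sigma M {0..s} Z \<rightarrow>\<^sub>M PiM \<Phi> (\<lambda>_. borel)" if "i < j" for i
      proof (rule Ymeas)
        show "i < m" using that j by simp
        fix k assume k: "k \<in> blk i"
        have "hi i \<le> hi (j - 1)" using that j by (intro lohi(4)) auto
        then have "t k \<le> s" using blk(2)[OF \<open>i < m\<close> k] unfolding s_def by linarith
        then show "Z (t k) \<in> borel_measurable (generated_sigma M {0..s} Z)"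
          using t0[OF \<open>i < m\<close> k] by (intro generated_sigma_measurable) simp
      qed
      have fut: "Y j \<in> generated_sigma M {s + b..} Z \<rightarrow>\<^sub>M PiM \<Phi> (\<lambda>_. borel)"
      proof (rule Ymeas[OF j])
        fix k assume k: "k \<in> blk j"
        then show "Z (t k) \<in> borel_measurable (generated_sigma M {s + b..} Z)"
          using blk(2)[OF j k] s by (intro generated_sigma_measurable) simp
      qed
      have "beta_coeff M (generated_sigma M {0..s} Z) (generated_sigma M {s + b..} Z) \<le> \<beta>"
        using beta_mixing_upper[OF s(1), of b] b \<beta>(2) by simp
      then show ?thesis using subs past fut by blast
    qed
    fix \<phi> assume \<phi>: "\<phi> \<in> \<Phi>"
    have finb: "finite (blk j)" using blk(2)[OF j] by (intro finite_subset[OF _ blk(1)]) blast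
    have w0: "0 \<le> w k" if "k \<in> blk j" for k using w blk(2)[OF j that] by simp
    show "Y j \<omega> \<phi> \<in> {- ((\<Sum>k\<in>blk j. w k) * (\<integral>z. \<phi> z \<partial>\<mu>))..- ((\<Sum>k\<in>blk j. w k) * (\<integral>z. \<phi> z \<partial>\<mu>)) + (\<Sum>k\<in>blk j. w k) * C}" for \<omega>
    proof -
      have eq: "Y j \<omega> \<phi> = (\<Sum>k\<in>blk j. w k * \<phi> (Z (t k) \<omega>)) - (\<Sum>k\<in>blk j. w k) * (\<integral>z. \<phi> z \<partial>\<mu>)"
        using \<phi> by (simp add: Y_def right_diff_distrib sum_subtractf sum_distrib_right)
      have "0 \<le> (\<Sum>k\<in>blk j. w k * \<phi> (Z (t k) \<omega>))"
        using w0 \<Phi>(3)[OF \<phi>] by (intro sum_nonneg mult_nonneg_nonneg) auto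
      moreover have "(\<Sum>k\<in>blk j. w k * \<phi> (Z (t k) \<omega>)) \<le> (\<Sum>k\<in>blk j. w k * C)"
        using w0 \<Phi>(3)[OF \<phi>] by (intro sum_mono mult_left_mono) auto
      ultimately show ?thesis unfolding eq by (simp add: sum_distrib_right)
    qed
    show "expectation (\<lambda>\<omega>. Y j \<omega> \<phi>) = 0"
    proof -
      have "expectation (\<lambda>\<omega>. Y j \<omega> \<phi>) = (\<Sum>k\<in>blk j. expectation (\<lambda>\<omega>. w k * (\<phi> (Z (t k) \<omega>) - (\<integral>z. \<phi> z \<partial>\<mu>))))"
        using \<phi> mean[OF \<phi> t0[OF j]] by (simp add: Y_def Bochner_Integration.integral_sum)
      also have "\<dots> = 0"
        using mean[OF \<phi> t0[OF j]] by (intro sum.neutral ballI) (simp add: prob_space)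
      finally show ?thesis .
    qed
  qed (use \<Phi>(1) \<beta>(1) R u in auto)
  have "{\<omega>\<in>space M. \<exists>\<phi>\<in>\<Phi>. \<bar>\<Sum>j<m. \<Sum>k\<in>blk j. w k * (\<phi> (Z (t k) \<omega>) - (\<integral>z. \<phi> z \<partial>\<mu>))\<bar> > u}
    = {\<omega>\<in>space M. \<exists>\<phi>\<in>\<Phi>. \<bar>\<Sum>j<m. Y j \<omega> \<phi>\<bar> > u}"
    by (auto simp: Y_def)
  then show ?thesis using main by simp
qed

end


section \<open>The exceptional events\<close>

text \<open>A deterministic inequality on one path. The increment is decomposed into frozen drift,
  noise \<open>N\<close> and a remainder; \<open>bias\<close>, \<open>mart\<close>,
  \<open>noise\<close> and \<open>conc\<close> are what holds off the exceptional events, and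
  \<open>q'\<close> is the population value of the truncated net member.\<close>

lemma risk_difference_bound:
  fixes x :: "real \<Rightarrow> real^'d::finite" and z :: "nat \<Rightarrow> (real^'d, 'b::finite) vec" and N :: "nat \<Rightarrow> real^'d"
  assumes I: "finite I" "\<And>k. k \<in> I \<Longrightarrow> 0 < mesh t k"
    and bias: "(\<Sum>k\<in>I. norm (x (t (Suc k)) - x (t k) - N k - mesh t k *\<^sub>R G (z k)) * e k) \<le> b1"
    and e: "\<And>k. k \<in> I \<Longrightarrow> norm (g (z k) - G (z k)) \<le> e k"
    and E: "\<And>k. k \<in> I \<Longrightarrow> norm (g (z k) - G (z k)) \<le> E" "\<And>k. k \<in> I \<Longrightarrow> norm (g' (z k) - G (z k)) \<le> E"
    and net: "\<And>k. k \<in> I \<Longrightarrow> norm (g (z k) - g' (z k)) \<le> \<epsilon>"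
    and mart: "\<bar>\<Sum>k\<in>I. N k \<bullet> (g' (z k) - G (z k))\<bar> \<le> b2"
    and noise: "(\<Sum>k\<in>I. norm (N k)) \<le> b3"
    and conc: "\<bar>\<Sum>k\<in>I. mesh t k * ((norm (g' (z k) - G (z k)))\<^sup>2 - q')\<bar> \<le> b4"
    and q: "\<bar>q - q'\<bar> \<le> r" and \<epsilon>: "0 \<le> \<epsilon>"
  shows "\<bar>((\<Sum>k\<in>I. mesh t k * (norm ((x (t (Suc k)) - x (t k)) /\<^sub>R mesh t k - g (z k)))\<^sup>2)
      - (\<Sum>k\<in>I. mesh t k * (norm ((x (t (Suc k)) - x (t k)) /\<^sub>R mesh t k - G (z k)))\<^sup>2)) - (\<Sum>k\<in>I. mesh t k) * q\<bar>
    \<le> 2 * b1 + 2 * b2 + 2 * \<epsilon> * b3 + b4 + 2 * E * \<epsilon> * (\<Sum>k\<in>I. mesh t k) + r * (\<Sum>k\<in>I. mesh t k)"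
proof -
  define h h' D where "h k = g (z k) - G (z k)" and "h' k = g' (z k) - G (z k)"
    and "D k = x (t (Suc k)) - x (t k) - N k - mesh t k *\<^sub>R G (z k)" for k
  \<comment> \<open>The squared residual of the true drift cancels in the difference, which leaves a
    quadratic term in \<open>h\<close> and a cross term; the latter splits into remainder and
    noise.\<close>
  have expand: "mesh t k * (norm ((x (t (Suc k)) - x (t k)) /\<^sub>R mesh t k - g (z k)))\<^sup>2
      - mesh t k * (norm ((x (t (Suc k)) - x (t k)) /\<^sub>R mesh t k - G (z k)))\<^sup>2
    = mesh t k * (norm (h k))\<^sup>2 - 2 * (D k \<bullet> h k) - 2 * (N k \<bullet> h k)" if "k \<in> I" for k
  proof -
    let ?d = "mesh t k"
    have d: "?d > 0" using I(2)[OF that] .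
    define a where "a = (x (t (Suc k)) - x (t k)) /\<^sub>R ?d - G (z k)"
    have "?d *\<^sub>R a = D k + N k" using d by (simp add: a_def D_def scaleR_diff_right)
    then have da: "?d * (a \<bullet> h k) = D k \<bullet> h k + N k \<bullet> h k"
      by (metis inner_add_left inner_scaleR_left)
    have 1: "(x (t (Suc k)) - x (t k)) /\<^sub>R ?d - g (z k) = a - h k" by (simp add: a_def h_def)
    have 2: "(norm (a - h k))\<^sup>2 = (norm a)\<^sup>2 - 2 * (a \<bullet> h k) + (norm (h k))\<^sup>2"
      by (simp add: power2_norm_eq_inner inner_diff_left inner_diff_right inner_commute)
    show ?thesis
      using da unfolding 1 2 a_def[symmetric] by (simp add: algebra_simps)
  qed
  let ?T = "\<Sum>k\<in>I. mesh t k"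
  have S1: "\<bar>\<Sum>k\<in>I. D k \<bullet> h k\<bar> \<le> b1"
  proof -
    have "\<bar>\<Sum>k\<in>I. D k \<bullet> h k\<bar> \<le> (\<Sum>k\<in>I. \<bar>D k \<bullet> h k\<bar>)" by (rule sum_abs)
    also have "\<dots> \<le> (\<Sum>k\<in>I. norm (D k) * e k)"
    proof (rule sum_mono)
      fix k assume "k \<in> I"
      then show "\<bar>D k \<bullet> h k\<bar> \<le> norm (D k) * e k"
        unfolding h_def by (intro order_trans[OF Cauchy_Schwarz_ineq2 mult_left_mono[OF e norm_ge_zero]])
    qed
    finally show ?thesis using bias unfolding D_def by (rule order_trans)
  qed
  have S2: "\<bar>\<Sum>k\<in>I. N k \<bullet> h k\<bar> \<le> b2 + \<epsilon> * b3"
  proof -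
    have "(\<Sum>k\<in>I. N k \<bullet> h k) = (\<Sum>k\<in>I. N k \<bullet> h' k) + (\<Sum>k\<in>I. N k \<bullet> (g (z k) - g' (z k)))"
      unfolding sum.distrib[symmetric] h_def h'_def by (intro sum.cong refl) (simp add: inner_diff_right)
    moreover have "\<bar>\<Sum>k\<in>I. N k \<bullet> (g (z k) - g' (z k))\<bar> \<le> \<epsilon> * b3"
    proof -
      have "\<bar>\<Sum>k\<in>I. N k \<bullet> (g (z k) - g' (z k))\<bar> \<le> (\<Sum>k\<in>I. \<bar>N k \<bullet> (g (z k) - g' (z k))\<bar>)" by (rule sum_abs)
      also have "\<dots> \<le> (\<Sum>k\<in>I. \<epsilon> * norm (N k))"
      proof (rule sum_mono)
        fix k assume "k \<in> I"
        then show "\<bar>N k \<bullet> (g (z k) - g' (z k))\<bar> \<le> \<epsilon> * norm (N k)"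
          unfolding mult.commute[of \<epsilon>] by (intro order_trans[OF Cauchy_Schwarz_ineq2 mult_left_mono[OF net norm_ge_zero]])
      qed
      also have "\<dots> \<le> \<epsilon> * b3" unfolding sum_distrib_left[symmetric] by (rule mult_left_mono[OF noise \<epsilon>])
      finally show ?thesis .
    qed
    ultimately show ?thesis using mart unfolding h'_def by (simp add: abs_le_iff)
  qed
  have S3: "\<bar>(\<Sum>k\<in>I. mesh t k * (norm (h k))\<^sup>2) - ?T * q\<bar> \<le> b4 + 2 * E * \<epsilon> * ?T + r * ?T"
  proof -
    \<comment> \<open>Three errors: passing to the net member at the observations, the centred sum
      of the net member, and the difference of the two population values.\<close>
    have eq: "(\<Sum>k\<in>I. mesh t k * (norm (h k))\<^sup>2) - ?T * q
      = (\<Sum>k\<in>I. mesh t k * ((norm (h k))\<^sup>2 - (norm (h' k))\<^sup>2)) + (\<Sum>k\<in>I. mesh t k * ((norm (h' k))\<^sup>2 - q')) + (q' - q) * ?T"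
      by (simp add: right_diff_distrib sum_subtractf left_diff_distrib sum_distrib_left sum_distrib_right mult.commute)
    have "\<bar>\<Sum>k\<in>I. mesh t k * ((norm (h k))\<^sup>2 - (norm (h' k))\<^sup>2)\<bar> \<le> (\<Sum>k\<in>I. \<bar>mesh t k * ((norm (h k))\<^sup>2 - (norm (h' k))\<^sup>2)\<bar>)"
      by (rule sum_abs)
    also have "\<dots> \<le> (\<Sum>k\<in>I. mesh t k * (2 * E * \<epsilon>))"
    proof (rule sum_mono)
      fix k assume k: "k \<in> I"
      have "\<bar>(norm (h k))\<^sup>2 - (norm (h' k))\<^sup>2\<bar> \<le> 2 * E * \<epsilon>"
        using E[OF k] net[OF k] by (intro abs_norm_square_diff_le) (simp_all add: h_def h'_def)
      then show "\<bar>mesh t k * ((norm (h k))\<^sup>2 - (norm (h' k))\<^sup>2)\<bar> \<le> mesh t k * (2 * E * \<epsilon>)"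
        using I(2)[OF k] by (simp add: abs_mult)
    qed
    also have "\<dots> = 2 * E * \<epsilon> * ?T" by (simp add: sum_distrib_right[symmetric] mult.commute)
    finally have a: "\<bar>\<Sum>k\<in>I. mesh t k * ((norm (h k))\<^sup>2 - (norm (h' k))\<^sup>2)\<bar> \<le> 2 * E * \<epsilon> * ?T" .
    have T0: "0 \<le> ?T" using I(2) by (intro sum_nonneg less_imp_le)
    have "\<bar>(q' - q) * ?T\<bar> \<le> r * ?T"
      using mult_right_mono[OF q T0] T0 by (simp add: abs_mult abs_minus_commute)
    moreover have "\<bar>A + B + C\<bar> \<le> b + a + c" if "\<bar>A\<bar> \<le> a" "\<bar>B\<bar> \<le> b" "\<bar>C\<bar> \<le> c" for A B C a b c :: real
      using that by linarith
    ultimately show ?thesis unfolding eq using a conc unfolding h'_def by blast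
  qed
  have total: "(\<Sum>k\<in>I. mesh t k * (norm ((x (t (Suc k)) - x (t k)) /\<^sub>R mesh t k - g (z k)))\<^sup>2)
      - (\<Sum>k\<in>I. mesh t k * (norm ((x (t (Suc k)) - x (t k)) /\<^sub>R mesh t k - G (z k)))\<^sup>2)
    = (\<Sum>k\<in>I. mesh t k * (norm (h k))\<^sup>2) - 2 * (\<Sum>k\<in>I. D k \<bullet> h k) - 2 * (\<Sum>k\<in>I. N k \<bullet> h k)"
    unfolding sum_subtractf[symmetric] sum_distrib_left using expand by (intro sum.cong refl)
  have "\<bar>(A - 2 * B - 2 * C) - Q\<bar> \<le> 2 * b1 + 2 * b2 + 2 * \<epsilon> * b3 + b4 + u + v"
    if "\<bar>B\<bar> \<le> b1" "\<bar>C\<bar> \<le> b2 + \<epsilon> * b3" "\<bar>A - Q\<bar> \<le> b4 + u + v" for A B C Q u v :: real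
    using that by (simp add: abs_le_iff)
  from this[OF S1 S2 S3] show ?thesis unfolding total .
qed

context stationary_sdde
begin

text \<open>A block weighs at most \<open>b + mesh_max t n\<close> and the blocks of one parity at
  most \<open>To\<close> together, which gives the variance bound \<open>R\<close>. The level
  \<open>u\<close> solves \<open>2 * u\<^sup>2 / R = \<Lambda>\<close>, and the stated threshold is
  \<open>2 * u\<close>, one \<open>u\<close> for each parity.\<close>

lemma mixing_deviation:
  fixes \<Phi> :: "((real^'d, 'b) vec \<Rightarrow> real) set" and t :: "nat \<Rightarrow> real" and n :: nat
  defines "I \<equiv> obs_index \<tau> t n" and "To \<equiv> obs_time \<tau> t n"
  assumes \<Phi>: "finite \<Phi>" "\<And>\<phi>. \<phi> \<in> \<Phi> \<Longrightarrow> \<phi> \<in> borel_measurable borel" "\<And>\<phi> z. \<phi> \<in> \<Phi> \<Longrightarrow> \<phi> z \<in> {0..C}" and C: "0 < C"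
    and grid: "is_grid t n T" and start: "\<exists>k\<le>n. t k = tau_max \<tau>" and horizon: "tau_max \<tau> < T"
    and J: "To \<le> real J" and b: "1 \<le> b" and \<beta>: "0 \<le> \<beta>" "beta_mixing M Z b \<le> \<beta>" and \<Lambda>: "0 \<le> \<Lambda>"
  shows "{\<omega>\<in>space M. \<exists>\<phi>\<in>\<Phi>. \<bar>\<Sum>k\<in>I. mesh t k * (\<phi> (Z (t k) \<omega>) - (\<integral>z. \<phi> z \<partial>\<mu>))\<bar> > C * sqrt (2 * To * (b + mesh_max t n) * \<Lambda>)} \<in> sets M" (is "?B \<in> _")
    and "prob {\<omega>\<in>space M. \<exists>\<phi>\<in>\<Phi>. \<bar>\<Sum>k\<in>I. mesh t k * (\<phi> (Z (t k) \<omega>) - (\<integral>z. \<phi> z \<partial>\<mu>))\<bar> > C * sqrt (2 * To * (b + mesh_max t n) * \<Lambda>)}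
      \<le> real J * \<beta> + 4 * real (card \<Phi>) * exp (- \<Lambda>)"
proof -
  have To: "To = T - tau_max \<tau>" unfolding To_def by (rule obs_time_eq[OF grid start])
  have To0: "0 < To" using horizon To by simp
  have n: "0 < n" using horizon tau_max_nonneg grid by (intro gr0I) (auto simp: is_grid_def)
  have D0: "0 < mesh_max t n" using mesh_pos[OF grid, of 0] mesh_le_mesh_max[of 0 n t] n by linarith
  have I: "finite I" "\<And>k. k \<in> I \<Longrightarrow> k < n \<and> tau_max \<tau> \<le> t k" by (auto simp: I_def obs_index_def)
  have mesh0: "0 \<le> mesh t k" if "k \<in> I" for k using mesh_pos[OF grid] I(2)[OF that] by (simp add: less_imp_le)
  have tT: "t k < T" if "k \<in> I" for k
    using grid_step[OF grid, of k] grid_mono[OF grid, of "Suc k" n] I(2)[OF that] grid by (auto simp: is_grid_def)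
  define blk where "blk i = {k\<in>I. tau_max \<tau> + real i * b \<le> t k \<and> t k < tau_max \<tau> + real (Suc i) * b}" for i
  have finb: "finite (blk i)" for i using I(1) by (simp add: blk_def)
  \<comment> \<open>Since \<open>b\<close> is at least 1 and \<open>To\<close> at most
    \<open>J\<close>, the first \<open>J\<close> blocks of length \<open>b\<close> reach the end of
    the observations.\<close>
  have union: "I = (\<Union>i<J. blk i)"
  proof (intro set_eqI iffI)
    fix k assume k: "k \<in> I"
    define y where "y = (t k - tau_max \<tau>) / b"
    have y0: "0 \<le> y" using I(2)[OF k] b by (simp add: y_def)
    have "y \<le> t k - tau_max \<tau>"
      using I(2)[OF k] b mult_left_mono[of 1 b "t k - tau_max \<tau>"] by (simp add: y_def divide_le_eq)
    also have "\<dots> < real J" using tT[OF k] To J by simp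
    finally have "y < real J" .
    then have "nat \<lfloor>y\<rfloor> < J" using y0 by linarith
    moreover have "real (nat \<lfloor>y\<rfloor>) \<le> y" "y < real (Suc (nat \<lfloor>y\<rfloor>))" using y0 by linarith+
    then have "k \<in> blk (nat \<lfloor>y\<rfloor>)"
      using k b unfolding blk_def y_def by (simp add: le_divide_eq divide_less_eq algebra_simps)
    ultimately show "k \<in> (\<Union>i<J. blk i)" by blast
  qed (auto simp: blk_def)
  have disj: "blk i \<inter> blk j = {}" if "i \<noteq> j" for i j
  proof -
    have "blk i \<inter> blk j = {}" if "i < j" for i j
    proof -
      have "real (Suc i) * b \<le> real j * b" using that b by (intro mult_right_mono) auto
      then show ?thesis unfolding blk_def by fastforce
    qed
    then show ?thesis using that by (metis Int_commute linorder_neqE_nat)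
  qed
  have sumI: "(\<Sum>k\<in>I. f k) = (\<Sum>i<J. \<Sum>k\<in>blk i. f k)" for f :: "nat \<Rightarrow> real"
    unfolding union using finb disj by (intro sum.UNION_disjoint) auto
  define w where "w i = (\<Sum>k\<in>blk i. mesh t k)" for i
  have w0: "0 \<le> w i" for i unfolding w_def using mesh0 by (intro sum_nonneg) (auto simp: blk_def)
  have wb: "w i \<le> b + mesh_max t n" for i
  proof -
    have "w i \<le> (\<Sum>k\<in>{k. k < n \<and> tau_max \<tau> + real i * b \<le> t k \<and> t k < tau_max \<tau> + real (Suc i) * b}. mesh t k)"
      unfolding w_def using I(2) mesh_pos[OF grid] by (intro sum_mono2) (auto simp: blk_def less_imp_le)
    also have "\<dots> \<le> (tau_max \<tau> + real (Suc i) * b) - (tau_max \<tau> + real i * b) + mesh_max t n"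
      using b by (intro mesh_sum_window[OF grid _ n]) (auto intro!: mult_right_mono)
    finally show ?thesis by (simp add: algebra_simps)
  qed
  have wsum: "(\<Sum>i<J. w i) = To" unfolding w_def sumI[symmetric] To_def I_def obs_time_def ..
  have wpar: "(\<Sum>j<(J + 1) div 2. w (2 * j)) \<le> To" "(\<Sum>j<J div 2. w (2 * j + 1)) \<le> To"
    using sum_even_odd[of w J] sum_nonneg[of "{..<(J + 1) div 2}" "\<lambda>j. w (2 * j)"] sum_nonneg[of "{..<J div 2}" "\<lambda>j. w (2 * j + 1)"] w0
    unfolding wsum by auto
  define R where "R = C\<^sup>2 * ((b + mesh_max t n) * To)"
  have R0: "R > 0" unfolding R_def using C b D0 To0 by (intro mult_pos_pos) auto
  define u where "u = C * sqrt ((b + mesh_max t n) * To * \<Lambda> / 2)"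
  have u0: "0 \<le> u" unfolding u_def using C b D0 To0 \<Lambda> by simp
  have uR: "2 * u\<^sup>2 / R = \<Lambda>"
  proof -
    have "u\<^sup>2 = C\<^sup>2 * ((b + mesh_max t n) * To * \<Lambda> / 2)"
      unfolding u_def using b D0 To0 \<Lambda> by (simp add: power_mult_distrib)
    then have "2 * u\<^sup>2 = \<Lambda> * R" unfolding R_def by (simp add: mult_ac)
    then show ?thesis using R0 by simp
  qed
  have u2: "2 * u = C * sqrt (2 * To * (b + mesh_max t n) * \<Lambda>)"
  proof -
    have "sqrt (2 * To * (b + mesh_max t n) * \<Lambda>) = sqrt (2\<^sup>2 * ((b + mesh_max t n) * To * \<Lambda> / 2))"
      by (rule arg_cong[where f = sqrt]) (simp add: power2_eq_square)
    also have "\<dots> = 2 * sqrt ((b + mesh_max t n) * To * \<Lambda> / 2)"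
      by (subst real_sqrt_mult) simp
    finally show ?thesis by (simp add: u_def)
  qed
  define V where "V = (\<lambda>i \<phi> \<omega>. \<Sum>k\<in>blk i. mesh t k * (\<phi> (Z (t k) \<omega>) - (\<integral>z. \<phi> z \<partial>\<mu>)))"
  have termM: "(\<lambda>\<omega>. mesh t k * (\<phi> (Z (t k) \<omega>) - (\<integral>z. \<phi> z \<partial>\<mu>))) \<in> borel_measurable M" if "\<phi> \<in> \<Phi>" "k \<in> I" for k \<phi>
  proof -
    have "0 \<le> t k" using I(2)[OF that(2)] tau_max_nonneg by linarith
    from measurable_compose[OF Z_measurable[OF this] \<Phi>(2)[OF that(1)]] show ?thesis by measurable
  qed
  have VM: "V i \<phi> \<in> borel_measurable M" if "\<phi> \<in> \<Phi>" for i \<phi>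
    unfolding V_def using termM[OF that] by (intro borel_measurable_sum) (simp add: blk_def)
  have evM: "{\<omega>\<in>space M. \<exists>\<phi>\<in>\<Phi>. \<bar>f \<phi> \<omega>\<bar> > a} \<in> sets M" if "\<And>\<phi>. \<phi> \<in> \<Phi> \<Longrightarrow> f \<phi> \<in> borel_measurable M" for f :: "_ \<Rightarrow> 'w \<Rightarrow> real" and a
  proof (rule sets.sets_Collect_finite_Ex[OF _ \<Phi>(1)])
    fix \<phi> assume "\<phi> \<in> \<Phi>"
    note [measurable] = that[OF this]
    show "{\<omega>\<in>space M. \<bar>f \<phi> \<omega>\<bar> > a} \<in> sets M" by measurable
  qed
  show "?B \<in> sets M"
    by (rule evM) (use termM in \<open>auto intro!: borel_measurable_sum\<close>)
  have par: "prob {\<omega>\<in>space M. \<exists>\<phi>\<in>\<Phi>. \<bar>\<Sum>j<m. V (2 * j + pr) \<phi> \<omega>\<bar> > u} \<le> real m * \<beta> + real (card \<Phi>) * (2 * exp (- \<Lambda>))"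
    if m: "(\<Sum>j<m. w (2 * j + pr)) \<le> To" for m pr
  proof -
    have "prob {\<omega>\<in>space M. \<exists>\<phi>\<in>\<Phi>. \<bar>\<Sum>j<m. \<Sum>k\<in>blk (2 * j + pr). mesh t k * (\<phi> (Z (t k) \<omega>) - (\<integral>z. \<phi> z \<partial>\<mu>))\<bar> > u}
      \<le> real m * \<beta> + real (card \<Phi>) * (2 * exp (- 2 * u\<^sup>2 / R))"
    proof (rule block_deviation[where \<Phi> = \<Phi> and C = C and I = I and m = m and blk = "\<lambda>j. blk (2 * j + pr)" and t = t
        and w = "mesh t" and \<beta> = \<beta> and b = b and R = R and u = u
        and lo = "\<lambda>j. tau_max \<tau> + real (2 * j + pr) * b" and hi = "\<lambda>j. tau_max \<tau> + real (Suc (2 * j + pr)) * b"])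
      show "k \<in> I \<and> tau_max \<tau> + real (2 * j + pr) * b \<le> t k \<and> t k \<le> tau_max \<tau> + real (Suc (2 * j + pr)) * b"
        if "k \<in> blk (2 * j + pr)" for j k
        using that by (auto simp: blk_def)
      show "0 \<le> tau_max \<tau> + real (2 * j + pr) * b" "0 \<le> tau_max \<tau> + real (Suc (2 * j + pr)) * b" for j
        using tau_max_nonneg b by (auto intro!: add_nonneg_nonneg mult_nonneg_nonneg)
      \<comment> \<open>Between two consecutive blocks of one parity lies a block of the other,
        which provides the lag \<open>b\<close>.\<close>
      show "tau_max \<tau> + real (Suc (2 * i + pr)) * b + b \<le> tau_max \<tau> + real (2 * j + pr) * b" if "i < j" for i j
      proof -
        have "real (Suc (Suc (2 * i + pr))) * b \<le> real (2 * j + pr) * b" using that b by (intro mult_right_mono) auto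
        then show ?thesis by (simp add: algebra_simps)
      qed
      show "tau_max \<tau> + real (Suc (2 * i + pr)) * b \<le> tau_max \<tau> + real (Suc (2 * j + pr)) * b" if "i \<le> j" for i j
        using that b by (intro add_left_mono mult_right_mono) auto
      show "0 < b" using b by simp
      \<comment> \<open>One factor of the squared weight is bounded by the largest block, the other
        is kept and summed to at most \<open>To\<close>.\<close>
      have "(\<Sum>j<m. (w (2 * j + pr) * C)\<^sup>2) \<le> (\<Sum>j<m. C\<^sup>2 * ((b + mesh_max t n) * w (2 * j + pr)))"
      proof (rule sum_mono)
        fix j
        have "w (2 * j + pr) * w (2 * j + pr) \<le> (b + mesh_max t n) * w (2 * j + pr)"
          by (rule mult_right_mono[OF wb w0])
        then have "C\<^sup>2 * (w (2 * j + pr) * w (2 * j + pr)) \<le> C\<^sup>2 * ((b + mesh_max t n) * w (2 * j + pr))"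
          by (rule mult_left_mono) simp
        then show "(w (2 * j + pr) * C)\<^sup>2 \<le> C\<^sup>2 * ((b + mesh_max t n) * w (2 * j + pr))"
          by (simp add: power2_eq_square mult_ac)
      qed
      also have "\<dots> = C\<^sup>2 * ((b + mesh_max t n) * (\<Sum>j<m. w (2 * j + pr)))" by (simp add: sum_distrib_left)
      also have "\<dots> \<le> R" unfolding R_def using m b D0 by (intro mult_left_mono) auto
      finally show "(\<Sum>j<m. ((\<Sum>k\<in>blk (2 * j + pr). mesh t k) * C)\<^sup>2) \<le> R" unfolding w_def .
    qed (rule \<Phi> I(1) mesh0 \<beta> R0 u0 | assumption)+
    moreover have "- 2 * u\<^sup>2 / R = - \<Lambda>" using uR by simp
    ultimately show ?thesis unfolding V_def by simp
  qed
  define B0 where "B0 = {\<omega>\<in>space M. \<exists>\<phi>\<in>\<Phi>. \<bar>\<Sum>j<(J + 1) div 2. V (2 * j + 0) \<phi> \<omega>\<bar> > u}"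
  define B1 where "B1 = {\<omega>\<in>space M. \<exists>\<phi>\<in>\<Phi>. \<bar>\<Sum>j<J div 2. V (2 * j + 1) \<phi> \<omega>\<bar> > u}"
  have BM: "B0 \<in> sets M" "B1 \<in> sets M"
    unfolding B0_def B1_def by (rule evM; use VM in \<open>auto intro!: borel_measurable_sum\<close>)+
  have "?B
    \<subseteq> B0 \<union> B1"
  proof
    fix \<omega> assume "\<omega> \<in> ?B"
    then obtain \<phi> where \<omega>: "\<omega> \<in> space M" and \<phi>: "\<phi> \<in> \<Phi>" and big: "\<bar>\<Sum>i<J. V i \<phi> \<omega>\<bar> > 2 * u"
      unfolding u2 V_def sumI by blast
    have "\<bar>\<Sum>j<(J + 1) div 2. V (2 * j + 0) \<phi> \<omega>\<bar> > u \<or> \<bar>\<Sum>j<J div 2. V (2 * j + 1) \<phi> \<omega>\<bar> > u"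
      using big unfolding sum_even_odd[of "\<lambda>i. V i \<phi> \<omega>"] by auto
    then show "\<omega> \<in> B0 \<union> B1" using \<omega> \<phi> unfolding B0_def B1_def by blast
  qed
  then have "prob ?B
    \<le> prob (B0 \<union> B1)" using BM by (intro finite_measure_mono) auto
  also have "\<dots> \<le> prob B0 + prob B1" by (rule measure_Un_le[OF BM])
  also have "\<dots> \<le> (real ((J + 1) div 2) * \<beta> + real (card \<Phi>) * (2 * exp (- \<Lambda>))) + (real (J div 2) * \<beta> + real (card \<Phi>) * (2 * exp (- \<Lambda>)))"
    unfolding B0_def B1_def using wpar by (intro add_mono par) auto
  also have "\<dots> = real ((J + 1) div 2 + J div 2) * \<beta> + 4 * real (card \<Phi>) * exp (- \<Lambda>)"
    by (simp add: algebra_simps)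
  \<comment> \<open>Together the two parities pay for exactly \<open>J\<close> mixing coefficients;
    \<open>J\<close> is also the factor inside the logarithm defining \<open>b\<close>.\<close>
  also have "(J + 1) div 2 + J div 2 = J" by presburger
  finally show "prob ?B
      \<le> real J * \<beta> + 4 * real (card \<Phi>) * exp (- \<Lambda>)" .
qed

text \<open>The Chernoff bound divides by the variance proxy of the noise term, so the proxy has to
  be positive; an operator norm zero would make \<open>S\<close> vanish.\<close>

lemma op_norm_pos:
  assumes "invertible S"
  shows "0 < op_norm S"
proof (rule ccontr)
  assume "\<not> 0 < op_norm S"
  then have "op_norm S \<le> 0" by simp
  moreover have "norm (S *v v) \<le> op_norm S * norm v" for v
    unfolding op_norm_def by (rule onorm[OF matrix_vector_mul_bounded_linear])
  ultimately have "norm (S *v v) \<le> 0" for v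
    by (meson mult_nonpos_nonneg norm_ge_zero order_trans)
  then have "S *v v = 0" for v by simp
  moreover obtain S' where "S' ** S = mat 1" using assms by (auto simp: invertible_def)
  ultimately have "v = 0" for v :: "real^'d"
    by (metis matrix_vector_mul_assoc matrix_vector_mul_lid matrix_vector_mult_0_right)
  from this[of "axis undefined 1"] show False by (simp add: axis_eq_0_iff)
qed

text \<open>The threshold is chosen so that its square equals \<open>2 * \<Lambda>\<close> times the
  variance proxy; every function then contributes \<open>2 * exp (- \<Lambda>)\<close> to the union
  bound.\<close>

lemma martingale_deviation:
  fixes \<Phi> :: "((real^'d, 'b) vec \<Rightarrow> real^'d) set" and t :: "nat \<Rightarrow> real" and n :: nat
  defines "I \<equiv> obs_index \<tau> t n" and "To \<equiv> obs_time \<tau> t n"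
  assumes \<Phi>: "finite \<Phi>" "\<And>\<phi>. \<phi> \<in> \<Phi> \<Longrightarrow> \<phi> \<in> borel_measurable borel" "\<And>\<phi> z. \<phi> \<in> \<Phi> \<Longrightarrow> norm (\<phi> z) \<le> E" and E: "0 < E"
    and grid: "is_grid t n T" and To0: "0 < To" and inv: "invertible S" and \<Lambda>: "0 \<le> \<Lambda>"
  shows "{\<omega>\<in>space M. \<exists>\<phi>\<in>\<Phi>. \<bar>\<Sum>k\<in>I. (S *v (W (t (Suc k)) \<omega> - W (t k) \<omega>)) \<bullet> \<phi> (Z (t k) \<omega>)\<bar> > op_norm S * E * sqrt (2 * To * \<Lambda>)} \<in> sets M" (is "?B \<in> _")
    and "prob {\<omega>\<in>space M. \<exists>\<phi>\<in>\<Phi>. \<bar>\<Sum>k\<in>I. (S *v (W (t (Suc k)) \<omega> - W (t k) \<omega>)) \<bullet> \<phi> (Z (t k) \<omega>)\<bar> > op_norm S * E * sqrt (2 * To * \<Lambda>)}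
      \<le> 2 * real (card \<Phi>) * exp (- \<Lambda>)"
proof -
  define v where "v = (op_norm S * E)\<^sup>2 * To"
  define u where "u = op_norm S * E * sqrt (2 * To * \<Lambda>)"
  have v: "0 < v" using op_norm_pos[OF inv] E To0 by (simp add: v_def)
  have u: "0 \<le> u" using op_norm_pos[OF inv] E To0 \<Lambda> by (simp add: u_def)
  have uv: "- u\<^sup>2 / (2 * v) = - \<Lambda>"
  proof -
    have "u\<^sup>2 = (op_norm S * E)\<^sup>2 * (2 * To * \<Lambda>)"
      unfolding u_def using To0 \<Lambda> by (simp add: power_mult_distrib)
    then have "u\<^sup>2 = \<Lambda> * (2 * v)" unfolding v_def by simp
    then show ?thesis using v by simp
  qed
  define L where "L = (\<lambda>\<phi> \<omega>. \<Sum>k\<in>I. (S *v (W (t (Suc k)) \<omega> - W (t k) \<omega>)) \<bullet> \<phi> (Z (t k) \<omega>))"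
  have I: "I = {k\<in>I. k < n}" by (auto simp: I_def obs_index_def)
  have LM: "L \<phi> \<in> borel_measurable M" if "\<phi> \<in> \<Phi>" for \<phi>
    unfolding L_def
  proof (rule borel_measurable_sum)
    fix k assume "k \<in> I"
    then have k: "0 \<le> t k" "0 \<le> t (Suc k)" using grid_nonneg[OF grid] by (auto simp: I_def obs_index_def)
    have "(\<lambda>\<omega>. S *v (W (t (Suc k)) \<omega> - W (t k) \<omega>)) \<in> borel_measurable M"
      by (rule borel_measurable_continuous_on[OF matrix_vector_mult_linear_continuous_on borel_measurable_diff[OF W_measurable[OF k(2)] W_measurable[OF k(1)]]])
    moreover have "(\<lambda>\<omega>. \<phi> (Z (t k) \<omega>)) \<in> borel_measurable M"
      by (rule measurable_compose[OF Z_measurable[OF k(1)] \<Phi>(2)[OF that]])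
    ultimately show "(\<lambda>\<omega>. (S *v (W (t (Suc k)) \<omega> - W (t k) \<omega>)) \<bullet> \<phi> (Z (t k) \<omega>)) \<in> borel_measurable M"
      by (rule borel_measurable_inner)
  qed
  have ev: "{\<omega>\<in>space M. \<bar>L \<phi> \<omega>\<bar> > u} \<in> sets M" if "\<phi> \<in> \<Phi>" for \<phi>
  proof -
    note [measurable] = LM[OF that]
    show ?thesis by measurable
  qed
  have one: "prob {\<omega>\<in>space M. \<bar>L \<phi> \<omega>\<bar> > u} \<le> 2 * exp (- \<Lambda>)" if "\<phi> \<in> \<Phi>" for \<phi>
    unfolding uv[symmetric]
  proof (rule chernoff_two_sided[OF LM[OF that] _ v u])
    fix \<theta>
    have "(\<integral>\<^sup>+\<omega>. ennreal (exp (\<theta> * (\<Sum>k\<in>{k\<in>I. k < n}. (S *v (W (t (Suc k)) \<omega> - W (t k) \<omega>)) \<bullet> \<phi> (Z (t k) \<omega>)))) \<partial>M)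
    \<le> ennreal (exp (\<theta>\<^sup>2 * ((op_norm S * E)\<^sup>2 * (\<Sum>k\<in>{k\<in>I. k < n}. mesh t k)) / 2))"
      using grid_nonneg[OF grid] grid_step[OF grid] by (intro martingale_mgf \<Phi>(2,3) that) auto
    then show "(\<integral>\<^sup>+\<omega>. ennreal (exp (\<theta> * L \<phi> \<omega>)) \<partial>M) \<le> ennreal (exp (\<theta>\<^sup>2 * v / 2))"
      unfolding I[symmetric] L_def v_def To_def obs_time_def I_def[symmetric] .
  qed
  have eq: "{\<omega>\<in>space M. \<exists>\<phi>\<in>\<Phi>. \<bar>L \<phi> \<omega>\<bar> > u} = (\<Union>\<phi>\<in>\<Phi>. {\<omega>\<in>space M. \<bar>L \<phi> \<omega>\<bar> > u})" by blast
  have "{\<omega>\<in>space M. \<exists>\<phi>\<in>\<Phi>. \<bar>L \<phi> \<omega>\<bar> > u} \<in> sets M"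
    unfolding eq by (rule sets.finite_UN[OF \<Phi>(1) ev])
  then show "?B \<in> sets M"
    unfolding L_def u_def .
  have "prob {\<omega>\<in>space M. \<exists>\<phi>\<in>\<Phi>. \<bar>L \<phi> \<omega>\<bar> > u} \<le> (\<Sum>\<phi>\<in>\<Phi>. prob {\<omega>\<in>space M. \<bar>L \<phi> \<omega>\<bar> > u})"
    unfolding eq by (rule measure_UNION_le[OF \<Phi>(1) ev])
  also have "\<dots> \<le> (\<Sum>\<phi>\<in>\<Phi>. 2 * exp (- \<Lambda>))" by (rule sum_mono[OF one])
  finally show "prob ?B
      \<le> 2 * real (card \<Phi>) * exp (- \<Lambda>)"
    unfolding L_def u_def by simp
qed

text \<open>A first-moment bound suffices for the total length of the noise increments, because it
  enters \<open>eps_n\<close> multiplied by the net radius.\<close>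

lemma noise_deviation:
  fixes t :: "nat \<Rightarrow> real" and n :: nat
  defines "I \<equiv> obs_index \<tau> t n"
  assumes grid: "is_grid t n T" and \<eta>: "0 < \<eta>"
  shows "{\<omega>\<in>space M. (\<Sum>k\<in>I. norm (S *v (W (t (Suc k)) \<omega> - W (t k) \<omega>))) > frob_norm S / \<eta> * (\<Sum>k\<in>I. sqrt (mesh t k))} \<in> sets M" (is "?B \<in> _")
    and "prob {\<omega>\<in>space M. (\<Sum>k\<in>I. norm (S *v (W (t (Suc k)) \<omega> - W (t k) \<omega>))) > frob_norm S / \<eta> * (\<Sum>k\<in>I. sqrt (mesh t k))} \<le> \<eta>"
proof -
  define f where "f \<omega> = (\<Sum>k\<in>I. ennreal (norm (S *v (W (t (Suc k)) \<omega> - W (t k) \<omega>))))" for \<omega>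
  define a where "a = frob_norm S * (\<Sum>k\<in>I. sqrt (mesh t k))"
  have kI: "k < n" "0 \<le> t k" "t k < t (Suc k)" if "k \<in> I" for k
    using that grid_nonneg[OF grid] grid_step[OF grid] by (auto simp: I_def obs_index_def)
  have termM: "(\<lambda>\<omega>. norm (S *v (W (t (Suc k)) \<omega> - W (t k) \<omega>))) \<in> borel_measurable M" if "k \<in> I" for k
  proof -
    have k: "0 \<le> t k" "0 \<le> t (Suc k)" using kI[OF that] by auto
    have "(\<lambda>\<omega>. S *v (W (t (Suc k)) \<omega> - W (t k) \<omega>)) \<in> borel_measurable M"
      by (rule borel_measurable_continuous_on[OF matrix_vector_mult_linear_continuous_on borel_measurable_diff[OF W_measurable[OF k(2)] W_measurable[OF k(1)]]])
    then show ?thesis by measurable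
  qed
  have tM: "(\<lambda>\<omega>. ennreal (norm (S *v (W (t (Suc k)) \<omega> - W (t k) \<omega>)))) \<in> borel_measurable M" if "k \<in> I" for k
    using termM[OF that] by measurable
  have fM: "f \<in> borel_measurable M" unfolding f_def[abs_def] by (rule borel_measurable_sum[OF tM])
  have frob: "0 \<le> frob_norm S"
    unfolding frob_norm_def trace_def matrix_matrix_mult_def transpose_def
    by (intro real_sqrt_ge_zero sum_nonneg) (simp add: sum_nonneg)
  have a0: "0 \<le> a" unfolding a_def using frob mesh_pos[OF grid] kI(1) by (intro mult_nonneg_nonneg sum_nonneg) (auto simp: less_imp_le)
  have "(\<integral>\<^sup>+\<omega>. f \<omega> \<partial>M) = (\<Sum>k\<in>I. \<integral>\<^sup>+\<omega>. ennreal (norm (S *v (W (t (Suc k)) \<omega> - W (t k) \<omega>))) \<partial>M)"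
    unfolding f_def using tM by (rule nn_integral_sum)
  also have "\<dots> \<le> (\<Sum>k\<in>I. ennreal (frob_norm S * sqrt (mesh t k)))"
    unfolding mesh_def by (intro sum_mono noise_increment_norm kI)
  also have "\<dots> = ennreal a"
    unfolding a_def sum_distrib_left using frob mesh_pos[OF grid] kI(1) by (intro sum_ennreal) (auto simp: less_imp_le)
  finally have "prob {\<omega>\<in>space M. f \<omega> > ennreal (a / \<eta>)} \<le> \<eta>" by (rule markov_ennreal[OF fM a0 \<eta>])
  moreover have eq: "?B
    = {\<omega>\<in>space M. f \<omega> > ennreal (a / \<eta>)}"
  proof -
    have "f \<omega> = ennreal (\<Sum>k\<in>I. norm (S *v (W (t (Suc k)) \<omega> - W (t k) \<omega>)))" for \<omega>
      unfolding f_def by (rule sum_ennreal) simp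
    moreover have "a / \<eta> = frob_norm S / \<eta> * (\<Sum>k\<in>I. sqrt (mesh t k))" by (simp add: a_def)
    moreover have "0 \<le> a / \<eta>" using a0 \<eta> by simp
    ultimately show ?thesis by (auto simp: ennreal_less_iff)
  qed
  ultimately show "prob ?B \<le> \<eta>"
    by simp
  show "?B \<in> sets M"
    unfolding eq using fM by measurable
qed

lemma drift_modulus_nonneg:
  assumes L2: "integrable M (\<lambda>\<omega>. (norm (G (Z 0 \<omega>)))\<^sup>2)" and "0 \<le> h"
  shows "0 \<le> drift_modulus M Z G h"
proof -
  have "0 \<le> sqrt (expectation (\<lambda>\<omega>. (norm (G (Z (0 + 0) \<omega>) - G (Z 0 \<omega>)))\<^sup>2))" by simp
  also have "\<dots> \<le> drift_modulus M Z G h"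
    by (rule drift_increment_moment(2)[OF L2 order_refl order_refl assms(2)])
  finally show ?thesis .
qed

text \<open>The weight \<open>e\<close> will be the class diameter, which dominates the distance of
  every drift of the class to \<open>G\<close>. A single event thus serves the whole class, without
  any net.\<close>

lemma bias_deviation:
  fixes t :: "nat \<Rightarrow> real" and n :: nat and \<eta> :: real and e :: "(real^'d, 'b) vec \<Rightarrow> real"
  defines "I \<equiv> obs_index \<tau> t n"
  defines "\<Xi> \<equiv> (\<lambda>\<omega>. \<Sum>k\<in>I. \<integral>\<^sup>+r\<in>{t k..t (Suc k)}. ennreal (norm (G (Z r \<omega>) - G (Z (t k) \<omega>)) * e (Z (t k) \<omega>)) \<partial>lborel)"
  defines "a \<equiv> sqrt (\<integral>z. (e z)\<^sup>2 \<partial>\<mu>) * obs_time \<tau> t n / \<eta> * drift_modulus M Z G (mesh_max t n)"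
  assumes L2: "integrable M (\<lambda>\<omega>. (norm (G (Z 0 \<omega>)))\<^sup>2)"
    and e: "e \<in> borel_measurable borel" and e0: "\<And>z. 0 \<le> e z" and e2: "integrable \<mu> (\<lambda>z. (e z)\<^sup>2)"
    and grid: "is_grid t n T" and n: "0 < n" and \<eta>: "0 < \<eta>"
  shows "0 \<le> a" and "{\<omega>\<in>space M. \<Xi> \<omega> > ennreal a} \<in> sets M" and "prob {\<omega>\<in>space M. \<Xi> \<omega> > ennreal a} \<le> \<eta>"
proof -
  have kI: "k < n" "0 \<le> t k" "t k \<le> t (Suc k)" "t (Suc k) - t k \<le> mesh_max t n" "0 \<le> mesh t k" if "k \<in> I" for k
    using that grid_nonneg[OF grid] grid_step[OF grid, of k] mesh_le_mesh_max[of k n t]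
    by (auto simp: I_def obs_index_def mesh_def)
  define c where "c = drift_modulus M Z G (mesh_max t n) * sqrt (\<integral>z. (e z)\<^sup>2 \<partial>\<mu>)"
  have "0 \<le> mesh_max t n" using mesh_pos[OF grid n] mesh_le_mesh_max[OF n, of t] by linarith
  then have c0: "0 \<le> c" unfolding c_def using drift_modulus_nonneg[OF L2] by simp
  have To0: "0 \<le> obs_time \<tau> t n" unfolding obs_time_def using kI(5) by (intro sum_nonneg) (simp add: I_def)
  have a: "a = obs_time \<tau> t n * c / \<eta>" unfolding a_def c_def by simp
  have ToC: "0 \<le> obs_time \<tau> t n * c" using To0 c0 by simp
  then show "0 \<le> a" using a \<eta> by simp
  have inner: "(\<lambda>\<omega>. \<integral>\<^sup>+r\<in>{t k..t (Suc k)}. ennreal (norm (G (Z r \<omega>) - G (Z (t k) \<omega>)) * e (Z (t k) \<omega>)) \<partial>lborel) \<in> borel_measurable M"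
    if "k \<in> I" for k
    by (rule bias_moment(1)[OF L2 e e0 e2 kI(2,3,4)[OF that]])
  have \<Xi>M: "\<Xi> \<in> borel_measurable M"
    unfolding \<Xi>_def by (intro borel_measurable_sum inner)
  then show "{\<omega>\<in>space M. \<Xi> \<omega> > ennreal a} \<in> sets M" by measurable
  have "(\<integral>\<^sup>+\<omega>. \<Xi> \<omega> \<partial>M) = (\<Sum>k\<in>I. \<integral>\<^sup>+\<omega>. (\<integral>\<^sup>+r\<in>{t k..t (Suc k)}. ennreal (norm (G (Z r \<omega>) - G (Z (t k) \<omega>)) * e (Z (t k) \<omega>)) \<partial>lborel) \<partial>M)"
    unfolding \<Xi>_def by (intro nn_integral_sum inner)
  also have "\<dots> \<le> (\<Sum>k\<in>I. ennreal (mesh t k * c))"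
    unfolding mesh_def c_def
  proof (rule sum_mono)
    fix k assume "k \<in> I"
    from kI(2,3,4)[OF this]
    show "(\<integral>\<^sup>+\<omega>. (\<integral>\<^sup>+r\<in>{t k..t (Suc k)}. ennreal (norm (G (Z r \<omega>) - G (Z (t k) \<omega>)) * e (Z (t k) \<omega>)) \<partial>lborel) \<partial>M)
      \<le> ennreal ((t (Suc k) - t k) * (drift_modulus M Z G (mesh_max t n) * sqrt (\<integral>z. (e z)\<^sup>2 \<partial>\<mu>)))"
      by (rule bias_moment(2)[OF L2 e e0 e2])
  qed
  also have "\<dots> = ennreal (obs_time \<tau> t n * c)"
    unfolding obs_time_def I_def[symmetric] sum_distrib_right using kI(5) c0 by (intro sum_ennreal) simp
  finally show "prob {\<omega>\<in>space M. \<Xi> \<omega> > ennreal a} \<le> \<eta>"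
    unfolding a by (rule markov_ennreal[OF \<Xi>M ToC \<eta>])
qed

end


section \<open>The uniform deviation inequality\<close>

text \<open>Every point lies in some ball of radius at least 1, on which a finite net makes the
  supremum defining the diameter a bounded one.\<close>

lemma class_diam_pointwise:
  fixes H :: "('d::finite, 'b::finite) hyp_class"
  assumes adm: "admissible_class H" and nets: "\<forall>r\<ge>1. \<forall>e>0. \<exists>A. internal_net H (K_ball c r) e A"
    and "g \<in> fst ` H" "g' \<in> fst ` H"
  shows "norm (g z - g' z) \<le> class_diam H z"
proof -
  define r where "r = max 1 (norm (z - (\<chi> a. c)))"
  obtain A where A: "internal_net H (K_ball c r) 1 A"
    using nets by (metis max.cobounded1 r_def zero_less_one)
  have "z \<in> K_ball c r" by (simp add: K_ball_def r_def)
  from class_diam_upper[OF A adm assms(3,4) this] show ?thesis .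
qed

lemma covering_number_net:
  assumes "internal_net H K e A"
  obtains B where "internal_net H K e B" "card B = covering_number H K e"
proof -
  have "\<exists>k B. internal_net H K e B \<and> card B = k" using assms by blast
  then have "\<exists>B. internal_net H K e B \<and> card B = covering_number H K e"
    unfolding covering_number_def by (rule LeastI_ex)
  then show thesis using that by blast
qed

text \<open>The population side of truncation and net. Inside \<open>K\<close> the exchange costs
  \<open>2 * E * \<epsilon>\<close> since the total mass is 1; outside \<open>K\<close> the
  truncated function is zero, and what is lost is at most the square of the envelope
  \<open>e\<close>.\<close>

lemma truncated_risk_difference:
  assumes "prob_space \<mu>" and sets_\<mu>: "sets \<mu> = sets borel"
    and meas: "g \<in> borel_measurable borel" "g' \<in> borel_measurable borel" "G \<in> borel_measurable borel" "e \<in> borel_measurable borel"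
    and K: "K \<in> sets borel" and int: "integrable \<mu> (\<lambda>z. (norm (g z - G z :: 'c::euclidean_space))\<^sup>2)" "integrable \<mu> (\<lambda>z. (e z)\<^sup>2)"
    and E: "\<And>z. z \<in> K \<Longrightarrow> norm (g z - G z) \<le> E" "\<And>z. z \<in> K \<Longrightarrow> norm (g' z - G z) \<le> E"
    and net: "\<And>z. z \<in> K \<Longrightarrow> norm (g z - g' z) \<le> \<epsilon>" and \<epsilon>: "0 \<le> \<epsilon>" and E0: "0 \<le> E"
    and e: "\<And>z. norm (g z - G z) \<le> e z"
  shows "\<bar>L2_dist_sq \<mu> g G - (\<integral>z. indicator K z * (norm (g' z - G z))\<^sup>2 \<partial>\<mu>)\<bar> \<le> 2 * E * \<epsilon> + (LINT z:- K|\<mu>. (e z)\<^sup>2)"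
proof -
  interpret prob_space \<mu> by fact
  note [measurable] = meas K
  have cong [measurable_cong]: "sets \<mu> = sets borel" by (rule sets_\<mu>)
  have sp: "space \<mu> = UNIV" using sets_eq_imp_space_eq[OF sets_\<mu>] by simp
  have i1: "integrable \<mu> (\<lambda>z. indicator K z * (norm (g z - G z))\<^sup>2)"
    by (rule Bochner_Integration.integrable_bound[OF int(1)]) (auto simp: indicator_def)
  have i2: "integrable \<mu> (\<lambda>z. indicator (- K) z * (norm (g z - G z))\<^sup>2)"
    by (rule Bochner_Integration.integrable_bound[OF int(1)]) (auto simp: indicator_def)
  have i3: "integrable \<mu> (\<lambda>z. indicator K z * (norm (g' z - G z))\<^sup>2)"
    by (rule integrable_const_bound[where B = "E\<^sup>2"]) (use E(2) in \<open>auto simp: indicator_def intro!: power_mono\<close>)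
  have i4: "integrable \<mu> (\<lambda>z. indicator (- K) z * (e z)\<^sup>2)"
    by (rule Bochner_Integration.integrable_bound[OF int(2)]) (auto simp: indicator_def)
  have split: "L2_dist_sq \<mu> g G = (\<integral>z. indicator K z * (norm (g z - G z))\<^sup>2 \<partial>\<mu>) + (\<integral>z. indicator (- K) z * (norm (g z - G z))\<^sup>2 \<partial>\<mu>)"
    unfolding L2_dist_sq_def Bochner_Integration.integral_add[OF i1 i2, symmetric]
    by (intro Bochner_Integration.integral_cong refl) (auto simp: indicator_def)
  have out: "(\<integral>z. indicator (- K) z * (norm (g z - G z))\<^sup>2 \<partial>\<mu>) \<le> (LINT z:- K|\<mu>. (e z)\<^sup>2)"
    unfolding set_lebesgue_integral_def real_scaleR_def
    using e by (intro integral_mono i2 i4 mult_left_mono power_mono) auto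
  have out0: "0 \<le> (\<integral>z. indicator (- K) z * (norm (g z - G z))\<^sup>2 \<partial>\<mu>)" by simp
  have diff: "\<bar>(norm (g z - G z))\<^sup>2 - (norm (g' z - G z))\<^sup>2\<bar> \<le> 2 * E * \<epsilon>" if z: "z \<in> K" for z
    using E[OF z] net[OF z] by (intro abs_norm_square_diff_le) simp_all
  have "\<bar>(\<integral>z. indicator K z * (norm (g z - G z))\<^sup>2 \<partial>\<mu>) - (\<integral>z. indicator K z * (norm (g' z - G z))\<^sup>2 \<partial>\<mu>)\<bar>
    = \<bar>\<integral>z. indicator K z * (norm (g z - G z))\<^sup>2 - indicator K z * (norm (g' z - G z))\<^sup>2 \<partial>\<mu>\<bar>"
    using i1 i3 by simp
  also have "\<dots> \<le> (\<integral>z. \<bar>indicator K z * (norm (g z - G z))\<^sup>2 - indicator K z * (norm (g' z - G z))\<^sup>2\<bar> \<partial>\<mu>)"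
    by (rule integral_abs_bound)
  also have "\<dots> \<le> (\<integral>z. 2 * E * \<epsilon> \<partial>\<mu>)"
  proof (rule integral_mono)
    show "\<bar>indicator K z * (norm (g z - G z))\<^sup>2 - indicator K z * (norm (g' z - G z))\<^sup>2\<bar> \<le> 2 * E * \<epsilon>" for z
      using diff[of z] E0 \<epsilon> by (cases "z \<in> K") auto
  qed (use i1 i3 in auto)
  finally have "\<bar>(\<integral>z. indicator K z * (norm (g z - G z))\<^sup>2 \<partial>\<mu>) - (\<integral>z. indicator K z * (norm (g' z - G z))\<^sup>2 \<partial>\<mu>)\<bar> \<le> 2 * E * \<epsilon>"
    by (simp add: prob_space)
  moreover have "\<bar>a + b - c\<bar> \<le> x + y" if "\<bar>a - c\<bar> \<le> x" "0 \<le> b" "b \<le> y" for a b c x y :: real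
    using that by linarith
  ultimately show ?thesis unfolding split using out out0 by blast
qed

context stationary_sdde
begin

lemma law_prob_space: "prob_space \<mu>"
  unfolding Z_law[OF order_refl, symmetric] by (rule prob_space_distr) (rule Z_measurable, simp)

lemma sets_law: "sets \<mu> = sets borel"
  unfolding Z_law[OF order_refl, symmetric] by simp

lemma measurable_law: "f \<in> borel_measurable \<mu> \<longleftrightarrow> f \<in> borel_measurable borel"
  using measurable_cong_sets[OF sets_law refl] by blast

lemma emp_risk_Z:
  "emp_risk \<tau> t n (\<lambda>r. X r \<omega>) g = (\<Sum>k\<in>obs_index \<tau> t n.
     mesh t k * (norm ((X (t (Suc k)) \<omega> - X (t k) \<omega>) /\<^sub>R mesh t k - g (Z (t k) \<omega>)))\<^sup>2)"
  unfolding emp_risk_def Z_def ..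

text \<open>The event is the preimage of a set of finitely many observations that is closed, since it is
  an intersection of closed sets over the possibly uncountable class.\<close>

lemma uniform_event_measurable:
  assumes adm: "admissible_class H" and grid: "is_grid t n T"
  shows "{\<omega>\<in>space M. (SUP (g, m)\<in>H. ereal \<bar>(emp_risk \<tau> t n (\<lambda>r. X r \<omega>) g - emp_risk \<tau> t n (\<lambda>r. X r \<omega>) G) - R g\<bar>) \<le> ereal eps} \<in> sets M"
proof -
  let ?I = "obs_index \<tau> t n"
  \<comment> \<open>Indices without an observation carry the default 0, so that the data form one
    point of a countable product space, where measurability is checked coordinatewise.\<close>
  define D where "D \<omega> k = (if k \<in> ?I then X (t (Suc k)) \<omega> - X (t k) \<omega> else 0)" for \<omega> k
  define V where "V \<omega> k = (if k \<in> ?I then Z (t k) \<omega> else 0)" for \<omega> k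
  define Y where "Y \<omega> k = (D \<omega> k, V \<omega> k)" for \<omega> k
  have kI: "0 \<le> t k" "0 \<le> t (Suc k)" if "k \<in> ?I" for k
    using that grid_nonneg[OF grid] by (auto simp: obs_index_def)
  have XM: "X r \<in> borel_measurable M" if "0 \<le> r" for r
    using measurable_from_subalg[OF filtration(1)[OF that] X_adapted[of r r]] that tau_max_nonneg by simp
  have Y: "Y \<in> borel_measurable M"
  proof (rule measurable_coordinatewise_then_product)
    fix k
    show "(\<lambda>\<omega>. Y \<omega> k) \<in> borel_measurable M"
    proof (cases "k \<in> ?I")
      case True
      note [measurable] = XM[OF kI(1)[OF True]] XM[OF kI(2)[OF True]] Z_measurable[OF kI(1)[OF True]]
      show ?thesis unfolding Y_def D_def V_def using True by simp
    next
      case False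
      then show ?thesis unfolding Y_def D_def V_def by simp
    qed
  qed
  define r where "r g y = (\<Sum>k\<in>?I. mesh t k * (norm (fst (y k) /\<^sub>R mesh t k - g (snd (y k))))\<^sup>2)"
    for g :: "(real^'d, 'b) vec \<Rightarrow> real^'d" and y :: "nat \<Rightarrow> (real^'d) \<times> (real^'d, 'b) vec"
  have r_cont: "continuous_on UNIV (r g)" if "continuous_on UNIV g" for g
    unfolding r_def
  proof (intro continuous_on_sum continuous_on_mult continuous_on_power continuous_on_norm continuous_on_diff continuous_on_scaleR continuous_on_const)
    fix k
    have c: "continuous_on UNIV (\<lambda>y :: nat \<Rightarrow> (real^'d) \<times> (real^'d, 'b) vec. y k)"
      by (rule continuous_on_product_coordinates)
    show "continuous_on UNIV (\<lambda>y :: nat \<Rightarrow> (real^'d) \<times> (real^'d, 'b) vec. fst (y k))"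
      by (rule continuous_on_fst[OF c])
    show "continuous_on UNIV (\<lambda>y :: nat \<Rightarrow> (real^'d) \<times> (real^'d, 'b) vec. g (snd (y k)))"
      by (rule continuous_on_compose2[OF that continuous_on_snd[OF c]]) simp
  qed
  have emp: "emp_risk \<tau> t n (\<lambda>r. X r \<omega>) g = r g (Y \<omega>)" for g \<omega>
    unfolding emp_risk_Z r_def Y_def D_def V_def by (intro sum.cong refl) simp
  define C where "C = (\<Inter>p\<in>H. {y. \<bar>(r (fst p) y - r G y) - R (fst p)\<bar> \<le> eps})"
  have "closed C"
    unfolding C_def
  proof (intro closed_INT ballI)
    fix p assume "p \<in> H"
    then have "continuous_on UNIV (r (fst p))" by (intro r_cont class_continuous[OF adm]) auto
    then show "closed {y. \<bar>(r (fst p) y - r G y) - R (fst p)\<bar> \<le> eps}"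
      using r_cont[OF drift_continuous] by (intro closed_Collect_le continuous_intros)
  qed
  then have "Y -` C \<inter> space M \<in> sets M" by (intro measurable_sets[OF Y] borel_closed)
  moreover have "{\<omega>\<in>space M. (SUP (g, m)\<in>H. ereal \<bar>(emp_risk \<tau> t n (\<lambda>r. X r \<omega>) g - emp_risk \<tau> t n (\<lambda>r. X r \<omega>) G) - R g\<bar>) \<le> ereal eps}
    = Y -` C \<inter> space M"
    unfolding emp C_def by (simp add: SUP_le_iff case_prod_beta vimage_def Int_def conj_commute)
  ultimately show ?thesis by simp
qed

lemma uniform_deviation:
  fixes H :: "('d, 'b) hyp_class" and t :: "nat \<Rightarrow> real" and n p J N :: nat
    and mask :: "(real^'d^'d, 'b) vec"
  assumes adm: "admissible_class H" and truth: "(G, mask) \<in> H"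
    and S_inv: "invertible S"
    and drift_L2: "integrable M (\<lambda>\<omega>. (norm (G (Z 0 \<omega>)))\<^sup>2)"
    and risk: "\<forall>(g, m)\<in>H. integrable \<mu> (\<lambda>z. (norm (g z - G z))\<^sup>2)"
    and nets: "\<forall>r\<ge>1. \<forall>e>0. \<exists>A. internal_net H (K_ball c r) e A"
    and diam_L2: "integrable \<mu> (\<lambda>z. (class_diam H z)\<^sup>2)"
    and grid: "is_grid t n T" and horizon: "T > tau_max \<tau>" and start: "\<exists>k\<le>n. t k = tau_max \<tau>"
    and To: "To = obs_time \<tau> t n"
    and rate: "lam_erg > 0" and mixing: "\<forall>u>0. beta_mixing M Z u \<le> C_beta * exp (- lam_erg * u)"
    and \<eta>: "0 < \<eta>" "\<eta> < 1" and p: "p \<ge> 1" and \<epsilon>: "\<epsilon> > 0"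
    and J: "J = max 1 (nat \<lceil>To\<rceil>)"
    and rho: "ennreal \<rho> \<ge> max 1 (ennreal_root (2 * p)
           (of_nat J * of_nat CARD('b) ^ p * moment_sup M (tau_max \<tau>) X c p / ennreal \<eta>))"
    and b: "b = max 1 (1 / lam_erg * ln (C_beta * real J / \<eta>))"
    and N: "N = covering_number H (K_ball c \<rho>) \<epsilon>"
    and Lambda: "\<Lambda> = ln (4 * real N / \<eta>)"
    and m_E: "m_E = sqrt (\<integral>z. (class_diam H z)\<^sup>2 \<partial>\<mu>)"
    and E_rho: "E_rho = max 1 (SUP z\<in>K_ball c \<rho>. class_diam H z)"
    and v_rho: "v_rho = (LINT z:- K_ball c \<rho>|\<mu>. (class_diam H z)\<^sup>2)"
    and eps_n: "eps_n = 2 * m_E * To / \<eta> * drift_modulus M Z G (mesh_max t n)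
              + 2 * op_norm S * E_rho * sqrt (2 * To * \<Lambda>)
              + 2 * \<epsilon> * frob_norm S / \<eta> * (\<Sum>k\<in>obs_index \<tau> t n. sqrt (mesh t k))
              + E_rho\<^sup>2 * sqrt (2 * To * (b + mesh_max t n) * \<Lambda>)
              + 4 * E_rho * \<epsilon> * To + v_rho * To"
  shows "prob {\<omega>\<in>space M. (SUP (g, m)\<in>H. ereal \<bar>(emp_risk \<tau> t n (\<lambda>r. X r \<omega>) g - emp_risk \<tau> t n (\<lambda>r. X r \<omega>) G)
                                  - To * L2_dist_sq \<mu> g G\<bar>) \<le> ereal eps_n} \<ge> 1 - 6 * \<eta>"
    (is "prob ?good \<ge> _")
proof -
  let ?I = "obs_index \<tau> t n" and ?K = "K_ball c \<rho> :: ((real^'d, 'b) vec) set" and ?e = "class_diam H"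
  interpret \<mu>: prob_space \<mu> by (rule law_prob_space)
  have "ennreal 1 \<le> ennreal \<rho>" using rho by simp
  then have \<rho>: "1 \<le> \<rho>" unfolding ennreal_le_iff2 by auto
  have To_eq: "To = T - tau_max \<tau>" unfolding To by (rule obs_time_eq[OF grid start])
  have To0: "0 < To" using horizon To_eq by simp
  have ToJ: "To \<le> real J" unfolding J by linarith
  have J1: "1 \<le> J" by (simp add: J)
  have n: "0 < n" using horizon tau_max_nonneg grid by (intro gr0I) (auto simp: is_grid_def)
  have GH: "G \<in> fst ` H" using truth by force
  have finI: "finite ?I" by simp
  have kI: "k < n" "0 \<le> t k" "t k \<le> t (Suc k)" "0 < mesh t k" "tau_max \<tau> \<le> t k" "t k < T" if "k \<in> ?I" for k
    using that grid_nonneg[OF grid, of k] grid_step[OF grid, of k] mesh_pos[OF grid, of k] grid_mono[OF grid, of "Suc k" n] grid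
    by (auto simp: obs_index_def is_grid_def)
  obtain A0 where A0: "internal_net H ?K \<epsilon> A0" using nets \<rho> \<epsilon> by blast
  obtain A where A: "internal_net H ?K \<epsilon> A" and cardA: "card A = N"
    using covering_number_net[OF A0] N by metis
  have A': "finite A" "A \<subseteq> fst ` H" "\<And>g. g \<in> fst ` H \<Longrightarrow> \<exists>g'\<in>A. \<forall>z\<in>?K. norm (g z - g' z) \<le> \<epsilon>"
    using A unfolding internal_net_def by blast+
  have "A \<noteq> {}" using A'(3)[OF GH] by blast
  then have N1: "1 \<le> real N" using A'(1) cardA by (metis One_nat_def Suc_leI card_gt_0_iff of_nat_1 of_nat_mono)
  have \<Lambda>: "exp (- \<Lambda>) = \<eta> / (4 * real N)" "0 \<le> \<Lambda>"
  proof -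
    have "0 < 4 * real N / \<eta>" using N1 \<eta> by simp
    then show "exp (- \<Lambda>) = \<eta> / (4 * real N)" unfolding Lambda exp_minus by (simp add: exp_ln)
    have "1 \<le> 4 * real N / \<eta>" using N1 \<eta> by (simp add: le_divide_eq)
    then show "0 \<le> \<Lambda>" unfolding Lambda by simp
  qed
  have diam: "norm (g z - g' z) \<le> ?e z" if "g \<in> fst ` H" "g' \<in> fst ` H" for g g' z
    by (rule class_diam_pointwise[OF adm nets that])
  have e0: "0 \<le> ?e z" for z using diam[OF GH GH, of z] by simp
  \<comment> \<open>The diameter is a supremum over a possibly uncountable class; its measurability
    is read off from the integrability of its square, whose root is the diameter because the
    diameter is non-negative.\<close>
  have eM: "?e \<in> borel_measurable borel"
  proof -
    have "(\<lambda>z. (?e z)\<^sup>2) \<in> borel_measurable borel"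
      using borel_measurable_integrable[OF diam_L2] by (simp add: measurable_law)
    then have "(\<lambda>z. sqrt ((?e z)\<^sup>2)) \<in> borel_measurable borel" by measurable
    then show ?thesis using e0 by simp
  qed
  have E1: "1 \<le> E_rho" by (simp add: E_rho)
  have eE: "?e z \<le> E_rho" if "z \<in> ?K" for z
  proof -
    have "bdd_above (?e ` ?K)" by (rule class_diam_bdd_above[OF A adm compact_K_ball]) (use truth in auto)
    from cSUP_upper[OF that this] show ?thesis unfolding E_rho by simp
  qed
  have KE: "norm (g z - G z) \<le> E_rho" if "g \<in> fst ` H" "z \<in> ?K" for g z
    using diam[OF that(1) GH, of z] eE[OF that(2)] by linarith
  have cM: "g \<in> borel_measurable borel" if "g \<in> fst ` H" for g
    using class_continuous[OF adm that] by (rule borel_measurable_continuous_onI)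
  define b1 where "b1 = m_E * To / \<eta> * drift_modulus M Z G (mesh_max t n)"
  define b2 where "b2 = op_norm S * E_rho * sqrt (2 * To * \<Lambda>)"
  define b3 where "b3 = frob_norm S / \<eta> * (\<Sum>k\<in>?I. sqrt (mesh t k))"
  define b4 where "b4 = E_rho\<^sup>2 * sqrt (2 * To * (b + mesh_max t n) * \<Lambda>)"
  \<comment> \<open>The term \<open>4 * E_rho * \<epsilon> * To\<close> is used in two halves, for
    passing to the net member in the empirical and in the population quadratic term.\<close>
  have eps: "eps_n = 2 * b1 + 2 * b2 + 2 * \<epsilon> * b3 + b4 + 2 * E_rho * \<epsilon> * To + (2 * E_rho * \<epsilon> + v_rho) * To"
    unfolding eps_n b1_def b2_def b3_def b4_def by (simp add: algebra_simps)
  define \<Xi> where "\<Xi> \<omega> = (\<Sum>k\<in>?I. \<integral>\<^sup>+r\<in>{t k..t (Suc k)}. ennreal (norm (G (Z r \<omega>) - G (Z (t k) \<omega>)) * ?e (Z (t k) \<omega>)) \<partial>lborel)" for \<omega>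
  define nz where "nz k \<omega> = S *v (W (t (Suc k)) \<omega> - W (t k) \<omega>)" for k \<omega>
  \<comment> \<open>Both families are cut off outside the ball and hence bounded by
    \<open>E_rho\<close> and its square everywhere; off \<open>B2\<close> the cut is invisible at
    the observations.\<close>
  define \<psi> where "\<psi> g' = (\<lambda>z. indicator ?K z *\<^sub>R (g' z - G z))" for g' :: "(real^'d, 'b) vec \<Rightarrow> real^'d"
  define \<phi> where "\<phi> g' = (\<lambda>z. indicator ?K z * (norm (g' z - G z))\<^sup>2)" for g' :: "(real^'d, 'b) vec \<Rightarrow> real^'d"
  define B1 where "B1 = {\<omega>\<in>space M. \<Xi> \<omega> > ennreal b1}"
  define B2 where "B2 = {\<omega>\<in>space M. \<exists>k\<in>?I. Z (t k) \<omega> \<notin> ?K}"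
  define B3 where "B3 = {\<omega>\<in>space M. (\<Sum>k\<in>?I. norm (nz k \<omega>)) > b3}"
  define B4 where "B4 = {\<omega>\<in>space M. \<exists>f\<in>\<psi> ` A. \<bar>\<Sum>k\<in>?I. nz k \<omega> \<bullet> f (Z (t k) \<omega>)\<bar> > b2}"
  define B5 where "B5 = {\<omega>\<in>space M. \<exists>f\<in>\<phi> ` A. \<bar>\<Sum>k\<in>?I. mesh t k * (f (Z (t k) \<omega>) - (\<integral>z. f z \<partial>\<mu>))\<bar> > b4}"
  have b1_0: "0 \<le> b1" and B1: "B1 \<in> sets M" "prob B1 \<le> \<eta>"
    using bias_deviation[OF drift_L2 eM e0 diam_L2 grid n \<eta>(1)] unfolding B1_def \<Xi>_def b1_def m_E To by blast+
  have B2M: "B2 \<in> sets M"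
    unfolding B2_def
  proof (rule sets.sets_Collect_finite_Ex[OF _ finI])
    fix k assume "k \<in> ?I"
    from measurable_sets[OF Z_measurable[OF kI(2)[OF this]] borel_comp[OF K_ball_borel[of c \<rho>]]]
    show "{\<omega>\<in>space M. Z (t k) \<omega> \<notin> ?K} \<in> sets M" by (simp add: vimage_def Int_def conj_commute)
  qed
  have B2: "prob B2 \<le> \<eta>"
    unfolding B2_def
  proof (rule tail_probability[OF _ finI \<rho> \<eta>(1) J1 p])
    show "?I \<subseteq> {k. tau_max \<tau> \<le> t k \<and> t k \<le> tau_max \<tau> + real J}"
      using kI(5,6) ToJ To_eq by fastforce
    show "ennreal_root (2 * p) (of_nat J * of_nat CARD('b) ^ p * moment_sup M (tau_max \<tau>) X c p / ennreal \<eta>) \<le> ennreal \<rho>"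
      using rho by simp
  qed
  have B3: "B3 \<in> sets M" "prob B3 \<le> \<eta>"
    using noise_deviation[OF grid \<eta>(1)] unfolding B3_def nz_def b3_def by blast+
  have \<psi>M: "f \<in> borel_measurable borel" "norm (f z) \<le> E_rho" if f: "f \<in> \<psi> ` A" for f z
  proof -
    obtain g' where "g' \<in> A" and g'2: "f = \<psi> g'" using f by (rule imageE)
    then have g'1: "g' \<in> fst ` H" using A'(2) by blast
    note [measurable] = cM[OF g'1]
    show "f \<in> borel_measurable borel" unfolding g'2 \<psi>_def by measurable
    show "norm (f z) \<le> E_rho" unfolding g'2 \<psi>_def using KE[OF g'1] E1 by (auto simp: indicator_def)
  qed
  have \<phi>M: "f \<in> borel_measurable borel" "f z \<in> {0..E_rho\<^sup>2}" if f: "f \<in> \<phi> ` A" for f z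
  proof -
    obtain g' where "g' \<in> A" and g'2: "f = \<phi> g'" using f by (rule imageE)
    then have g'1: "g' \<in> fst ` H" using A'(2) by blast
    note [measurable] = cM[OF g'1]
    show "f \<in> borel_measurable borel" unfolding g'2 \<phi>_def by measurable
    show "f z \<in> {0..E_rho\<^sup>2}" unfolding g'2 \<phi>_def using KE[OF g'1] by (auto simp: indicator_def intro!: power_mono)
  qed
  have E0: "0 < E_rho" "0 < E_rho\<^sup>2" using E1 by auto
  have card4: "real (card (f ` A)) * exp (- \<Lambda>) \<le> \<eta> / 4" for f :: "((real^'d, 'b) vec \<Rightarrow> real^'d) \<Rightarrow> 'z"
  proof -
    have "real (card (f ` A)) \<le> real N" using card_image_le[OF A'(1), of f] cardA by simp
    then have "real (card (f ` A)) * exp (- \<Lambda>) \<le> real N * exp (- \<Lambda>)" by (rule mult_right_mono) simp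
    also have "\<dots> = \<eta> / 4" unfolding \<Lambda>(1) using N1 by simp
    finally show ?thesis .
  qed
  have B4: "B4 \<in> sets M" "prob B4 \<le> 2 * real (card (\<psi> ` A)) * exp (- \<Lambda>)"
  proof -
    note dev = martingale_deviation[where \<Phi> = "\<psi> ` A" and E = E_rho and t = t and n = n and T = T and \<Lambda> = \<Lambda>, folded To]
    show "B4 \<in> sets M"
      unfolding B4_def nz_def b2_def
      by (rule dev(1)) (rule finite_imageI[OF A'(1)] \<psi>M E0(1) grid To0 S_inv \<Lambda>(2) | assumption)+
    show "prob B4 \<le> 2 * real (card (\<psi> ` A)) * exp (- \<Lambda>)"
      unfolding B4_def nz_def b2_def
      by (rule dev(2)) (rule finite_imageI[OF A'(1)] \<psi>M E0(1) grid To0 S_inv \<Lambda>(2) | assumption)+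
  qed
  \<comment> \<open>This is what \<open>b\<close> is chosen for: \<open>J\<close> blocks at
    \<open>\<eta> / real J\<close> each cost \<open>\<eta>\<close> altogether. For a non-positive
    \<open>C_beta\<close> the logarithm carries no information, but the mixing bound is then
    non-positive itself.\<close>
  have \<beta>: "beta_mixing M Z b \<le> \<eta> / real J"
  proof -
    have b0: "0 < b" by (simp add: b)
    have "C_beta * exp (- lam_erg * b) \<le> \<eta> / real J"
    proof (cases "C_beta \<le> 0")
      case True
      then have "C_beta * exp (- lam_erg * b) \<le> 0" by (simp add: mult_nonpos_nonneg)
      then show ?thesis using \<eta> J1 by (meson divide_nonneg_nonneg less_imp_le of_nat_0_le_iff order_trans)
    next
      case False
      then have pos: "0 < C_beta * real J / \<eta>" using \<eta> J1 by simp
      have "1 / lam_erg * ln (C_beta * real J / \<eta>) \<le> b" by (simp add: b)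
      then have "ln (C_beta * real J / \<eta>) \<le> lam_erg * b" using rate by (simp add: field_simps)
      then have "exp (- lam_erg * b) \<le> exp (- ln (C_beta * real J / \<eta>))" by simp
      also have "\<dots> = \<eta> / (C_beta * real J)" using pos by (simp add: exp_minus exp_ln)
      finally have "C_beta * exp (- lam_erg * b) \<le> C_beta * (\<eta> / (C_beta * real J))"
        using False by (intro mult_left_mono) auto
      then show ?thesis using False by simp
    qed
    then show ?thesis using mixing b0 by (meson order_trans)
  qed
  have B5: "B5 \<in> sets M" "prob B5 \<le> real J * (\<eta> / real J) + 4 * real (card (\<phi> ` A)) * exp (- \<Lambda>)"
  proof -
    have *: "1 \<le> b" "0 \<le> \<eta> / real J" using \<eta> by (simp_all add: b)
    note dev = mixing_deviation[where \<Phi> = "\<phi> ` A" and C = "E_rho\<^sup>2" and t = t and n = n and T = T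
        and \<Lambda> = \<Lambda> and b = b and J = J and \<beta> = "\<eta> / real J", folded To]
    show "B5 \<in> sets M"
      unfolding B5_def b4_def
      by (rule dev(1)) (rule finite_imageI[OF A'(1)] \<phi>M E0(2) grid start horizon ToJ * \<beta> \<Lambda>(2) | assumption)+
    show "prob B5 \<le> real J * (\<eta> / real J) + 4 * real (card (\<phi> ` A)) * exp (- \<Lambda>)"
      unfolding B5_def b4_def
      by (rule dev(2)) (rule finite_imageI[OF A'(1)] \<phi>M E0(2) grid start horizon ToJ * \<beta> \<Lambda>(2) | assumption)+
  qed
  have good_M: "?good \<in> sets M" by (rule uniform_event_measurable[OF adm grid])
  \<comment> \<open>The integral equation holds almost surely only, so the inclusion in the
    exceptional events is up to a null set.\<close>
  have AE: "AE \<omega> in M. \<omega> \<in> space M - ?good \<longrightarrow> \<omega> \<in> B1 \<union> B2 \<union> B3 \<union> B4 \<union> B5"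
    using solution_increment
  proof eventually_elim
    case (elim \<omega>)
    show ?case
    proof (rule impI, rule ccontr)
      assume \<omega>: "\<omega> \<in> space M - ?good" and nB: "\<omega> \<notin> B1 \<union> B2 \<union> B3 \<union> B4 \<union> B5"
      have \<omega>M: "\<omega> \<in> space M" using \<omega> by simp
      have n1: "\<Xi> \<omega> \<le> ennreal b1" using nB \<omega>M by (auto simp: B1_def not_less)
      have n2: "Z (t k) \<omega> \<in> ?K" if "k \<in> ?I" for k using nB \<omega>M that by (auto simp: B2_def)
      have n3: "(\<Sum>k\<in>?I. norm (nz k \<omega>)) \<le> b3" using nB \<omega>M by (auto simp: B3_def not_less)
      have n4: "\<bar>\<Sum>k\<in>?I. nz k \<omega> \<bullet> \<psi> g' (Z (t k) \<omega>)\<bar> \<le> b2" if "g' \<in> A" for g' using nB \<omega>M that by (auto simp: B4_def not_less)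
      have n5: "\<bar>\<Sum>k\<in>?I. mesh t k * (\<phi> g' (Z (t k) \<omega>) - (\<integral>z. \<phi> g' z \<partial>\<mu>))\<bar> \<le> b4" if "g' \<in> A" for g'
        using nB \<omega>M that by (auto simp: B5_def not_less)
      \<comment> \<open>On each cell the weight depends on the left endpoint only, so it may be
        pulled into the time integral, which gives the summand of \<open>\<Xi>\<close>.\<close>
      have bias: "(\<Sum>k\<in>?I. norm (X (t (Suc k)) \<omega> - X (t k) \<omega> - nz k \<omega> - mesh t k *\<^sub>R G (Z (t k) \<omega>)) * ?e (Z (t k) \<omega>)) \<le> b1"
      proof -
        let ?D = "\<lambda>k. norm (X (t (Suc k)) \<omega> - X (t k) \<omega> - nz k \<omega> - mesh t k *\<^sub>R G (Z (t k) \<omega>))"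
          and ?G = "\<lambda>k r. norm (G (Z r \<omega>) - G (Z (t k) \<omega>))" and ?f = "\<lambda>k. ?e (Z (t k) \<omega>)"
        have "ennreal (\<Sum>k\<in>?I. ?D k * ?f k)
          = (\<Sum>k\<in>?I. ennreal (?D k * ?f k))"
          using e0 by (intro sum_ennreal[symmetric]) simp
        also have "\<dots> \<le> \<Xi> \<omega>"
          unfolding \<Xi>_def
        proof (rule sum_mono)
          fix k assume k: "k \<in> ?I"
          have c: "continuous_on {t k..t (Suc k)} (\<lambda>r. ?G k r)"
          proof (intro continuous_intros)
            show "continuous_on {t k..t (Suc k)} (\<lambda>r. G (Z r \<omega>))"
              by (rule continuous_on_compose2[OF drift_continuous continuous_on_subset[OF Z_continuous[OF \<omega>M]]]) (use kI(2)[OF k] in auto)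
          qed
          have cm: "(\<lambda>r. ennreal (?G k r) * indicator {t k..t (Suc k)} r) \<in> borel_measurable lborel"
          proof -
            have "(\<lambda>r. indicator {t k..t (Suc k)} r *\<^sub>R ?G k r) \<in> borel_measurable borel"
              using borel_measurable_continuous_on_indicator[OF _ c] by simp
            then have "(\<lambda>r. ennreal (indicator {t k..t (Suc k)} r *\<^sub>R ?G k r)) \<in> borel_measurable borel"
              by measurable
            also have "(\<lambda>r. ennreal (indicator {t k..t (Suc k)} r *\<^sub>R ?G k r))
              = (\<lambda>r. ennreal (?G k r) * indicator {t k..t (Suc k)} r)"
              by (auto simp: indicator_def)
            finally show ?thesis by simp
          qed
          have "ennreal (?D k * ?f k)
            = ennreal (?D k) * ennreal (?f k)"
            using e0 by (simp add: ennreal_mult)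
          also have "\<dots> \<le> (\<integral>\<^sup>+r\<in>{t k..t (Suc k)}. ennreal (?G k r) \<partial>lborel) * ennreal (?f k)"
            unfolding nz_def mesh_def using elim kI(2,3)[OF k] by (intro mult_right_mono) auto
          also have "\<dots> = (\<integral>\<^sup>+r\<in>{t k..t (Suc k)}. ennreal (?G k r * ?f k) \<partial>lborel)"
            unfolding nn_integral_multc[OF cm, symmetric]
            using e0 by (intro nn_integral_cong) (simp add: ennreal_mult mult_ac)
          finally show "ennreal (?D k * ?f k)
            \<le> (\<integral>\<^sup>+r\<in>{t k..t (Suc k)}. ennreal (?G k r * ?f k) \<partial>lborel)" .
        qed
        also have "\<dots> \<le> ennreal b1" by (rule n1)
        finally show ?thesis using b1_0 by (subst (asm) ennreal_le_iff) auto
      qed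
      have "\<bar>(emp_risk \<tau> t n (\<lambda>r. X r \<omega>) g - emp_risk \<tau> t n (\<lambda>r. X r \<omega>) G) - To * L2_dist_sq \<mu> g G\<bar> \<le> eps_n"
        if gm: "(g, m) \<in> H" for g m
      proof -
        have g: "g \<in> fst ` H" using gm by force
        obtain g' where g': "g' \<in> A" "\<And>z. z \<in> ?K \<Longrightarrow> norm (g z - g' z) \<le> \<epsilon>" using A'(3)[OF g] by blast
        have g'H: "g' \<in> fst ` H" using g'(1) A'(2) by blast
        have q: "\<bar>L2_dist_sq \<mu> g G - (\<integral>z. \<phi> g' z \<partial>\<mu>)\<bar> \<le> 2 * E_rho * \<epsilon> + v_rho"
          unfolding \<phi>_def v_rho
          by (rule truncated_risk_difference[OF law_prob_space sets_law cM[OF g] cM[OF g'H] cM[OF GH] eM K_ball_borel _ diam_L2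
               KE[OF g] KE[OF g'H] g'(2) less_imp_le[OF \<epsilon>] less_imp_le[OF E0(1)] diam[OF g GH]])
             (use risk gm in auto)
        have \<psi>K: "\<psi> g' (Z (t k) \<omega>) = g' (Z (t k) \<omega>) - G (Z (t k) \<omega>)"
          and \<phi>K: "\<phi> g' (Z (t k) \<omega>) = (norm (g' (Z (t k) \<omega>) - G (Z (t k) \<omega>)))\<^sup>2" if "k \<in> ?I" for k
          using n2[OF that] by (simp_all add: \<psi>_def \<phi>_def)
        have m4: "\<bar>\<Sum>k\<in>?I. nz k \<omega> \<bullet> (g' (Z (t k) \<omega>) - G (Z (t k) \<omega>))\<bar> \<le> b2"
          using n4[OF g'(1)] by (simp add: \<psi>K cong: sum.cong)
        have m5: "\<bar>\<Sum>k\<in>?I. mesh t k * ((norm (g' (Z (t k) \<omega>) - G (Z (t k) \<omega>)))\<^sup>2 - (\<integral>z. \<phi> g' z \<partial>\<mu>))\<bar> \<le> b4"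
          using n5[OF g'(1)] by (simp add: \<phi>K cong: sum.cong)
        have "\<bar>((\<Sum>k\<in>?I. mesh t k * (norm ((X (t (Suc k)) \<omega> - X (t k) \<omega>) /\<^sub>R mesh t k - g (Z (t k) \<omega>)))\<^sup>2)
          - (\<Sum>k\<in>?I. mesh t k * (norm ((X (t (Suc k)) \<omega> - X (t k) \<omega>) /\<^sub>R mesh t k - G (Z (t k) \<omega>)))\<^sup>2)) - (\<Sum>k\<in>?I. mesh t k) * L2_dist_sq \<mu> g G\<bar>
          \<le> 2 * b1 + 2 * b2 + 2 * \<epsilon> * b3 + b4 + 2 * E_rho * \<epsilon> * (\<Sum>k\<in>?I. mesh t k) + (2 * E_rho * \<epsilon> + v_rho) * (\<Sum>k\<in>?I. mesh t k)"
          by (rule risk_difference_bound[where x = "\<lambda>r. X r \<omega>" and z = "\<lambda>k. Z (t k) \<omega>" and N = "\<lambda>k. nz k \<omega>" and e = "\<lambda>k. ?e (Z (t k) \<omega>)",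
               OF finI kI(4) bias diam[OF g GH] KE[OF g n2] KE[OF g'H n2] g'(2)[OF n2] m4 n3 m5 q less_imp_le[OF \<epsilon>]])
        then show ?thesis
          unfolding emp_risk_Z eps To obs_time_def .
      qed
      then have "\<omega> \<in> ?good" using \<omega>M by (auto simp: SUP_le_iff)
      then show False using \<omega> by simp
    qed
  qed
  have "prob (space M - ?good) \<le> prob (B1 \<union> B2 \<union> B3 \<union> B4 \<union> B5)"
    using B1(1) B2M B3(1) B4(1) B5(1) by (intro finite_measure_mono_AE[OF AE]) auto
  also have "\<dots> \<le> prob B1 + prob B2 + prob B3 + prob B4 + prob B5"
    using B1(1) B2M B3(1) B4(1) B5(1)
    by (intro order_trans[OF measure_Un_le] add_mono order_refl sets.Un)
  \<comment> \<open>Bias, tail and noise cost \<open>\<eta>\<close> each. As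
    \<open>N * exp (- \<Lambda>)\<close> is \<open>\<eta> / 4\<close>, the martingale costs half of
    \<open>\<eta>\<close> and the concentration twice \<open>\<eta>\<close>, of which one is mixing;
    the total of 5.5 \<open>\<eta>\<close> is below 6 \<open>\<eta>\<close>.\<close>
  also have "\<dots> \<le> \<eta> + \<eta> + \<eta> + 2 * real (card (\<psi> ` A)) * exp (- \<Lambda>) + (real J * (\<eta> / real J) + 4 * real (card (\<phi> ` A)) * exp (- \<Lambda>))"
    using B1(2) B2 B3(2) B4(2) B5(2) by (intro add_mono)
  also have "\<dots> \<le> 6 * \<eta>"
    using card4[of \<psi>] card4[of \<phi>] J1 \<eta> by simp
  finally have "prob (space M - ?good) \<le> 6 * \<eta>" .
  then show ?thesis using prob_compl[OF good_M] by simp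
qed

end


section \<open>Support recovery\<close>

theorem theorem4:
  fixes M :: "'w measure"
    and F :: "real \<Rightarrow> 'w measure"
    and \<tau> :: "'b::{finite,linorder} \<Rightarrow> real"
    and f :: "'d::finite \<Rightarrow> (real^'d, 'b) vec \<Rightarrow> real"
    and mask :: "(real^'d^'d, 'b) vec"
    and G :: "(real^'d, 'b) vec \<Rightarrow> real^'d"
    and S :: "real^'d^'d"
    and W X :: "real \<Rightarrow> 'w \<Rightarrow> real^'d"
    and Z :: "real \<Rightarrow> 'w \<Rightarrow> (real^'d, 'b) vec"
    and P :: "real \<Rightarrow> (real \<Rightarrow> real^'d) \<Rightarrow> (real \<Rightarrow> real^'d) measure"
    and \<pi> :: "(real \<Rightarrow> real^'d) measure"
    and \<mu> :: "((real^'d, 'b) vec) measure"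
    and c :: "real^'d"
    and H :: "('d, 'b) hyp_class"
    and t :: "nat \<Rightarrow> real" and n p J N :: nat
    and T To \<delta> \<eta> \<rho> \<epsilon> b \<Lambda> C_beta lam_erg E_rho v_rho m_E eps_n :: real
  assumes prob_space: "prob_space M"
    and delays: "is_delays \<tau>"
    and mask: "is_mask mask"
    and drift: "G = masked_drift f mask"
    and brownian: "brownian_motion M F W"
    and delay_process: "Z = (\<lambda>s \<omega>. delay_vec \<tau> (\<lambda>r. X r \<omega>) s)"
    and kernel: "segment_kernel M F \<tau> G S W P"
    and invariant: "invariant_measure (segment_space (tau_max \<tau>)) P \<pi>"
    and law: "\<mu> = stationary_law \<tau> \<pi>"
    and noise_invertible: "invertible S"
    and stationary: "stationary_solution M F \<tau> G S W \<pi> X"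
    and drift_L2: "integrable M (\<lambda>\<omega>. (norm (G (Z 0 \<omega>)))\<^sup>2)"
    and f_lipschitz: "\<forall>j. locally_lipschitz (f j)"
    and coercive: "coercive_drift G"
    and dissipative: "dissipative_drift c G"
    and class_admissible: "admissible_class H"
    and truth_in_class: "(G, mask) \<in> H"
    and class_risk_finite: "\<forall>(g, m)\<in>H. integrable \<mu> (\<lambda>z. (norm (g z - G z))\<^sup>2)"
    and class_nets: "\<forall>r\<ge>1. \<forall>e>0. \<exists>A. internal_net H (K_ball c r) e A"
    and class_diam_L2: "integrable \<mu> (\<lambda>z. (class_diam H z)\<^sup>2)"
    and grid: "is_grid t n T"
    and horizon: "T > tau_max \<tau>"
    and tau_max_on_grid: "\<exists>k\<le>n. t k = tau_max \<tau>"
    and mesh_le_1: "mesh_max t n \<le> 1"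
    and To: "To = obs_time \<tau> t n"
    and rate_pos: "lam_erg > 0"
    and mixing: "\<forall>u>0. beta_mixing M Z u \<le> C_beta * exp (- lam_erg * u)"
    and delta_pos: "0 < \<delta>"
    and delta_less: "\<delta> < 1"
    and p_ge_1: "p \<ge> 1"
    and eps_pos: "\<epsilon> > 0"
    and eta: "\<eta> = \<delta> / 6"
    and J: "J = max 1 (nat \<lceil>To\<rceil>)"
    and rho: "ennreal \<rho> \<ge> max 1 (ennreal_root (2 * p)
           (of_nat J * of_nat CARD('b) ^ p * moment_sup M (tau_max \<tau>) X c p / ennreal \<eta>))"
    and b: "b = max 1 (1 / lam_erg * ln (C_beta * real J / \<eta>))"
    and N: "N = covering_number H (K_ball c \<rho>) \<epsilon>"
    and Lambda: "\<Lambda> = ln (4 * real N / \<eta>)"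
    and m_E: "m_E = sqrt (\<integral>z. (class_diam H z)\<^sup>2 \<partial>\<mu>)"
    and E_rho: "E_rho = max 1 (SUP z\<in>K_ball c \<rho>. class_diam H z)"
    and v_rho: "v_rho = (LINT z:- K_ball c \<rho>|\<mu>. (class_diam H z)\<^sup>2)"
    and eps_n: "eps_n = 2 * m_E * To / \<eta> * drift_modulus M Z G (mesh_max t n)
              + 2 * op_norm S * E_rho * sqrt (2 * To * \<Lambda>)
              + 2 * \<epsilon> * frob_norm S / \<eta> * (\<Sum>k\<in>obs_index \<tau> t n. sqrt (mesh t k))
              + E_rho\<^sup>2 * sqrt (2 * To * (b + mesh_max t n) * \<Lambda>)
              + 4 * E_rho * \<epsilon> * To + v_rho * To"
  shows "measure M {\<omega>\<in>space M.
             (SUP (g, m)\<in>H. ereal \<bar>(emp_risk \<tau> t n (\<lambda>r. X r \<omega>) g - emp_risk \<tau> t n (\<lambda>r. X r \<omega>) G)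
                                  - To * L2_dist_sq \<mu> g G\<bar>) \<le> ereal eps_n} \<ge> 1 - \<delta>
       \<and> (\<forall>lam Gh Mh.
            mask \<noteq> 0 \<longrightarrow> s_min \<mu> G mask > 0 \<longrightarrow>
            0 < lam \<longrightarrow> lam < To * (s_min \<mu> G mask)\<^sup>2 / real (d_max mask) \<longrightarrow>
            eps_n < min lam (To * (s_min \<mu> G mask)\<^sup>2 - lam * real (d_max mask)) \<longrightarrow>
            (\<forall>z. (\<lambda>\<omega>. Gh \<omega> z) \<in> borel_measurable M) \<longrightarrow>
            Mh \<in> borel_measurable M \<longrightarrow>
            (\<forall>\<omega>\<in>space M. (Gh \<omega>, Mh \<omega>) \<in> H \<and>
               (\<forall>(g, m)\<in>H.
                  emp_risk \<tau> t n (\<lambda>r. X r \<omega>) (Gh \<omega>) + lam * real (\<Sum>a\<in>UNIV. mat_l0 (Mh \<omega> $ a))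
                  \<le> emp_risk \<tau> t n (\<lambda>r. X r \<omega>) g + lam * real (\<Sum>a\<in>UNIV. mat_l0 (m $ a)))) \<longrightarrow>
            measure M {\<omega>\<in>space M. (\<forall>a. Mh \<omega> $ a = mask $ a) \<and>
                         L2_dist_sq \<mu> (Gh \<omega>) G \<le> eps_n / To} \<ge> 1 - \<delta>)"
proof -
  have G_cont: "continuous_on UNIV G"
    using class_continuous[OF class_admissible, of G] truth_in_class by force
  interpret sd: stationary_sdde M F \<tau> G S W X P \<pi> \<mu>
    by (intro stationary_sdde.intro stationary_sdde_axioms.intro
        prob_space delays brownian kernel invariant law stationary G_cont)
  have Z_eq: "sd.Z = Z" by (intro ext) (simp add: sd.Z_def delay_process)
  have \<eta>: "0 < \<eta>" "\<eta> < 1" using eta delta_pos delta_less by auto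
  let ?dev = "\<lambda>\<omega> g. \<bar>(emp_risk \<tau> t n (\<lambda>r. X r \<omega>) g - emp_risk \<tau> t n (\<lambda>r. X r \<omega>) G) - To * L2_dist_sq \<mu> g G\<bar>"
  define A where "A = {\<omega>\<in>space M. (SUP (g, m)\<in>H. ereal (?dev \<omega> g)) \<le> ereal eps_n}"
  have "1 - 6 * \<eta> \<le> measure M A"
    unfolding A_def
    by (rule sd.uniform_deviation[unfolded Z_eq, OF class_admissible truth_in_class noise_invertible drift_L2 class_risk_finite
          class_nets class_diam_L2 grid horizon tau_max_on_grid To rate_pos mixing \<eta> p_ge_1 eps_pos J rho b N Lambda m_E E_rho v_rho eps_n])
  then have part1: "1 - \<delta> \<le> measure M A" by (simp add: eta)
  have dev: "?dev \<omega> g \<le> eps_n" if "\<omega> \<in> A" "(g, m) \<in> H" for \<omega> g m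
    using that unfolding A_def by (auto simp: SUP_le_iff)
  have To0: "0 < To" using horizon unfolding To obs_time_eq[OF grid tau_max_on_grid] by simp
  have G2: "integrable \<mu> (\<lambda>z. (norm (G z))\<^sup>2)"
    unfolding sd.Z_law[OF order_refl, symmetric] using sd.Z_measurable[of 0] drift_L2
    by (subst integrable_distr_eq) (auto simp: Z_eq)
  have part2: "1 - \<delta> \<le> measure M {\<omega>\<in>space M. (\<forall>a. Mh \<omega> $ a = mask $ a) \<and> L2_dist_sq \<mu> (Gh \<omega>) G \<le> eps_n / To}"
    if s: "0 < s_min \<mu> G mask" and lam: "0 < lam" "lam < To * (s_min \<mu> G mask)\<^sup>2 / real (d_max mask)"
      and eps: "eps_n < min lam (To * (s_min \<mu> G mask)\<^sup>2 - lam * real (d_max mask))"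
      and Gh: "\<forall>z. (\<lambda>\<omega>. Gh \<omega> z) \<in> borel_measurable M" and Mh: "Mh \<in> borel_measurable M"
      and argmin: "\<forall>\<omega>\<in>space M. (Gh \<omega>, Mh \<omega>) \<in> H \<and>
         (\<forall>(g, m)\<in>H. emp_risk \<tau> t n (\<lambda>r. X r \<omega>) (Gh \<omega>) + lam * real (\<Sum>a\<in>UNIV. mat_l0 (Mh \<omega> $ a))
            \<le> emp_risk \<tau> t n (\<lambda>r. X r \<omega>) g + lam * real (\<Sum>a\<in>UNIV. mat_l0 (m $ a)))"
    for lam Gh Mh
  proof -
    interpret \<mu>: prob_space \<mu> by (rule sd.law_prob_space)
    let ?T = "{\<omega>\<in>space M. (\<forall>a. Mh \<omega> $ a = mask $ a) \<and> L2_dist_sq \<mu> (Gh \<omega>) G \<le> eps_n / To}"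
    have GhH: "(Gh \<omega>, Mh \<omega>) \<in> H" if "\<omega> \<in> space M" for \<omega> using argmin that by blast
    \<comment> \<open>The estimator is measurable for each fixed \<open>z\<close>; its distance to
      \<open>G\<close> is an integral over \<open>z\<close> and needs joint measurability, supplied
      by continuity of the members of the class.\<close>
    have "(\<lambda>(\<omega>, z). Gh \<omega> z) \<in> borel_measurable (M \<Otimes>\<^sub>M borel)"
    proof (rule measurable_Caratheodory)
      show "(\<lambda>\<omega>. Gh \<omega> z) \<in> borel_measurable M" for z using Gh by blast
      show "continuous_on UNIV (Gh \<omega>)" if "\<omega> \<in> space M" for \<omega>
        using class_continuous[OF class_admissible, of "Gh \<omega>"] GhH[OF that] by force
    qed
    then have [measurable]: "(\<lambda>p. Gh (fst p) (snd p)) \<in> borel_measurable (M \<Otimes>\<^sub>M borel)"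
      by (simp add: case_prod_beta)
    have "(\<lambda>p. (norm (Gh (fst p) (snd p) - G (snd p)))\<^sup>2) \<in> borel_measurable (M \<Otimes>\<^sub>M borel)"
      by measurable
    then have "(\<lambda>(\<omega>, z). (norm (Gh \<omega> z - G z))\<^sup>2) \<in> borel_measurable (M \<Otimes>\<^sub>M \<mu>)"
      by (simp add: case_prod_beta measurable_cong_sets[OF sets_pair_measure_cong[OF refl sd.sets_law] refl])
    from \<mu>.borel_measurable_lebesgue_integral[OF this]
    have [measurable]: "(\<lambda>\<omega>. L2_dist_sq \<mu> (Gh \<omega>) G) \<in> borel_measurable M" unfolding L2_dist_sq_def .
    have "{\<omega>\<in>space M. Mh \<omega> = mask} \<in> sets M"
      using measurable_sets[OF Mh, of "{mask}"] by (simp add: vimage_def Int_def conj_commute)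
    moreover have "{\<omega>\<in>space M. L2_dist_sq \<mu> (Gh \<omega>) G \<le> eps_n / To} \<in> sets M" by measurable
    ultimately have "{\<omega>\<in>space M. Mh \<omega> = mask} \<inter> {\<omega>\<in>space M. L2_dist_sq \<mu> (Gh \<omega>) G \<le> eps_n / To} \<in> sets M"
      by (rule sets.Int)
    also have "{\<omega>\<in>space M. Mh \<omega> = mask} \<inter> {\<omega>\<in>space M. L2_dist_sq \<mu> (Gh \<omega>) G \<le> eps_n / To} = ?T"
      by (auto simp: vec_eq_iff)
    finally have T: "?T \<in> sets M" .
    \<comment> \<open>Recovery is deterministic on the event of the first part, so no further
      probability is spent.\<close>
    have "A \<subseteq> ?T"
    proof
      fix \<omega> assume \<omega>: "\<omega> \<in> A"
      then have \<omega>M: "\<omega> \<in> space M" by (simp add: A_def)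
      note gH = GhH[OF \<omega>M]
      have risk: "integrable \<mu> (\<lambda>z. (norm (Gh \<omega> z - G z))\<^sup>2)" using class_risk_finite gH by blast
      have le: "emp_risk \<tau> t n (\<lambda>r. X r \<omega>) (Gh \<omega>) + lam * real (\<Sum>a\<in>UNIV. mat_l0 (Mh \<omega> $ a))
          \<le> emp_risk \<tau> t n (\<lambda>r. X r \<omega>) G + lam * real (\<Sum>a\<in>UNIV. mat_l0 (mask $ a))"
        using argmin \<omega>M truth_in_class by blast
      have "Mh \<omega> = mask" "L2_dist_sq \<mu> (Gh \<omega>) G \<le> eps_n / To"
        by (rule support_recovery[OF sd.law_prob_space sd.sets_law class_admissible truth_in_class gH G2 risk To0 lam s eps
              dev[OF \<omega> gH] le])+
      then show "\<omega> \<in> ?T" using \<omega>M by simp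
    qed
    then have "measure M A \<le> measure M ?T" by (rule sd.finite_measure_mono[OF _ T])
    then show ?thesis using part1 by simp
  qed
  show ?thesis
    using part1 part2 unfolding A_def by blast
qed

end
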